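(* Consider the following two assertions. (A) For every finite separable field extension $L|K$ and every valuation $\omega$ on $L$ with restriction $\nu$ to $K$ such that $d(\omega|\nu)=1$ and $\epsilon(\omega|\nu)=e(\omega|\nu)$, the ring $\mathcal{O}_\omega$ is essentially finitely generated over $\mathcal{O}_\nu$. (B) For every finite field extension $L|K$ and every valuation $\omega$ on $L$ with restriction $\nu$ to $K$ such that $d(\omega|\nu)=1$ and $\epsilon(\omega|\nu)=e(\omega|\nu)$, the ring $\mathcal{O}_\omega$ is essentially finitely generated over $\mathcal{O}_\nu$. If (A) is true, then (B) is true.
   Context: For a finite field extension $L|K$ and a valuation $\omega$ on $L$ with restriction $\nu$ to $K$: $\mathcal{O}_\omega,\mathcal{O}_\nu$ are the valuation rings, $\Gamma_\omega\supseteq\Gamma_\nu$ the value groups (totally ordered abelian groups), $L\omega\supseteq K\nu$ the residue fields. Put $e(\omega|\nu)=(\Gamma_\omega:\Gamma_\nu)$ and $f(\omega|\nu)=[L\omega:K\nu]$. Initial index: for an extension $\Delta\subseteq\Gamma$ of ordered abelian groups, $\epsilon(\Gamma\mid\Delta)=|\{\gamma\in\Gamma\mid \gamma\ge 0 \text{ and } \gamma<\delta\text{ for all }\delta\in\Delta\text{ with }\delta>0\}|$; and $\epsilon(\omega|\nu)=\epsilon(\Gamma_\omega\mid\Gamma_\nu)$. Defect: fix an extension $\overline\nu$ of $\omega$ to an algebraic closure $\overline K$ of $L$. The henselization $K^h$ of $(K,\nu)$ is the smallest field with $K\subseteq K^h\subseteq\overline K$ such that $\overline\nu$ is the only extension of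 $\overline\nu|_{K^h}$ to $\overline K$; $L^h$ is defined likewise for $(L,\omega)$. The defect is $d(\omega|\nu)=\dfrac{[L^h:K^h]}{e(\omega|\nu)f(\omega|\nu)}$, a positive integer. A ring extension $A\subseteq B$ is essentially finitely generated if there are $x_1,\ldots,x_r\in B$ and a multiplicative set $S\subseteq A[x_1,\ldots,x_r]$ with $B=S^{-1}A[x_1,\ldots,x_r]$. *)

theory Defs
  imports Complex_Main "HOL-Algebra.Algebraic_Closure" "HOL-Algebra.Generated_Rings"
begin

text \<open>
  Totally ordered abelian groups as objects with a carrier. HOL-Algebra writes abelian groups
  multiplicatively, so the group operation \<open>\<otimes>\<close> and the unit \<open>\<one>\<close> stand for the \<open>+\<close> and the \<open>0\<close> of
  a value group. The orientation of the order is that of additive valuations.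
\<close>

record 'g ordered_group = "'g monoid" +
  leq :: "'g \<Rightarrow> 'g \<Rightarrow> bool" (infixl "\<preceq>\<index>" 50)

locale ordered_abelian_group = comm_group G
  for G :: "('g, 'h) ordered_group_scheme" (structure) +
  assumes leq_refl: "a \<in> carrier G \<Longrightarrow> a \<preceq> a"
    and leq_antisym: "\<lbrakk>a \<preceq> b; b \<preceq> a; a \<in> carrier G; b \<in> carrier G\<rbrakk> \<Longrightarrow> a = b"
    and leq_trans:
      "\<lbrakk>a \<preceq> b; b \<preceq> c; a \<in> carrier G; b \<in> carrier G; c \<in> carrier G\<rbrakk> \<Longrightarrow> a \<preceq> c"
    and leq_total: "\<lbrakk>a \<in> carrier G; b \<in> carrier G\<rbrakk> \<Longrightarrow> a \<preceq> b \<or> b \<preceq> a"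
    and leq_mult:
      "\<lbrakk>a \<preceq> b; a \<in> carrier G; b \<in> carrier G; c \<in> carrier G\<rbrakk> \<Longrightarrow> a \<otimes> c \<preceq> b \<otimes> c"

definition lt :: "('g, 'h) ordered_group_scheme \<Rightarrow> 'g \<Rightarrow> 'g \<Rightarrow> bool" (infixl "\<prec>\<index>" 50)
  where "a \<prec>\<^bsub>G\<^esub> b \<longleftrightarrow> a \<preceq>\<^bsub>G\<^esub> b \<and> a \<noteq> b"

text \<open>
  A valuation is given by its values on nonzero elements; the value \<open>\<infinity>\<close> of \<open>0\<close> is implicit
  (the function value at \<open>0\<close> is irrelevant). The third axiom is
  \<open>v (x + y) \<ge> min (v x) (v y)\<close>. The map need not be onto \<open>G\<close>: the value group is the image.
\<close>

locale valuation = field F + ordered_abelian_group G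
  for F :: "('a, 'b) ring_scheme" and G :: "('g, 'h) ordered_group_scheme" and v :: "'a \<Rightarrow> 'g" +
  assumes val_closed: "x \<in> carrier F - {\<zero>\<^bsub>F\<^esub>} \<Longrightarrow> v x \<in> carrier G"
    and val_mult: "\<lbrakk>x \<in> carrier F - {\<zero>\<^bsub>F\<^esub>}; y \<in> carrier F - {\<zero>\<^bsub>F\<^esub>}\<rbrakk>
      \<Longrightarrow> v (x \<otimes>\<^bsub>F\<^esub> y) = v x \<otimes>\<^bsub>G\<^esub> v y"
    and val_add: "\<lbrakk>x \<in> carrier F - {\<zero>\<^bsub>F\<^esub>}; y \<in> carrier F - {\<zero>\<^bsub>F\<^esub>}; x \<oplus>\<^bsub>F\<^esub> y \<noteq> \<zero>\<^bsub>F\<^esub>\<rbrakk>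
      \<Longrightarrow> v x \<preceq>\<^bsub>G\<^esub> v (x \<oplus>\<^bsub>F\<^esub> y) \<or> v y \<preceq>\<^bsub>G\<^esub> v (x \<oplus>\<^bsub>F\<^esub> y)"

text \<open>
  In the following \<open>F\<close> is an ambient field, \<open>E\<close>, \<open>L\<close>, \<open>K\<close> are (carriers of) subfields, and \<open>v\<close>
  is a valuation on (at least) \<open>E\<close>, resp. \<open>L\<close>. The restriction of \<open>v\<close> to a smaller subfield is
  the same function \<open>v\<close>, used with that subfield.
\<close>

definition val_ring ::
    "('a, 'b) ring_scheme \<Rightarrow> ('g, 'h) ordered_group_scheme \<Rightarrow> ('a \<Rightarrow> 'g) \<Rightarrow> 'a set \<Rightarrow> 'a set"
  where "val_ring F G v E = {x \<in> E. x = \<zero>\<^bsub>F\<^esub> \<or> \<one>\<^bsub>G\<^esub> \<preceq>\<^bsub>G\<^esub> v x}"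

definition val_ideal ::
    "('a, 'b) ring_scheme \<Rightarrow> ('g, 'h) ordered_group_scheme \<Rightarrow> ('a \<Rightarrow> 'g) \<Rightarrow> 'a set \<Rightarrow> 'a set"
  where "val_ideal F G v E = {x \<in> E. x = \<zero>\<^bsub>F\<^esub> \<or> \<one>\<^bsub>G\<^esub> \<prec>\<^bsub>G\<^esub> v x}"

definition value_group :: "('a, 'b) ring_scheme \<Rightarrow> ('a \<Rightarrow> 'g) \<Rightarrow> 'a set \<Rightarrow> 'g set"
  where "value_group F v E = v ` (E - {\<zero>\<^bsub>F\<^esub>})"

definition residue_field ::
    "('a, 'b) ring_scheme \<Rightarrow> ('g, 'h) ordered_group_scheme \<Rightarrow> ('a \<Rightarrow> 'g) \<Rightarrow> 'a set \<Rightarrow> 'a set ring"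
  where "residue_field F G v E = (F\<lparr>carrier := val_ring F G v E\<rparr>) Quot (val_ideal F G v E)"

text \<open>
  The image of the residue field of \<open>K\<close> under its canonical embedding into the residue field
  of \<open>L\<close>, i.e. the residue classes modulo the maximal ideal of \<open>L\<close> of the valuation ring of \<open>K\<close>.
\<close>

definition residue_subfield ::
    "('a, 'b) ring_scheme \<Rightarrow> ('g, 'h) ordered_group_scheme \<Rightarrow> ('a \<Rightarrow> 'g) \<Rightarrow> 'a set \<Rightarrow> 'a set
      \<Rightarrow> 'a set set"
  where "residue_subfield F G v L K =
    (\<lambda>x. val_ideal F G v L +>\<^bsub>F\<lparr>carrier := val_ring F G v L\<rparr>\<^esub> x) ` val_ring F G v K"

definition ramification_index ::
    "('a, 'b) ring_scheme \<Rightarrow> ('g, 'h) ordered_group_scheme \<Rightarrow> ('a \<Rightarrow> 'g) \<Rightarrow> 'a set \<Rightarrow> 'a set \<Rightarrow> nat"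
  where "ramification_index F G v L K =
    card (rcosets\<^bsub>G\<lparr>carrier := value_group F v L\<rparr>\<^esub> (value_group F v K))"

definition inertia_degree ::
    "('a, 'b) ring_scheme \<Rightarrow> ('g, 'h) ordered_group_scheme \<Rightarrow> ('a \<Rightarrow> 'g) \<Rightarrow> 'a set \<Rightarrow> 'a set \<Rightarrow> nat"
  where "inertia_degree F G v L K =
    ring.dim (residue_field F G v L)
      (residue_subfield F G v L K) (carrier (residue_field F G v L))"

text \<open>Here \<open>H\<close> and \<open>D\<close> are subgroups of \<open>G\<close> with \<open>D \<subseteq> H\<close>.\<close>

definition initial_index_group ::
    "('g, 'h) ordered_group_scheme \<Rightarrow> 'g set \<Rightarrow> 'g set \<Rightarrow> nat"
  where "initial_index_group G H D =
    card {c \<in> H. \<one>\<^bsub>G\<^esub> \<preceq>\<^bsub>G\<^esub> c \<and> (\<forall>d\<in>D. \<one>\<^bsub>G\<^esub> \<prec>\<^bsub>G\<^esub> d \<longrightarrow> c \<prec>\<^bsub>G\<^esub> d)}"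

definition initial_index ::
    "('a, 'b) ring_scheme \<Rightarrow> ('g, 'h) ordered_group_scheme \<Rightarrow> ('a \<Rightarrow> 'g) \<Rightarrow> 'a set \<Rightarrow> 'a set \<Rightarrow> nat"
  where "initial_index F G v L K =
    initial_index_group G (value_group F v L) (value_group F v K)"

text \<open>
  \<open>v\<close> is the only extension of its restriction to \<open>E\<close> to a valuation on \<open>F\<close>. This is used for
  \<open>F\<close> an algebraic closure of \<open>E\<close>. Then the value group of \<open>v\<close> is a divisible hull of that of
  the restriction, so every extension of the restriction is equivalent to a unique one which
  takes its values in \<open>G\<close> and literally agrees with \<open>v\<close> on \<open>E\<close>; hence quantifying over
  the latter is enough.
\<close>

definition only_extension ::
    "('a, 'b) ring_scheme \<Rightarrow> ('g, 'h) ordered_group_scheme \<Rightarrow> ('a \<Rightarrow> 'g) \<Rightarrow> 'a set \<Rightarrow> bool"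
  where "only_extension F G v E \<longleftrightarrow>
    (\<forall>w. valuation F G w \<and> (\<forall>x \<in> E - {\<zero>\<^bsub>F\<^esub>}. w x = v x)
      \<longrightarrow> (\<forall>x \<in> carrier F - {\<zero>\<^bsub>F\<^esub>}. w x = v x))"

text \<open>\<open>LEAST\<close> refers to the inclusion order on sets.\<close>

definition henselization ::
    "('a, 'b) ring_scheme \<Rightarrow> ('g, 'h) ordered_group_scheme \<Rightarrow> ('a \<Rightarrow> 'g) \<Rightarrow> 'a set \<Rightarrow> 'a set"
  where "henselization F G v K = (LEAST E. subfield E F \<and> K \<subseteq> E \<and> only_extension F G v E)"

text \<open>
  Here \<open>F\<close> is an algebraic closure of \<open>L\<close> and \<open>v\<close> is a valuation on \<open>F\<close>. The index and the degree
  in the denominator depend only on the restriction of \<open>v\<close> to \<open>L\<close>.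
\<close>

definition defect ::
    "('a, 'b) ring_scheme \<Rightarrow> ('g, 'h) ordered_group_scheme \<Rightarrow> ('a \<Rightarrow> 'g) \<Rightarrow> 'a set \<Rightarrow> 'a set \<Rightarrow> rat"
  where "defect F G v L K =
    of_nat (ring.dim F (henselization F G v K) (henselization F G v L)) /
    of_nat (ramification_index F G v L K * inertia_degree F G v L K)"

text \<open>
  Separability of \<open>L\<close> over \<open>K\<close> inside an algebraically closed field \<open>F\<close>: minimal polynomials have
  no multiple roots in \<open>F\<close>.
\<close>

definition separable_extension :: "('a, 'b) ring_scheme \<Rightarrow> 'a set \<Rightarrow> 'a set \<Rightarrow> bool"
  where "separable_extension F L K \<longleftrightarrow>
    (\<forall>x\<in>L. \<not> ring.transcendental F K x \<and>
      (\<forall>a \<in> carrier F. ring.alg_mult F (ring.Irr F K x) a \<le> 1))"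

text \<open>
  \<open>A\<close> is a subring of \<open>B\<close>. The polynomial expression ring \<open>A[T]\<close> is the subring generated by
  \<open>A \<union> T\<close>; \<open>B\<close> is the localization of \<open>A[T]\<close> at \<open>S\<close> via the inclusion iff \<open>S\<close>
  consists of units of \<open>B\<close> and every element of \<open>B\<close> is a fraction.
\<close>

definition essentially_finitely_generated :: "('a, 'b) ring_scheme \<Rightarrow> 'a set \<Rightarrow> bool"
  where "essentially_finitely_generated B A \<longleftrightarrow>
    (\<exists>T S. finite T \<and> T \<subseteq> carrier B \<and>
      submonoid S B \<and> S \<subseteq> generate_ring B (A \<union> T) \<and> S \<subseteq> Units B \<and>
      carrier B = {a \<otimes>\<^bsub>B\<^esub> inv\<^bsub>B\<^esub> s | a s. a \<in> generate_ring B (A \<union> T) \<and> s \<in> S})"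

text \<open>
  A finite extension \<open>L|K\<close> with a valuation \<open>\<omega>\<close> on \<open>L\<close>, together with an algebraic closure \<open>F\<close>
  of \<open>L\<close> and an extension \<open>v\<close> of \<open>\<omega>\<close> to \<open>F\<close>. The group \<open>G\<close> only serves as a common codomain of
  \<open>\<omega>\<close> and \<open>v\<close>.
\<close>

locale finite_valued_extension =
  fixes F :: "('a, 'b) ring_scheme" and L K :: "'a set"
    and G :: "('g, 'h) ordered_group_scheme" and \<omega> v :: "'a \<Rightarrow> 'g"
  assumes closure: "algebraic_closure F L"
    and K_subfield: "subfield K F"
    and K_sub_L: "K \<subseteq> L"
    and finite_degree: "ring.finite_dimension F K L"
    and val_L: "valuation (F\<lparr>carrier := L\<rparr>) G \<omega>"
    and val_F: "valuation F G v"
    and extends: "x \<in> L - {\<zero>\<^bsub>F\<^esub>} \<Longrightarrow> v x = \<omega> x"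

end

theory Submission
  imports Defs "HOL-Computational_Algebra.Primes"
begin

text \<open>
  In characteristic zero every finite extension is separable. In characteristic \<open>p\<close> let \<open>E\<close> be the
  separable closure of \<open>K\<close> in \<open>L\<close>. Henselizations are separable and immediate over their base
  field, so \<open>[E\<^sup>h : K\<^sup>h] \<ge> e(E|K) f(E|K)\<close>, and a basis of the purely inseparable extension \<open>L|E\<close> stays
  independent over \<open>E\<^sup>h\<close>, so \<open>[L\<^sup>h : E\<^sup>h] \<ge> [L : E] \<ge> e(L|E) f(L|E)\<close>. As degrees, indices and residue
  degrees are multiplicative, \<open>d(L|K) = 1\<close> forces equality throughout: \<open>d(E|K) = 1\<close> and
  \<open>[L : E] = e(L|E) f(L|E)\<close>. The condition \<open>\<epsilon> = e\<close> says that every coset of the smaller value group is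
  represented by an element of the initial segment, and this property passes from \<open>L|K\<close> to \<open>E|K\<close> and
  to \<open>L|E\<close>. Hence assertion (A) applies to \<open>E|K\<close>, while the products of a lifted residue basis and of
  initial coset representatives generate \<open>\<O>\<^sub>L\<close> as an \<open>\<O>\<^sub>E\<close>-module, so that \<open>\<O>\<^sub>L\<close> inherits essential
  finite generation.

  The henselization of \<open>K\<close> is described by the \<open>K\<close>-automorphisms \<open>\<tau>\<close> of the algebraic closure: it
  consists of the separable elements \<open>x\<close> for which there is a separable unit \<open>t\<close> of the valuation ring
  such that all proper conjugates of \<open>t\<close> have positive value and \<open>\<tau> t = t\<close> implies \<open>\<tau> x = x\<close>.
\<close>

subsection \<open>Automorphisms of an algebraic closure\<close>

text \<open>The henselization is defined as a least field, so its existence has to be shown along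
  with its being separable and immediate. The description by units \<open>t\<close> makes minimality
  cheap: an automorphism that preserves the valuation cannot move \<open>t\<close> to an element of
  positive value, hence fixes \<open>t\<close> and everything attached to it. The remaining
  properties rest on one device. If \<open>A\<close> is an initial segment, by value, of a finite
  set \<open>Z\<close> of nonzero elements, then the elementary symmetric function of
  \<open>Z\<close> of degree \<open>card A\<close> has the product over \<open>A\<close> as its
  leading term. Comparing such products of conjugates with symmetric functions that the relevant
  automorphisms fix produces the units \<open>t\<close>, forces the extension of the valuation from
  the field they cut out to be unique, and places each nonzero element of that field near a quotient
  of elements of \<open>K\<close>. Separability is taken as \<open>K(x) = K(x^p)\<close>, so that
  closure under sums and products becomes a dimension count with spans of p-th powers.\<close>

text \<open>Graphs of partial \<open>K\<close>-automorphisms, ordered by inclusion for Zorn's lemma.\<close>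

definition (in ring) partial_auto :: "'a set \<Rightarrow> ('a \<times> 'a) set \<Rightarrow> bool" where
  "partial_auto K r \<longleftrightarrow> r \<subseteq> carrier R \<times> carrier R \<and> (\<forall>k\<in>K. (k, k) \<in> r) \<and>
    (\<forall>a b c d. (a, b) \<in> r \<longrightarrow> (c, d) \<in> r \<longrightarrow> (a \<oplus> c, b \<oplus> d) \<in> r \<and> (a \<otimes> c, b \<otimes> d) \<in> r) \<and>
    (\<forall>a b. (a, b) \<in> r \<longrightarrow> (\<ominus> a, \<ominus> b) \<in> r) \<and>
    (\<forall>b. (\<zero>, b) \<in> r \<longrightarrow> b = \<zero>) \<and> (\<forall>a. (a, \<zero>) \<in> r \<longrightarrow> a = \<zero>)"

text \<open>The two conditions on \<open>\<zero>\<close> mirror each other, so the notion is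
  symmetric. The extension step can therefore serve twice: for the domain of a maximal graph and,
  via the converse, for its range.\<close>

lemma (in ring) partial_auto_converse: "partial_auto K r \<Longrightarrow> partial_auto K (r\<inverse>)"
  unfolding partial_auto_def by blast

text \<open>Single-valuedness is not part of the definition: subtracting the two pairs puts a pair
  with first entry \<open>\<zero>\<close> and second entry the difference of \<open>b\<close> and
  \<open>c\<close> into \<open>r\<close>, and the condition on \<open>\<zero>\<close> makes that
  difference vanish.\<close>

lemma (in ring) partial_auto_unique:
  assumes "partial_auto K r" "(a, b) \<in> r" "(a, c) \<in> r"
  shows "b = c"
proof -
  have cl: "a \<in> carrier R" "b \<in> carrier R" "c \<in> carrier R"
    using assms unfolding partial_auto_def by blast+
  have "(\<ominus> a, \<ominus> c) \<in> r"
    using assms unfolding partial_auto_def by blast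
  then have "(a \<oplus> \<ominus> a, b \<oplus> \<ominus> c) \<in> r"
    using assms(1,2) unfolding partial_auto_def by blast
  then have "b \<oplus> \<ominus> c = \<zero>"
    using assms(1) cl unfolding partial_auto_def by (metis r_neg)
  then show ?thesis
    using cl by (metis minus_equality minus_minus a_inv_closed)
qed

text \<open>The graph consists of the values at \<open>z\<close> and \<open>z'\<close> of one
  polynomial over \<open>M\<close>, at \<open>z'\<close> with its coefficients moved by
  \<open>\<tau>\<close>. The conditions on \<open>\<zero>\<close> say that the two evaluations have
  the same kernel, namely the multiples of \<open>Irr M z\<close>.\<close>

lemma (in field) partial_auto_adjoin_root:
  assumes M: "subfield M R" and h: "\<tau> \<in> ring_hom (R\<lparr>carrier := M\<rparr>) R"
    and K: "K \<subseteq> M" "\<And>k. k \<in> K \<Longrightarrow> \<tau> k = k"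
    and z: "z \<in> carrier R" "(algebraic over M) z"
    and z': "z' \<in> carrier R" "eval (map \<tau> (Irr M z)) z' = \<zero>"
  obtains r where "partial_auto K r" "(\<lambda>m. (m, \<tau> m)) ` M \<subseteq> r" "(z, z') \<in> r"
proof -
  note M' = subfieldE(1)[OF M]
  interpret MR: field "R\<lparr>carrier := M\<rparr>" using subfield_iff(2)[OF M] .
  interpret H: ring_hom_ring "R\<lparr>carrier := M\<rparr>" R \<tau>
    using h MR.ring_axioms ring_axioms by (simp add: ring_hom_ringI2)
  have MsubR: "M \<subseteq> carrier R" using M by (rule subfieldE(3))
  define g where "g q = eval (map \<tau> q) z'" for q
  have setq: "set q \<subseteq> M" if "q \<in> carrier (M[X])" for q
    using that polynomial_incl[of M q] by (simp add: univ_poly_carrier)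
  have setm: "set (map \<tau> q) \<subseteq> carrier R" if "set q \<subseteq> M" for q
    using that H.hom_closed by auto
  interpret UP: ring "M[X]" using univ_poly_is_ring[OF M'] .
  interpret UPd: domain "M[X]" using univ_poly_is_domain[OF M'] .
  have gh: "g \<in> ring_hom (M[X]) R"
  proof (rule ring_hom_memI)
    fix p q assume p: "p \<in> carrier (M[X])" and q: "q \<in> carrier (M[X])"
    show "g p \<in> carrier R"
      unfolding g_def by (rule eval_in_carrier[OF setm[OF setq[OF p]] z'(1)])
    have sp: "set (poly_add p q) \<subseteq> M" "set (poly_mult p q) \<subseteq> M"
      using setq[OF UP.a_closed[OF p q]] setq[OF UP.m_closed[OF p q]]
      by (simp_all add: univ_poly_add univ_poly_mult)
    have "eval (poly_add (map \<tau> p) (map \<tau> q)) z' = g (poly_add p q)"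
      using H.poly_add_hom'[of p q] setq[OF p] setq[OF q] eval_normalize[OF setm[OF sp(1)] z'(1)] poly_add_consistent[OF M']
      unfolding g_def by simp
    then show "g (p \<oplus>\<^bsub>M[X]\<^esub> q) = g p \<oplus> g q"
      using eval_poly_add[OF setm[OF setq[OF p]] setm[OF setq[OF q]] z'(1)]
      by (simp add: univ_poly_add g_def)
    have "eval (poly_mult (map \<tau> p) (map \<tau> q)) z' = g (poly_mult p q)"
      using H.poly_mult_hom'[of p q] setq[OF p] setq[OF q] eval_normalize[OF setm[OF sp(2)] z'(1)] poly_mult_consistent[OF M']
      unfolding g_def by simp
    then show "g (p \<otimes>\<^bsub>M[X]\<^esub> q) = g p \<otimes> g q"
      using eval_poly_mult[OF setm[OF setq[OF p]] setm[OF setq[OF q]] z'(1)]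
      by (simp add: univ_poly_mult g_def)
  next
    show "g \<one>\<^bsub>M[X]\<^esub> = \<one>"
      using z' H.hom_one by (simp add: g_def univ_poly_one)
  qed
  interpret G: ring_hom_ring "M[X]" R g
    using gh UP.ring_axioms ring_axioms by (simp add: ring_hom_ringI2)
  interpret E: ring_hom_ring "M[X]" R "\<lambda>q. eval q z"
    using eval_ring_hom[OF M' z(1)] .
  have irr: "Irr M z \<in> carrier (M[X])" using IrrE(1)[OF M z] .
  have ker: "g q = \<zero>" if q: "q \<in> carrier (M[X])" "eval q z = \<zero>" for q
  proof -
    have "Irr M z divides\<^bsub>M[X]\<^esub> q"
      using Irr_minimal[OF M z q] pdivides_iff_shell[OF M irr q(1)] by simp
    then obtain s where "s \<in> carrier (M[X])" "q = Irr M z \<otimes>\<^bsub>M[X]\<^esub> s"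
      unfolding factor_def by blast
    then show ?thesis
      using z'(2) irr by (simp add: g_def[of "Irr M z"])
  qed
  \<comment> \<open>A polynomial that does not vanish at \<open>z\<close> has an inverse
    \<open>s\<close> modulo the minimal polynomial. Applying \<open>ker\<close> to
    \<open>q s - 1\<close> shows that \<open>g q\<close> is invertible.\<close>
  have ker': "eval q z = \<zero>" if q: "q \<in> carrier (M[X])" "g q = \<zero>" for q
  proof (rule ccontr)
    assume ne: "eval q z \<noteq> \<zero>"
    have sub: "subfield (simple_extension M z) R"
      using simple_extension_is_subfield[OF M z(1)] z(2) by simp
    have img: "simple_extension M z = (\<lambda>p. eval p z) ` carrier (M[X])"
      using simple_extension_as_eval_img[OF MsubR z(1)] .
    have "eval q z \<in> simple_extension M z - {\<zero>}" using img q ne by auto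
    from subfield_m_inv[OF sub this]
    obtain s where s: "s \<in> carrier (M[X])" "eval q z \<otimes> eval s z = \<one>"
      unfolding img by auto
    let ?d = "q \<otimes>\<^bsub>M[X]\<^esub> s \<ominus>\<^bsub>M[X]\<^esub> \<one>\<^bsub>M[X]\<^esub>"
    have "eval ?d z = \<zero>" using s q by (simp add: a_minus_def r_neg UP.minus_closed)
    then have "g ?d = \<zero>" using s q by (intro ker) simp_all
    then show False using s q by (simp add: a_minus_def)
  qed
  define r where "r = (\<lambda>q. (eval q z, g q)) ` carrier (M[X])"
  \<comment> \<open>The constant \<open>m\<close> is the list \<open>[m]\<close>, except that
    \<open>\<zero>\<close> is represented by the empty list.\<close>
  have con: "\<exists>q\<in>carrier (M[X]). eval q z = m \<and> g q = \<tau> m" if "m \<in> M" for m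
  proof (cases "m = \<zero>")
    case True
    then show ?thesis using univ_poly_zero_closed[of R M] H.hom_zero
      by (intro bexI[of _ "[]"]) (auto simp: g_def)
  next
    case False
    then have "[m] \<in> carrier (M[X])" using that by (simp add: univ_poly_def polynomial_def)
    moreover have "eval [m] z = m" "g [m] = \<tau> m"
      using that MsubR z(1) z'(1) H.hom_closed[of m] by (auto simp: g_def)
    ultimately show ?thesis by blast
  qed
  have "partial_auto K r"
    unfolding partial_auto_def
  proof (intro conjI allI impI ballI)
    show "r \<subseteq> carrier R \<times> carrier R" unfolding r_def by auto
  next
    fix k assume k: "k \<in> K"
    then obtain q where "q \<in> carrier (M[X])" "eval q z = k" "g q = k" using con[of k] K by auto
    then show "(k, k) \<in> r" unfolding r_def by force
  next
    fix a b c d assume "(a, b) \<in> r" "(c, d) \<in> r"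
    then obtain p q where pq: "p \<in> carrier (M[X])" "q \<in> carrier (M[X])"
      "a = eval p z" "b = g p" "c = eval q z" "d = g q" unfolding r_def by auto
    then show "(a \<oplus> c, b \<oplus> d) \<in> r" unfolding r_def
      by (intro image_eqI[of _ _ "p \<oplus>\<^bsub>M[X]\<^esub> q"]) simp_all
    show "(a \<otimes> c, b \<otimes> d) \<in> r" unfolding r_def using pq
      by (intro image_eqI[of _ _ "p \<otimes>\<^bsub>M[X]\<^esub> q"]) simp_all
  next
    fix a b assume "(a, b) \<in> r"
    then obtain p where pq: "p \<in> carrier (M[X])" "a = eval p z" "b = g p" unfolding r_def by auto
    then show "(\<ominus> a, \<ominus> b) \<in> r" unfolding r_def
      by (intro image_eqI[of _ _ "\<ominus>\<^bsub>M[X]\<^esub> p"]) simp_all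
  next
    fix b assume "(\<zero>, b) \<in> r" then show "b = \<zero>" using ker unfolding r_def by auto
  next
    fix b assume "(b, \<zero>) \<in> r" then show "b = \<zero>" using ker' unfolding r_def by auto
  qed
  moreover have "(\<lambda>m. (m, \<tau> m)) ` M \<subseteq> r"
    using con unfolding r_def by force
  moreover have "(z, z') \<in> r"
  proof -
    have "eval X z = z" "g X = z'"
      using eval_var[OF z(1)] z'(1) H.hom_one H.hom_zero by (auto simp: g_def var_def)
    then show ?thesis using var_closed(1)[OF M'] unfolding r_def by force
  qed
  ultimately show ?thesis using that by blast
qed

context algebraic_closure
begin

text \<open>Every \<open>k\<close> is algebraic over \<open>K\<close>, so \<open>K(k)\<close> is a
  field and already contains the inverse; as a ring it stays inside \<open>M\<close>.\<close>

lemma intermediate_subfield: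
  assumes "subring M L" "K \<subseteq> M"
  shows "subfield M L"
proof (rule subfieldI')
  fix k assume k: "k \<in> M - {\<zero>}"
  have kL: "k \<in> carrier L" using k subringE(1)[OF assms(1)] by blast
  have "subfield (simple_extension K k) L"
    using simple_extension_is_subfield[OF subfield_axioms kL] algebraic_extension[OF kL] by simp
  moreover have "k \<in> simple_extension K k - {\<zero>}"
    using simple_extension_mem[OF subfieldE(1)[OF subfield_axioms] kL] k by blast
  ultimately have "inv k \<in> simple_extension K k"
    using subfield_m_inv(1)[of "simple_extension K k" k] by blast
  then show "inv k \<in> M"
    using simple_extension_subring_incl[OF assms, of k] k by blast
qed (rule assms(1))

lemma intermediate_algebraic_closure:
  assumes "subfield M L" "K \<subseteq> M"
  shows "algebraic_closure L M"
proof -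
  interpret subfield M L by fact
  show ?thesis
  proof
    fix x assume "x \<in> carrier L"
    then show "(algebraic over M) x"
      using algebraic_mono[OF assms(2)] algebraic_extension by blast
  next
    fix P assume "P \<in> carrier (M[X])"
    then show "splitted P"
      using roots_over_carrier carrier_polynomial_shell[OF subfieldE(1)[OF assms(1)]] by blast
  qed
qed

text \<open>The domain of a graph is a ring above \<open>K\<close>, hence a field \<open>M\<close>.
  The minimal polynomial of \<open>z\<close> over \<open>M\<close>, with transported coefficients,
  has a root in the algebraically closed field, and \<open>z\<close> is sent there.\<close>

lemma partial_auto_extend:
  assumes r: "partial_auto K r" and z: "z \<in> carrier L"
  obtains r' where "partial_auto K r'" "r \<subseteq> r'" "z \<in> Domain r'"
proof -
  define M where "M = Domain r"
  define \<tau> where "\<tau> m = (THE b. (m, b) \<in> r)" for m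
  have \<tau>: "\<tau> a = b" if "(a, b) \<in> r" for a b
    unfolding \<tau>_def using that partial_auto_unique[OF r] by blast
  have \<tau>M: "(m, \<tau> m) \<in> r" if "m \<in> M" for m
    using that \<tau> unfolding M_def by auto
  have Kr: "(k, k) \<in> r" if "k \<in> K" for k using r that unfolding partial_auto_def by blast
  have KM: "K \<subseteq> M" using Kr unfolding M_def by blast
  have \<tau>K: "\<tau> k = k" if "k \<in> K" for k using \<tau>[OF Kr[OF that]] .
  have sub: "subring M L"
  proof (rule subringI)
    show "M \<subseteq> carrier L" using r unfolding partial_auto_def M_def by auto
    show "\<one> \<in> M" using KM subringE(3)[OF subfieldE(1)[OF subfield_axioms]] by auto
  next
    fix a assume "a \<in> M"
    then show "\<ominus> a \<in> M" using r unfolding partial_auto_def M_def by blast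
    fix b assume "b \<in> M"
    then show "a \<oplus> b \<in> M" "a \<otimes> b \<in> M" using \<open>a \<in> M\<close> r unfolding partial_auto_def M_def by blast+
  qed
  then have M: "subfield M L" using intermediate_subfield KM by blast
  have hom: "\<tau> \<in> ring_hom (L\<lparr>carrier := M\<rparr>) L"
  proof (rule ring_hom_memI)
    fix x assume x: "x \<in> carrier (L\<lparr>carrier := M\<rparr>)"
    then show "\<tau> x \<in> carrier L" using \<tau>M[of x] r unfolding partial_auto_def by auto
    fix y assume y: "y \<in> carrier (L\<lparr>carrier := M\<rparr>)"
    have "(x, \<tau> x) \<in> r" "(y, \<tau> y) \<in> r" using x y \<tau>M by auto
    then have "(x \<otimes> y, \<tau> x \<otimes> \<tau> y) \<in> r" "(x \<oplus> y, \<tau> x \<oplus> \<tau> y) \<in> r"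
      using r unfolding partial_auto_def by blast+
    then show "\<tau> (x \<otimes>\<^bsub>L\<lparr>carrier := M\<rparr>\<^esub> y) = \<tau> x \<otimes> \<tau> y"
      "\<tau> (x \<oplus>\<^bsub>L\<lparr>carrier := M\<rparr>\<^esub> y) = \<tau> x \<oplus> \<tau> y" using \<tau> by auto
  next
    show "\<tau> \<one>\<^bsub>L\<lparr>carrier := M\<rparr>\<^esub> = \<one>"
      using \<tau>K subringE(3)[OF subfieldE(1)[OF subfield_axioms]] by auto
  qed
  interpret H: ring_hom_ring "L\<lparr>carrier := M\<rparr>" L \<tau>
    using hom subring_is_ring[OF sub] ring_axioms by (simp add: ring_hom_ringI2)
  have alg: "(algebraic over M) z"
    using algebraic_mono[OF KM] algebraic_extension[OF z] by blast
  let ?P = "Irr M z"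
  note irr = IrrE[OF M z alg]
  have P: "set ?P \<subseteq> M" "?P \<noteq> []"
    using irr(1) polynomial_incl[of M ?P] irr(2) pirreducibleE(1)[OF subfieldE(1)[OF M]] by (auto simp: univ_poly_carrier)
  have deg: "degree ?P \<ge> 1" using pirreducible_degree[OF M irr(1,2)] .
  let ?Q = "map \<tau> ?P"
  \<comment> \<open>\<open>\<tau>\<close> fixes the leading coefficient \<open>\<one>\<close>, so
    the transported list is again a polynomial of the same positive degree and must have a
    root.\<close>
  have Q: "?Q \<in> carrier (poly_ring L)"
  proof -
    have "lead_coeff ?Q = \<one>" using P irr(3) \<tau>K[of \<one>] subringE(3)[OF subfieldE(1)[OF subfield_axioms]]
      by (simp add: hd_map)
    moreover have "set ?Q \<subseteq> carrier L" using P(1) H.hom_closed by auto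
    ultimately show ?thesis by (simp add: univ_poly_carrier[symmetric] polynomial_def)
  qed
  have "size (roots ?Q) = degree ?Q"
    using roots_over_carrier[OF Q] unfolding splitted_def .
  then have "roots ?Q \<noteq> {#}" using deg by auto
  then obtain z' where "z' \<in># roots ?Q" by blast
  then have z': "z' \<in> carrier L" "eval ?Q z' = \<zero>"
    using roots_mem_iff_is_root[OF Q] unfolding is_root_def by auto
  obtain r' where r': "partial_auto K r'" "(\<lambda>m. (m, \<tau> m)) ` M \<subseteq> r'" "(z, z') \<in> r'"
    using partial_auto_adjoin_root[OF M hom KM \<tau>K z alg z'] .
  have "r \<subseteq> r'"
  proof (rule subrelI)
    fix a b assume ab: "(a, b) \<in> r"
    then have "a \<in> M" "\<tau> a = b" using \<tau> unfolding M_def by auto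
    then show "(a, b) \<in> r'" using r'(2) by auto
  qed
  then show ?thesis using that r' by blast
qed

definition auts :: "('a \<Rightarrow> 'a) set" where
  "auts = {\<tau> \<in> ring_hom L L. \<tau> ` carrier L = carrier L \<and> inj_on \<tau> (carrier L) \<and> (\<forall>k\<in>K. \<tau> k = k)}"

text \<open>The isomorphism over \<open>K\<close> that sends \<open>x\<close> to its conjugate
  \<open>y\<close> is enlarged by Zorn's lemma. Only graphs above \<open>r0\<close> compete, so the
  maximal one still contains \<open>(x, y)\<close>.\<close>

lemma exists_aut:
  assumes x: "x \<in> carrier L" and y: "y \<in> carrier L" "eval (Irr K x) y = \<zero>"
  obtains \<tau> where "\<tau> \<in> auts" "\<tau> x = y"
proof -
  note alg = algebraic_extension[OF x]
  have KL: "K \<subseteq> carrier L" using subfieldE(3)[OF subfield_axioms] .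
  have "set (Irr K x) \<subseteq> K" using IrrE(1)[OF subfield_axioms x alg] polynomial_incl[of K] by (simp add: univ_poly_carrier)
  then have idm: "map id (Irr K x) = Irr K x" by simp
  have "id \<in> ring_hom (L\<lparr>carrier := K\<rparr>) L" using KL by (intro ring_hom_memI) auto
  then obtain r0 where r0: "partial_auto K r0" "(x, y) \<in> r0"
    using partial_auto_adjoin_root[OF subfield_axioms, of id K x y] x alg y idm
    by (metis id_apply order_refl)
  let ?A = "{r. partial_auto K r \<and> r0 \<subseteq> r}"
  have "\<exists>r\<in>?A. \<forall>s\<in>?A. r \<subseteq> s \<longrightarrow> s = r"
  proof (rule subset_Zorn_nonempty)
    show "?A \<noteq> {}" using r0 by auto
  next
    fix C assume C: "C \<noteq> {}" "subset.chain ?A C"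
    then have Cs: "\<And>r. r \<in> C \<Longrightarrow> partial_auto K r \<and> r0 \<subseteq> r"
      and Ct: "\<And>r s. r \<in> C \<Longrightarrow> s \<in> C \<Longrightarrow> r \<subseteq> s \<or> s \<subseteq> r"
      unfolding subset.chain_def by blast+
    have "partial_auto K (\<Union>C)"
      unfolding partial_auto_def
    proof (intro conjI allI impI ballI)
      show "\<Union>C \<subseteq> carrier L \<times> carrier L" using Cs unfolding partial_auto_def by blast
    next
      fix k assume "k \<in> K" then show "(k, k) \<in> \<Union>C"
        using Cs C(1) unfolding partial_auto_def by blast
    next
      fix a b c d assume "(a, b) \<in> \<Union>C" "(c, d) \<in> \<Union>C"
      then obtain s where s: "s \<in> C" "(a, b) \<in> s" "(c, d) \<in> s" using Ct by blast
      then have "(a \<oplus> c, b \<oplus> d) \<in> s" "(a \<otimes> c, b \<otimes> d) \<in> s"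
        using Cs[OF s(1)] unfolding partial_auto_def by blast+
      then show "(a \<oplus> c, b \<oplus> d) \<in> \<Union>C" "(a \<otimes> c, b \<otimes> d) \<in> \<Union>C" using s(1) by blast+
    next
      fix a b assume "(a, b) \<in> \<Union>C" then show "(\<ominus> a, \<ominus> b) \<in> \<Union>C"
        using Cs unfolding partial_auto_def by blast
    next
      fix b assume "(\<zero>, b) \<in> \<Union>C" then show "b = \<zero>" using Cs unfolding partial_auto_def by blast
    next
      fix b assume "(b, \<zero>) \<in> \<Union>C" then show "b = \<zero>" using Cs unfolding partial_auto_def by blast
    qed
    then show "\<Union>C \<in> ?A" using Cs C(1) by blast
  qed
  then obtain r where rA: "r \<in> ?A" and rmax: "\<forall>s\<in>?A. r \<subseteq> s \<longrightarrow> s = r" by (elim bexE)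
  have r: "partial_auto K r" "r0 \<subseteq> r" using rA by simp_all
  have max: "s = r" if "partial_auto K s" "r \<subseteq> s" for s
    using rmax that r(2) by (metis (no_types, lifting) mem_Collect_eq subset_trans)
  have dom: "Domain r = carrier L"
  proof
    show "Domain r \<subseteq> carrier L" using r unfolding partial_auto_def by auto
    show "carrier L \<subseteq> Domain r"
    proof
      fix z assume "z \<in> carrier L"
      then obtain s where "partial_auto K s" "r \<subseteq> s" "z \<in> Domain s"
        using partial_auto_extend[OF r(1)] by metis
      then show "z \<in> Domain r" using max by blast
    qed
  qed
  \<comment> \<open>The converse of the maximal graph is extended to include \<open>z\<close>;
    turned back, this extension must equal the graph itself.\<close>
  have ran: "Range r = carrier L"
  proof
    show "Range r \<subseteq> carrier L" using r unfolding partial_auto_def by auto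
    show "carrier L \<subseteq> Range r"
    proof
      fix z assume "z \<in> carrier L"
      then obtain s where s: "partial_auto K s" "r\<inverse> \<subseteq> s" "z \<in> Domain s"
        using partial_auto_extend[OF partial_auto_converse[OF r(1)]] by metis
      moreover have "r \<subseteq> s\<inverse>" using s(2) by auto
      ultimately have "s\<inverse> = r" using max[OF partial_auto_converse] by blast
      then show "z \<in> Range r" using s(3) by blast
    qed
  qed
  define \<tau> where "\<tau> m = (THE b. (m, b) \<in> r)" for m
  have \<tau>: "\<tau> a = b" if "(a, b) \<in> r" for a b
    unfolding \<tau>_def using that partial_auto_unique[OF r(1)] by blast
  have \<tau>L: "(m, \<tau> m) \<in> r" if "m \<in> carrier L" for m
    using that \<tau> dom by blast
  have "\<tau> \<in> ring_hom L L"
  proof (rule ring_hom_memI)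
    fix x assume x: "x \<in> carrier L"
    then show "\<tau> x \<in> carrier L" using \<tau>L[of x] ran by blast
    fix y assume y: "y \<in> carrier L"
    have "(x, \<tau> x) \<in> r" "(y, \<tau> y) \<in> r" using x y \<tau>L by auto
    then have "(x \<otimes> y, \<tau> x \<otimes> \<tau> y) \<in> r" "(x \<oplus> y, \<tau> x \<oplus> \<tau> y) \<in> r"
      using r unfolding partial_auto_def by blast+
    then show "\<tau> (x \<otimes> y) = \<tau> x \<otimes> \<tau> y" "\<tau> (x \<oplus> y) = \<tau> x \<oplus> \<tau> y" using \<tau> by auto
  next
    have "(\<one>, \<one>) \<in> r" using r(1) subringE(3)[OF subfieldE(1)[OF subfield_axioms]] unfolding partial_auto_def by blast
    then show "\<tau> \<one> = \<one>" by (rule \<tau>)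
  qed
  moreover have "\<tau> ` carrier L = carrier L"
  proof
    show "\<tau> ` carrier L \<subseteq> carrier L" using \<tau>L ran by blast
    show "carrier L \<subseteq> \<tau> ` carrier L"
    proof
      fix b assume "b \<in> carrier L"
      then obtain a where "(a, b) \<in> r" using ran by blast
      then show "b \<in> \<tau> ` carrier L" using \<tau> dom by blast
    qed
  qed
  moreover have "inj_on \<tau> (carrier L)"
    using \<tau>L partial_auto_unique[OF partial_auto_converse[OF r(1)]] by (metis converseI inj_onI)
  moreover have "\<tau> k = k" if "k \<in> K" for k
  proof -
    have "(k, k) \<in> r" using r(1) that unfolding partial_auto_def by blast
    then show ?thesis by (rule \<tau>)
  qed
  ultimately have "\<tau> \<in> auts" unfolding auts_def by blast
  moreover have "\<tau> x = y" using \<tau> r r0 by blast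
  ultimately show ?thesis using that by blast
qed

end

subsection \<open>Separability in characteristic \<open>p\<close>\<close>

text \<open>Formal derivative of a coefficient list with leading coefficient first. The result is
  not normalized: in characteristic \<open>p\<close> its leading entries may vanish. In return its
  length is known and identities between values can be proved by induction on lists.\<close>

fun (in ring) pder :: "'a list \<Rightarrow> 'a list" where
  "pder [] = []"
| "pder (c # p) = (if p = [] then [] else add_pow R (length p) c # pder p)"

lemma (in ring) length_pder: "length (pder p) = length p - 1"
  by (induct p) auto

lemma (in ring) pder_closed: "set p \<subseteq> carrier R \<Longrightarrow> set (pder p) \<subseteq> carrier R"
  by (induct p) auto

lemma (in ring) eval_pder_Cons:
  assumes "set (c # p) \<subseteq> carrier R" "a \<in> carrier R"
  shows "eval (pder (c # p)) a = add_pow R (length p) c \<otimes> a [^] (length p - 1) \<oplus> eval (pder p) a"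
  using assms by (auto simp: length_pder)

text \<open>Appending \<open>\<zero>\<close> multiplies a polynomial by the variable, so this is the
  product rule with a factor \<open>X\<close>.\<close>

lemma (in cring) eval_pder_append_zero:
  assumes "set p \<subseteq> carrier R" "a \<in> carrier R"
  shows "eval (pder (p @ [\<zero>])) a = a \<otimes> eval (pder p) a \<oplus> eval p a"
  using assms(1)
proof (induct p)
  case Nil
  then show ?case using assms by simp
next
  case (Cons c p)
  have cl: "c \<in> carrier R" "set p \<subseteq> carrier R" "set (p @ [\<zero>]) \<subseteq> carrier R" using Cons by auto
  let ?n = "length p" and ?D = "eval (pder p) a" and ?e = "eval p a"
  have D: "?D \<in> carrier R" "?e \<in> carrier R"
    using eval_in_carrier[OF pder_closed[OF cl(2)] assms(2)] eval_in_carrier[OF cl(2) assms(2)] by auto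
  have pow: "add_pow R ?n c \<otimes> a [^] ?n = a \<otimes> (add_pow R ?n c \<otimes> a [^] (?n - 1))"
  proof (cases ?n)
    case 0 then show ?thesis using cl assms by (simp add: add_pow_def)
  next
    case (Suc m)
    then show ?thesis using cl assms by (simp add: m_ac del: add.nat_pow_Suc)
  qed
  have sc: "add_pow R (Suc ?n) c = add_pow R ?n c \<oplus> c"
    by (simp add: cl)
  have "eval (pder ((c # p) @ [\<zero>])) a
      = add_pow R (Suc ?n) c \<otimes> a [^] ?n \<oplus> (a \<otimes> ?D \<oplus> ?e)"
    using eval_pder_Cons[of c "p @ [\<zero>]" a] cl assms Cons(1)[OF cl(2)] by simp
  also have "\<dots> = a \<otimes> (add_pow R ?n c \<otimes> a [^] (?n - 1)) \<oplus> c \<otimes> a [^] ?n \<oplus> (a \<otimes> ?D \<oplus> ?e)"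
    unfolding sc using cl assms by (subst l_distr) (simp_all add: pow)
  also have "\<dots> = a \<otimes> (add_pow R ?n c \<otimes> a [^] (?n - 1) \<oplus> ?D) \<oplus> (c \<otimes> a [^] ?n \<oplus> ?e)"
    using cl assms D by (simp add: r_distr a_ac)
  also have "\<dots> = a \<otimes> eval (pder (c # p)) a \<oplus> eval (c # p) a"
    using eval_pder_Cons[of c p a] cl assms by simp
  finally show ?case .
qed

lemma (in ring) eval_pder_replicate:
  assumes "set p \<subseteq> carrier R" "a \<in> carrier R"
  shows "eval (pder (replicate n \<zero> @ p)) a = eval (pder p) a"
proof (induct n)
  case (Suc n)
  have "set (pder (replicate n \<zero> @ p)) \<subseteq> carrier R"
    using assms by (intro pder_closed) auto
  then show ?case
    using Suc assms eval_pder_Cons[of \<zero> "replicate n \<zero> @ p" a] eval_in_carrier[of "pder (replicate n \<zero> @ p)" a]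
    by auto
qed simp

lemma (in ring) eval_pder_normalize:
  assumes "set p \<subseteq> carrier R" "a \<in> carrier R"
  shows "eval (pder (normalize p)) a = eval (pder p) a"
  using eval_pder_replicate[OF normalize_in_carrier[OF assms(1)] assms(2)] normalize_trick[of p] by metis

lemma (in ring) map2_add_closed:
  "set p \<subseteq> carrier R \<Longrightarrow> set q \<subseteq> carrier R \<Longrightarrow> set (map2 (\<oplus>) p q) \<subseteq> carrier R"
  by (induct p q rule: list_induct2') auto

lemma (in ring) eval_pder_map2:
  assumes "length p = length q" "set p \<subseteq> carrier R" "set q \<subseteq> carrier R" "a \<in> carrier R"
  shows "eval (pder (map2 (\<oplus>) p q)) a = eval (pder p) a \<oplus> eval (pder q) a"
  using assms(1-3)
proof (induct p q rule: list_induct2)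
  case (Cons c p d q)
  then have cl: "c \<in> carrier R" "d \<in> carrier R" "set p \<subseteq> carrier R" "set q \<subseteq> carrier R" by auto
  have s: "set (map2 (\<oplus>) p q) \<subseteq> carrier R"
    using cl map2_add_closed by blast
  have e: "eval (pder p) a \<in> carrier R" "eval (pder q) a \<in> carrier R"
    using eval_in_carrier[OF pder_closed] cl assms by auto
  have "eval (pder (map2 (\<oplus>) (c # p) (d # q))) a
     = add_pow R (length p) (c \<oplus> d) \<otimes> a [^] (length p - 1) \<oplus> (eval (pder p) a \<oplus> eval (pder q) a)"
    using eval_pder_Cons[of "c \<oplus> d" "map2 (\<oplus>) p q" a] cl s assms(4) Cons(1,2)
    by simp
  also have "\<dots> = eval (pder (c # p)) a \<oplus> eval (pder (d # q)) a"
    using eval_pder_Cons[of c p a] eval_pder_Cons[of d q a] cl assms(4) e Cons(1)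
    by (simp add: add.nat_pow_distrib l_distr a_ac)
  finally show ?case .
qed simp

lemma (in ring) eval_pder_poly_add:
  assumes "set p \<subseteq> carrier R" "set q \<subseteq> carrier R" "a \<in> carrier R"
  shows "eval (pder (poly_add p q)) a = eval (pder p) a \<oplus> eval (pder q) a"
proof -
  have *: "eval (pder (poly_add p q)) a = eval (pder p) a \<oplus> eval (pder q) a"
    if "length q \<le> length p" "set p \<subseteq> carrier R" "set q \<subseteq> carrier R" for p q
  proof -
    let ?q = "replicate (length p - length q) \<zero> @ q"
    have q: "set ?q \<subseteq> carrier R" "length p = length ?q" using that by auto
    have s: "set (map2 (\<oplus>) p ?q) \<subseteq> carrier R"
      using map2_add_closed[OF that(2) q(1)] .
    show ?thesis
      using that eval_pder_map2[OF q(2) that(2) q(1) assms(3)] eval_pder_normalize[OF s assms(3)]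
        eval_pder_replicate[OF that(3) assms(3)] by simp
  qed
  have cl: "eval (pder p) a \<in> carrier R" "eval (pder q) a \<in> carrier R"
    using eval_in_carrier[OF pder_closed] assms by auto
  show ?thesis
  proof (cases "length q \<le> length p")
    case True then show ?thesis using * assms by blast
  next
    case False then show ?thesis
      using *[of p q] assms poly_add_comm[OF assms(1,2)] cl a_comm by simp
  qed
qed

lemma (in ring) eval_pder_smult:
  assumes "set p \<subseteq> carrier R" "a \<in> carrier R" "k \<in> carrier R"
  shows "eval (pder (map ((\<otimes>) k) p)) a = k \<otimes> eval (pder p) a"
  using assms(1)
proof (induct p)
  case (Cons c p)
  then have cl: "c \<in> carrier R" "set p \<subseteq> carrier R" "set (map ((\<otimes>) k) p) \<subseteq> carrier R"
    using assms by auto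
  have "eval (pder p) a \<in> carrier R" using eval_in_carrier[OF pder_closed] cl assms by auto
  then show ?case
    using eval_pder_Cons[of "k \<otimes> c" "map ((\<otimes>) k) p" a] eval_pder_Cons[of c p a] cl assms Cons(1)
    by (simp add: r_distr add_pow_rdistr m_assoc[symmetric])
qed (use assms in simp)

text \<open>Product rule for the factor \<open>X - a\<close>, read at \<open>a\<close>, where the
  summand that still contains this factor drops out.\<close>

lemma (in domain) eval_pder_linear_mult:
  assumes p: "p \<in> carrier (poly_ring R)" and a: "a \<in> carrier R"
  shows "eval (pder ([\<one>, \<ominus> a] \<otimes>\<^bsub>poly_ring R\<^esub> p)) a = eval p a"
proof -
  have s: "set p \<subseteq> carrier R" using p by (simp add: polynomial_incl univ_poly_carrier)
  have e: "eval (pder p) a \<in> carrier R" "eval p a \<in> carrier R"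
    using eval_in_carrier[OF pder_closed] eval_in_carrier s a by auto
  have m: "poly_mult [\<ominus> a] p = normalize (map ((\<otimes>) (\<ominus> a)) p)"
    using poly_mult_const'(1)[OF s, of "\<ominus> a"] a by simp
  have id: "map ((\<otimes>) \<one>) p = p" using s by (induct p) auto
  have "[\<one>, \<ominus> a] \<otimes>\<^bsub>poly_ring R\<^esub> p = poly_add (p @ [\<zero>]) (normalize (map ((\<otimes>) (\<ominus> a)) p))"
    using m id by (simp add: univ_poly_mult)
  moreover have "set (map ((\<otimes>) (\<ominus> a)) p) \<subseteq> carrier R" using s a by auto
  ultimately have "eval (pder ([\<one>, \<ominus> a] \<otimes>\<^bsub>poly_ring R\<^esub> p)) a
      = eval (pder (p @ [\<zero>])) a \<oplus> \<ominus> a \<otimes> eval (pder p) a"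
    using eval_pder_poly_add[of "p @ [\<zero>]" "normalize (map ((\<otimes>) (\<ominus> a)) p)" a]
      eval_pder_normalize[of "map ((\<otimes>) (\<ominus> a)) p" a] eval_pder_smult[OF s a, of "\<ominus> a"] normalize_in_carrier[of "map ((\<otimes>) (\<ominus> a)) p"] s a
    by simp
  also have "\<dots> = eval p a"
    unfolding eval_pder_append_zero[OF s a] using e a by (simp add: a_ac l_minus r_neg1 r_neg a_lcomm)
  finally show ?thesis .
qed

lemma (in domain) eval_pder_double_root:
  assumes p: "p \<in> carrier (poly_ring R)" and a: "a \<in> carrier R" and m: "alg_mult p a \<ge> 2"
  shows "eval p a = \<zero>" "eval (pder p) a = \<zero>"
proof -
  interpret UP: domain "poly_ring R" using univ_poly_is_domain[OF carrier_is_subring] .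
  have "p \<noteq> []" using m unfolding alg_mult_def by auto
  let ?l = "[\<one>, \<ominus> a]"
  have l: "?l \<in> carrier (poly_ring R)" using a by (simp add: univ_poly_def polynomial_def)
  have "(?l [^]\<^bsub>poly_ring R\<^esub> (2::nat)) pdivides p"
    using le_alg_mult_imp_pdivides[OF a p m] .
  then obtain q where q: "q \<in> carrier (poly_ring R)" "p = (?l [^]\<^bsub>poly_ring R\<^esub> (2::nat)) \<otimes>\<^bsub>poly_ring R\<^esub> q"
    unfolding pdivides_def factor_def by blast
  let ?r = "?l \<otimes>\<^bsub>poly_ring R\<^esub> q"
  have r: "?r \<in> carrier (poly_ring R)" using l q by simp
  have pr: "p = ?l \<otimes>\<^bsub>poly_ring R\<^esub> ?r"
    using q l by (simp add: numeral_2_eq_2 UP.m_assoc)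
  interpret E: ring_hom_ring "poly_ring R" R "\<lambda>p. eval p a"
    using eval_ring_hom[OF carrier_is_subring a] .
  have "eval ?l a = \<zero>" using a by (simp add: r_neg)
  then have 0: "eval ?r a = \<zero>" using E.hom_mult[OF l q(1)] E.hom_closed[OF q(1)] by simp
  then show "eval p a = \<zero>" unfolding pr using E.hom_mult[OF l r] E.hom_closed[OF l] by simp
  show "eval (pder p) a = \<zero>" unfolding pr using eval_pder_linear_mult[OF r a] 0 by simp
qed

lemma (in ring) coeff_pder:
  "p \<noteq> [] \<Longrightarrow> set p \<subseteq> carrier R \<Longrightarrow> coeff (pder p) i = add_pow R (Suc i) (coeff p (Suc i))"
proof (induct p)
  case (Cons c p)
  show ?case
  proof (cases "p = []")
    case False
    then have "coeff (pder (c # p)) i = (if i = length p - 1 then add_pow R (length p) c else coeff (pder p) i)"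
      by (simp add: length_pder)
    also have "\<dots> = add_pow R (Suc i) (coeff (c # p) (Suc i))"
      using Cons False by (cases "Suc i = length p") auto
    finally show ?thesis .
  qed (use Cons in simp)
qed simp

lemma (in ring) eval_eq_finsum:
  assumes "set p \<subseteq> carrier R" "a \<in> carrier R"
  shows "eval p a = (\<Oplus>i\<in>{..<length p}. coeff p i \<otimes> a [^] i)"
  using assms(1)
proof (induct p)
  case (Cons c p)
  have "(\<Oplus>i\<in>{..<length p}. coeff (c # p) i \<otimes> a [^] i) = (\<Oplus>i\<in>{..<length p}. coeff p i \<otimes> a [^] i)"
    using Cons assms by (intro finsum_cong') auto
  moreover have "(\<Oplus>i\<in>{..<length (c # p)}. coeff (c # p) i \<otimes> a [^] i)
      = c \<otimes> a [^] length p \<oplus> (\<Oplus>i\<in>{..<length p}. coeff (c # p) i \<otimes> a [^] i)"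
    using Cons(2) assms(2) by (simp add: lessThan_Suc Pi_def coeff_in_carrier)
  ultimately show ?case using Cons by simp
qed simp

lemma (in cring) binomial_expansion:
  assumes a: "a \<in> carrier R" and b: "b \<in> carrier R"
  shows "(a \<oplus> b) [^] (n::nat) = (\<Oplus>k\<in>{..n}. add_pow R (n choose k) (a [^] k \<otimes> b [^] (n - k)))"
proof (induct n)
  case 0
  then show ?case using a b by simp
next
  case (Suc n)
  define t where "t n k = add_pow R (n choose k) (a [^] k \<otimes> b [^] (n - k))" for n k :: nat
  have t: "t n k \<in> carrier R" for n k unfolding t_def using a b by simp
  \<comment> \<open>By Pascal's rule each term for \<open>Suc n\<close> is \<open>a\<close> times a
    term for \<open>n\<close> plus a \<open>u\<close>. For \<open>k \<le> n\<close> the element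
    \<open>u k\<close> is \<open>b\<close> times \<open>t n k\<close>; at \<open>k = Suc n\<close>
    the binomial coefficient makes it vanish.\<close>
  define u where "u k = add_pow R (n choose k) (a [^] k \<otimes> b [^] (Suc n - k))" for k
  have u: "u k \<in> carrier R" for k unfolding u_def using a b by simp
  have tS: "t (Suc n) (Suc k) = a \<otimes> t n k \<oplus> u (Suc k)" for k
    unfolding t_def u_def using a b
    by (simp add: add_pow_rdistr add.nat_pow_mult[symmetric] m_ac del: add.nat_pow_Suc)
  have t0: "t (Suc n) 0 = u 0" unfolding t_def u_def by simp
  have ub: "u k = b \<otimes> t n k" if "k \<le> n" for k
    unfolding t_def u_def using a b that by (simp add: add_pow_rdistr Suc_diff_le m_ac)
  have ul: "u (Suc n) = \<zero>" unfolding u_def by (simp add: a b binomial_eq_0 del: binomial_Suc_n)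
  have "(\<Oplus>k\<in>{..Suc n}. t (Suc n) k) = (\<Oplus>k\<in>{..n}. a \<otimes> t n k \<oplus> u (Suc k)) \<oplus> u 0"
    using finsum_Suc2[of "t (Suc n)" n] t by (simp add: tS t0)
  also have "\<dots> = (\<Oplus>k\<in>{..n}. a \<otimes> t n k) \<oplus> (\<Oplus>k\<in>{..n}. u (Suc k)) \<oplus> u 0"
    using t u a by (simp add: finsum_addf)
  also have "\<dots> = (\<Oplus>k\<in>{..n}. a \<otimes> t n k) \<oplus> (\<Oplus>k\<in>{..Suc n}. u k)"
    using finsum_Suc2[of u n] t u a by (simp add: a_assoc)
  also have "(\<Oplus>k\<in>{..Suc n}. u k) = (\<Oplus>k\<in>{..n}. u k)"
    using finsum_Suc[of u n] u ul by simp
  also have "(\<Oplus>k\<in>{..n}. u k) = (\<Oplus>k\<in>{..n}. b \<otimes> t n k)"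
    using ub t b by (intro finsum_cong') auto
  also have "(\<Oplus>k\<in>{..n}. a \<otimes> t n k) \<oplus> (\<Oplus>k\<in>{..n}. b \<otimes> t n k) = (a \<oplus> b) \<otimes> (\<Oplus>k\<in>{..n}. t n k)"
    using a b t by (simp add: finsum_rdistr[symmetric] l_distr)
  also have "\<dots> = (a \<oplus> b) [^] Suc n"
    using Suc a b unfolding t_def by (simp add: m_comm)
  finally show ?case unfolding t_def by simp
qed

lemma (in domain) freshman:
  assumes p: "normalization_semidom_class.prime (p::nat)" "add_pow R p \<one> = \<zero>" and a: "a \<in> carrier R" and b: "b \<in> carrier R"
  shows "(a \<oplus> b) [^] p = a [^] p \<oplus> b [^] p"
proof -
  have pz: "add_pow R n x = \<zero>" if "p dvd n" "x \<in> carrier R" for n x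
  proof -
    have "add_pow R p x = \<zero>"
      using add_pow_ldistr[of \<one> x p] p(2) that by simp
    then show ?thesis using that by (auto simp: add.nat_pow_pow[symmetric] dvd_def)
  qed
  define t where "t k = add_pow R (p choose k) (a [^] k \<otimes> b [^] (p - k))" for k :: nat
  have t: "t k \<in> carrier R" for k unfolding t_def using a b by simp
  have "(\<Oplus>k\<in>{..p}. t k) = (\<Oplus>k\<in>{0, p}. t k)"
  proof (rule add.finprod_mono_neutral_cong_right)
    fix i assume i: "i \<in> {..p} - {0, p}"
    then have "p dvd (p choose i)" using p(1) by (intro dvd_choose_prime) auto
    then show "t i = \<zero>" unfolding t_def using pz a b by simp
  qed (use t in auto)
  also have "\<dots> = b [^] p \<oplus> a [^] p"
    using prime_gt_0_nat[OF p(1)] t a b by (simp add: Pi_def) (simp add: t_def)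
  finally show ?thesis
    using binomial_expansion[OF a b, of p] a b unfolding t_def by (simp add: a_comm)
qed

section \<open>Products of spans and generating lists\<close>

declare (in ring) Span.simps [simp del]

lemma (in ring) subalgebraI:
  assumes K: "subfield K R" and V: "V \<subseteq> carrier R" "\<zero> \<in> V"
    "\<And>a b. a \<in> V \<Longrightarrow> b \<in> V \<Longrightarrow> a \<oplus> b \<in> V" "\<And>k a. k \<in> K \<Longrightarrow> a \<in> V \<Longrightarrow> k \<otimes> a \<in> V"
  shows "subalgebra K V R"
proof -
  have neg: "\<ominus> a \<in> V" if "a \<in> V" for a
  proof -
    have "\<ominus> \<one> \<otimes> a \<in> V" using V(4)[OF _ that] subringE(3,5)[OF subfieldE(1)[OF K]] by blast
    moreover have "\<ominus> \<one> \<otimes> a = \<ominus> a" using that V(1) by (simp add: l_minus subset_iff)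
    ultimately show ?thesis by simp
  qed
  have "subgroup V (add_monoid R)"
    using V neg by (intro add.subgroupI) (auto simp: a_inv_def)
  then show ?thesis using V(4) by (simp add: subalgebra_def subalgebra_axioms_def)
qed

text \<open>The elements that multiply a fixed element into \<open>W\<close> form a subspace. Hence
  a condition on products of generators passes to the spans, one factor at a time.\<close>

lemma (in ring) Span_mult:
  assumes K: "subfield K R" and W: "subalgebra K W R"
    and comm: "\<And>a b. a \<in> carrier R \<Longrightarrow> b \<in> carrier R \<Longrightarrow> a \<otimes> b = b \<otimes> a"
    and U: "set Us \<subseteq> carrier R" and V: "set Vs \<subseteq> carrier R"
    and UV: "\<And>u v. u \<in> set Us \<Longrightarrow> v \<in> set Vs \<Longrightarrow> u \<otimes> v \<in> W"
    and x: "x \<in> Span K Us" and y: "y \<in> Span K Vs"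
  shows "x \<otimes> y \<in> W"
proof -
  have KR: "K \<subseteq> carrier R" using subfieldE(3)[OF K] .
  have W': "\<zero> \<in> W" "\<And>a b. a \<in> W \<Longrightarrow> b \<in> W \<Longrightarrow> a \<oplus> b \<in> W" "\<And>k a. k \<in> K \<Longrightarrow> a \<in> W \<Longrightarrow> k \<otimes> a \<in> W"
    using W unfolding subalgebra_def subalgebra_axioms_def
    by (auto dest: subgroup.one_closed subgroup.m_closed)
  have *: "subalgebra K {a \<in> carrier R. a \<otimes> b \<in> W} R" if "b \<in> carrier R" for b
    using that W' KR by (intro subalgebraI[OF K]) (auto simp: l_distr m_assoc subset_iff)
  have uy: "u \<otimes> y \<in> W" if u: "u \<in> set Us" for u
  proof -
    have uR: "u \<in> carrier R" using u U by auto
    have "v \<otimes> u \<in> W" if "v \<in> set Vs" for v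
      using UV[OF u that] V that comm[OF uR, of v] by auto
    then have "set Vs \<subseteq> {a \<in> carrier R. a \<otimes> u \<in> W}" using V by auto
    then have "y \<in> {a \<in> carrier R. a \<otimes> u \<in> W}"
      using subalgebra_Span_incl[OF K *[OF uR]] y by blast
    then show ?thesis using comm uR by auto
  qed
  have yR: "y \<in> carrier R" using y Span_in_carrier[OF KR V] by blast
  have "set Us \<subseteq> {a \<in> carrier R. a \<otimes> y \<in> W}" using uy U by auto
  then show ?thesis using subalgebra_Span_incl[OF K *[OF yR]] x by blast
qed

text \<open>The case distinction on lengths is the point: a list whose span contains as many
  independent elements as the list has entries must itself be independent.\<close>

lemma (in ring) spanning_sublist:
  assumes K: "subfield K R" and "set Us \<subseteq> carrier R"
  shows "\<exists>Vs. independent K Vs \<and> Span K Vs = Span K Us \<and>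
    (length Vs < length Us \<or> (length Vs = length Us \<and> independent K Us))"
  using assms(2)
proof (induct Us)
  case Nil
  then show ?case by (intro exI[of _ "[]"]) simp
next
  case (Cons u Us)
  then have u: "u \<in> carrier R" "set Us \<subseteq> carrier R" by auto
  from Cons obtain Vs where Vs: "independent K Vs" "Span K Vs = Span K Us"
    "length Vs < length Us \<or> (length Vs = length Us \<and> independent K Us)" by auto
  show ?case
  proof (cases "u \<in> Span K Us")
    case True
    then have "Span K (u # Us) \<subseteq> Span K Us"
      using mono_Span_subset[OF K, of "u # Us" Us] Span_base_incl[OF K u(2)] u by auto
    then have "Span K (u # Us) = Span K Us" using mono_Span[OF K u(2,1)] by blast
    then show ?thesis using Vs by (intro exI[of _ Vs]) auto
  next
    case False
    then have "independent K (u # Vs)" using Vs u by (intro li_Cons) auto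
    moreover have "Span K (u # Vs) = Span K (u # Us)" using Vs(2) by (simp add: Span.simps)
    moreover have "independent K Us \<Longrightarrow> independent K (u # Us)" using False u by (intro li_Cons)
    ultimately show ?thesis using Vs(3) by (intro exI[of _ "u # Vs"]) auto
  qed
qed

section \<open>Separability through spans of p-th powers\<close>

locale char_p_field = field +
  fixes p :: nat
  assumes prime_p: "normalization_semidom_class.prime p" and char_p: "add_pow R p \<one> = \<zero>"
begin

abbreviation frob :: "'a \<Rightarrow> 'a" where "frob x \<equiv> x [^] p"

lemma p_gt_1: "p > 1"
  using prime_p prime_gt_1_nat by blast

lemma frob_add: "a \<in> carrier R \<Longrightarrow> b \<in> carrier R \<Longrightarrow> frob (a \<oplus> b) = frob a \<oplus> frob b"
  using freshman prime_p char_p by blast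

lemma frob_mult: "a \<in> carrier R \<Longrightarrow> b \<in> carrier R \<Longrightarrow> frob (a \<otimes> b) = frob a \<otimes> frob b"
  by (simp add: nat_pow_distrib)

lemma frob_zero: "frob \<zero> = \<zero>"
  using p_gt_1 by (simp add: nat_pow_zero)

lemma frob_minus: "a \<in> carrier R \<Longrightarrow> frob (\<ominus> a) = \<ominus> frob a"
  using frob_add[of a "\<ominus> a"] frob_zero by (simp add: r_neg) (metis a_comm a_inv_closed minus_equality nat_pow_closed)

lemma frob_inj: "a \<in> carrier R \<Longrightarrow> b \<in> carrier R \<Longrightarrow> frob a = frob b \<Longrightarrow> a = b"
proof -
  assume a: "a \<in> carrier R" and b: "b \<in> carrier R" and eq: "frob a = frob b"
  have pz: "c = \<zero>" if "c \<in> carrier R" "c [^] (n::nat) = \<zero>" for c n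
    using that by (induct n) (auto simp: integral_iff)
  have "frob (a \<ominus> b) = \<zero>" using a b eq frob_add frob_minus by (simp add: r_neg a_minus_def)
  then have "a \<ominus> b = \<zero>" using pz a b by blast
  then show "a = b" using a b by simp
qed

text \<open>\<open>x\<close> is separable over \<open>K\<close> iff \<open>K(x) = K(x\<^sup>p)\<close>.\<close>

definition sep :: "'a set \<Rightarrow> 'a \<Rightarrow> bool" where
  "sep K x \<longleftrightarrow> x \<in> carrier R \<and> x \<in> simple_extension K (frob x)"

lemma sep_mono: "K \<subseteq> K' \<Longrightarrow> sep K x \<Longrightarrow> sep K' x"
  unfolding sep_def using mono_simple_extension by blast

text \<open>The model is a power basis of \<open>K(x)\<close> with \<open>x\<close> separable: the
  space generated by \<open>Us\<close> lies in the space generated by the p-th powers of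
  \<open>Us\<close>. Unlike the equation \<open>K(x) = K(x^p)\<close>, this property visibly
  survives joining two lists and multiplying them out.\<close>

definition frob_spanned :: "'a set \<Rightarrow> 'a list \<Rightarrow> bool" where
  "frob_spanned K Us \<longleftrightarrow> set Us \<subseteq> carrier R \<and> set Us \<subseteq> Span K (map frob Us)"

context
  fixes K assumes K: "subfield K R"
begin

lemma KR: "K \<subseteq> carrier R" using subfieldE(3)[OF K] .

lemma map_frob_carrier: "set Us \<subseteq> carrier R \<Longrightarrow> set (map frob Us) \<subseteq> carrier R" by auto

text \<open>Taking p-th powers is additive and raises scalars to their p-th powers, which stay in
  \<open>K\<close>. So the preimage of a subspace is a subspace.\<close>

lemma Span_frob:
  assumes "set Us \<subseteq> carrier R" "x \<in> Span K Us"
  shows "frob x \<in> Span K (map frob Us)"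
proof -
  let ?W = "Span K (map frob Us)"
  note W = Span_subgroup_props[OF K map_frob_carrier[OF assms(1)]]
  have kp: "frob k \<in> K" if "k \<in> K" for k
    using that by (induct p) (use subringE(3,6)[OF subfieldE(1)[OF K]] in auto)
  have "subalgebra K {a \<in> carrier R. frob a \<in> ?W} R"
  proof (rule subalgebraI[OF K])
    fix k a assume "k \<in> K" "a \<in> {a \<in> carrier R. frob a \<in> ?W}"
    then show "k \<otimes> a \<in> {a \<in> carrier R. frob a \<in> ?W}"
      using Span_smult_closed[OF K map_frob_carrier[OF assms(1)]] kp KR by (auto simp: frob_mult)
  qed (use W in \<open>auto simp: frob_zero frob_add\<close>)
  moreover have "set Us \<subseteq> {a \<in> carrier R. frob a \<in> ?W}"
    using assms(1) Span_base_incl[OF K map_frob_carrier[OF assms(1)]] by auto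
  ultimately show ?thesis using subalgebra_Span_incl[OF K] assms(2) by blast
qed

lemma frob_spanned_append:
  assumes "frob_spanned K Us" "frob_spanned K Vs"
  shows "frob_spanned K (Us @ Vs)"
  using assms mono_Span_append(1)[OF K map_frob_carrier map_frob_carrier, of Us Vs]
    mono_Span_append(2)[OF K map_frob_carrier map_frob_carrier, of Vs Us]
  unfolding frob_spanned_def by auto

lemma frob_spanned_mult:
  assumes U: "frob_spanned K Us" and V: "frob_spanned K Vs"
  shows "frob_spanned K (concat (map (\<lambda>u. map ((\<otimes>) u) Vs) Us))"
proof -
  let ?Ws = "concat (map (\<lambda>u. map ((\<otimes>) u) Vs) Us)"
  have c: "set Us \<subseteq> carrier R" "set Vs \<subseteq> carrier R" using assms unfolding frob_spanned_def by auto
  have cW: "set ?Ws \<subseteq> carrier R" using c by auto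
  have "u \<otimes> v \<in> Span K (map frob ?Ws)" if "u \<in> set Us" "v \<in> set Vs" for u v
  proof (rule Span_mult[OF K Span_is_subalgebra[OF K map_frob_carrier[OF cW]] m_comm map_frob_carrier[OF c(1)] map_frob_carrier[OF c(2)]])
    fix a b assume "a \<in> set (map frob Us)" "b \<in> set (map frob Vs)"
    then obtain u v where "u \<in> set Us" "v \<in> set Vs" "a = frob u" "b = frob v" by auto
    then have "a \<otimes> b \<in> set (map frob ?Ws)" using c by (auto simp: frob_mult[symmetric] subset_iff intro!: image_eqI bexI[of _ u])
    then show "a \<otimes> b \<in> Span K (map frob ?Ws)" using Span_base_incl[OF K map_frob_carrier[OF cW]] by blast
  qed (use that U V in \<open>auto simp: frob_spanned_def\<close>)
  then show ?thesis unfolding frob_spanned_def using cW by auto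
qed

text \<open>MacLane's criterion. Once \<open>Ys\<close> is completed to a basis of the span of
  \<open>Us\<close>, the p-th powers of that basis generate a space containing the basis. They are
  no more numerous than the basis, so they are independent too.\<close>

lemma frob_spanned_independent:
  assumes U: "frob_spanned K Us" and Y: "independent K Ys" "set Ys \<subseteq> Span K Us"
  shows "independent K (map frob Ys)"
proof -
  have c: "set Us \<subseteq> carrier R" using U unfolding frob_spanned_def by auto
  obtain n where n: "dimension n K (Span K Us)"
    using Span_finite_dimension[OF K c] unfolding finite_dimension_def by blast
  obtain Zs where Zs: "length (Zs @ Ys) = n" "independent K (Zs @ Ys)" "Span K (Zs @ Ys) = Span K Us"
    using complete_base[OF K n Y] by blast
  let ?B = "Zs @ Ys"
  have cB: "set ?B \<subseteq> carrier R" using independent_in_carrier[OF Zs(2)] .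
  note cfB = map_frob_carrier[OF cB]
  have "frob u \<in> Span K (map frob ?B)" if "u \<in> set Us" for u
    using Span_frob[OF cB] Span_base_incl[OF K c] that Zs(3) by blast
  then have "Span K (map frob Us) \<subseteq> Span K (map frob ?B)"
    by (intro mono_Span_subset[OF K _ cfB]) auto
  then have "Span K Us \<subseteq> Span K (map frob ?B)"
    using U mono_Span_subset[OF K _ cfB, of Us] unfolding frob_spanned_def by blast
  then have le: "set ?B \<subseteq> Span K (map frob ?B)"
    using Zs(3) Span_base_incl[OF K cB] by blast
  obtain Vs where Vs: "independent K Vs" "Span K Vs = Span K (map frob ?B)"
    "length Vs < length (map frob ?B) \<or> (length Vs = length (map frob ?B) \<and> independent K (map frob ?B))"
    using spanning_sublist[OF K cfB] by blast
  have "length ?B \<le> length Vs"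
    using independent_length_le[OF K Zs(2) Vs(1)] le Vs(2) by blast
  then have "independent K (map frob Zs @ map frob Ys)" using Vs(3) by auto
  then show ?thesis by (rule independent_split(1)[OF K])
qed

lemma equal_of_dimension:
  assumes "dimension n K E" "dimension n K E'" "E \<subseteq> E'"
  shows "E = E'"
proof -
  obtain Vs where "independent K Vs" "length Vs = n" "Span K Vs = E" "set Vs \<subseteq> carrier R"
    using exists_base[OF K assms(1)] by blast
  then show ?thesis
    using independent_length_eq_dimension[OF K assms(2), of Vs] assms(3) Span_base_incl[OF K, of Vs] by blast
qed

lemma map_frob_exp_base: "x \<in> carrier R \<Longrightarrow> map frob (exp_base x n) = exp_base (frob x) n"
  unfolding exp_base_def by (simp add: nat_pow_pow mult.commute)

text \<open>The list is the power basis of \<open>x\<close>. Since \<open>K(x^p) = K(x)\<close>, the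
  two elements have the same degree, so the p-th powers of this list are exactly the power basis of
  \<open>x^p\<close>.\<close>

lemma sep_imp_frob_spanned:
  assumes x: "sep K x" and alg: "(algebraic over K) x" "(algebraic over K) (frob x)"
  shows "\<exists>Us. frob_spanned K Us \<and> x \<in> Span K Us"
proof -
  have xc: "x \<in> carrier R" "frob x \<in> carrier R" using x unfolding sep_def by auto
  let ?m = "degree (Irr K x)"
  let ?Us = "exp_base x ?m"
  have c: "set ?Us \<subseteq> carrier R" using xc unfolding exp_base_def by auto
  note S = simple_extension_is_subring[OF subfieldE(1)[OF K]]
  have "simple_extension K (frob x) \<subseteq> simple_extension K x"
  proof (rule simple_extension_subring_incl[OF S[OF xc(1)] simple_extension_incl[OF KR xc(1)]])
    interpret S: subring "simple_extension K x" R using S[OF xc(1)] .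
    have "x \<in> simple_extension K x" using simple_extension_mem[OF subfieldE(1)[OF K] xc(1)] .
    then show "frob x \<in> simple_extension K x"
      by (induct p) (use subringE(3,6)[OF S[OF xc(1)]] in auto)
  qed
  moreover have "simple_extension K x \<subseteq> simple_extension K (frob x)"
    using x simple_extension_subring_incl[OF S[OF xc(2)] simple_extension_incl[OF KR xc(2)]]
    unfolding sep_def by blast
  ultimately have eq: "simple_extension K (frob x) = simple_extension K x" by blast
  have "degree (Irr K (frob x)) = ?m"
    using dimension_simple_extension[OF K xc(1) alg(1)] dimension_simple_extension[OF K xc(2) alg(2)]
      dimension_is_inj[OF K] eq by metis
  then have "Span K (map frob ?Us) = simple_extension K x"
    using Span_exp_base[OF K xc(2) alg(2)] map_frob_exp_base[OF xc(1)] eq by simp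
  moreover have "Span K ?Us = simple_extension K x" using Span_exp_base[OF K xc(1) alg(1)] .
  ultimately have "frob_spanned K ?Us" "x \<in> Span K ?Us"
    using c Span_base_incl[OF K c] simple_extension_mem[OF subfieldE(1)[OF K] xc(1)]
    unfolding frob_spanned_def by simp_all
  then show ?thesis by blast
qed

text \<open>The span of \<open>Us\<close> need not be a ring, so the list grows with the exponent:
  each stage multiplies it by \<open>Us\<close> and adds \<open>\<one>\<close>.\<close>

lemma frob_spanned_power:
  assumes U: "frob_spanned K Us" and x: "x \<in> Span K Us"
  shows "\<exists>Ws. frob_spanned K Ws \<and> (\<forall>i<n. x [^] (i::nat) \<in> Span K Ws)"
proof (induct n)
  case 0
  then show ?case using U by auto
next
  case (Suc n)
  then obtain Ws where Ws: "frob_spanned K Ws" "\<forall>i<n. x [^] i \<in> Span K Ws" by blast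
  have c: "set Us \<subseteq> carrier R" "set Ws \<subseteq> carrier R" using U Ws unfolding frob_spanned_def by auto
  let ?P = "concat (map (\<lambda>u. map ((\<otimes>) u) Us) Ws)"
  let ?A = "\<one> # ?P"
  have "frob_spanned K [\<one>]"
    unfolding frob_spanned_def using Span_base_incl[OF K, of "[\<one>]"] by simp
  from frob_spanned_append[OF this frob_spanned_mult[OF Ws(1) U]]
  have A: "frob_spanned K ?A" by simp
  then have cA: "set ?A \<subseteq> carrier R" unfolding frob_spanned_def by blast
  have "x [^] i \<in> Span K ?A" if "i < Suc n" for i
  proof (cases i)
    case 0
    then show ?thesis using Span_base_incl[OF K cA] by auto
  next
    case (Suc j)
    have "x [^] j \<otimes> x \<in> Span K ?A"
    proof (rule Span_mult[OF K Span_is_subalgebra[OF K cA] m_comm c(2,1)])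
      fix u v assume "u \<in> set Ws" "v \<in> set Us"
      then have "u \<otimes> v \<in> set ?A" by auto
      then show "u \<otimes> v \<in> Span K ?A" using Span_base_incl[OF K cA] by blast
    qed (use that Suc Ws x in auto)
    then show ?thesis using Suc by simp
  qed
  then show ?case using A by blast
qed

text \<open>The powers of \<open>x\<close> below its degree lie in one such span, so their p-th
  powers are again independent. There are enough of them to generate \<open>K(x)\<close>, and all of
  them lie in \<open>K(x^p)\<close>.\<close>

lemma frob_spanned_imp_sep:
  assumes U: "frob_spanned K Us" and x: "x \<in> Span K Us"
    and alg: "(algebraic over K) x"
  shows "sep K x"
proof -
  let ?m = "degree (Irr K x)"
  have c: "set Us \<subseteq> carrier R" using U unfolding frob_spanned_def by auto
  have xc: "x \<in> carrier R" "frob x \<in> carrier R" using x Span_in_carrier[OF KR c(1)] by auto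
  obtain Ws where Ws: "frob_spanned K Ws" "\<forall>i<?m. x [^] i \<in> Span K Ws"
    using frob_spanned_power[OF U x] by blast
  have "set (exp_base x ?m) \<subseteq> Span K Ws" using Ws(2) unfolding exp_base_def by auto
  from frob_spanned_independent[OF Ws(1) exp_base_independent[OF K xc(1) alg] this]
  have ind: "independent K (exp_base (frob x) ?m)" using map_frob_exp_base[OF xc(1)] by simp
  note S = simple_extension_is_subring[OF subfieldE(1)[OF K]]
  have sub: "set (exp_base (frob x) ?m) \<subseteq> E" if "subring E R" "frob x \<in> E" for E
  proof -
    have "frob x [^] i \<in> E" for i :: nat
      by (induct i) (use that subringE(3,6)[OF that(1)] in auto)
    then show ?thesis unfolding exp_base_def by auto
  qed
  have "x \<in> simple_extension K x" using simple_extension_mem[OF subfieldE(1)[OF K] xc(1)] .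
  then have "frob x \<in> simple_extension K x"
    by (induct p) (use subringE(3,6)[OF S[OF xc(1)]] in auto)
  then have "Span K (exp_base (frob x) ?m) = simple_extension K x"
    using independent_length_eq_dimension[OF K dimension_simple_extension[OF K xc(1) alg] ind sub[OF S[OF xc(1)]]]
    by (simp add: exp_base_def)
  moreover have "Span K (exp_base (frob x) ?m) \<subseteq> simple_extension K (frob x)"
  proof (rule subalgebra_Span_incl[OF K])
    show "subalgebra K (simple_extension K (frob x)) R"
      using subringE[OF S[OF xc(2)]] simple_extension_incl[OF KR xc(2)] by (intro subalgebraI[OF K]) auto
    show "set (exp_base (frob x) ?m) \<subseteq> simple_extension K (frob x)"
      using sub[OF S[OF xc(2)]] simple_extension_mem[OF subfieldE(1)[OF K] xc(2)] by blast
  qed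
  ultimately show ?thesis
    unfolding sep_def using xc \<open>x \<in> simple_extension K x\<close> by blast
qed

end

end

lemma (in ring) subring_nat_pow:
  "subring S R \<Longrightarrow> x \<in> S \<Longrightarrow> x [^] (n::nat) \<in> S"
  by (induct n) (auto intro: subringE(3,6))

lemma (in ring) subring_add_pow:
  "subring S R \<Longrightarrow> x \<in> S \<Longrightarrow> add_pow R (n::nat) x \<in> S"
  by (induct n) (auto intro: subringE(2,7))

lemma (in ring) coeff_map_rev:
  "i < n \<Longrightarrow> coeff (map f (rev [0..<n])) i = f i"
  by (simp add: coeff_nth rev_nth)

section \<open>Minimal polynomials and conjugates\<close>

context algebraic_closure
begin

lemma KL: "K \<subseteq> carrier L" using subfieldE(3)[OF subfield_axioms] .

lemma Ksub: "subring K L" using subfieldE(1)[OF subfield_axioms] .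

lemma alg: "x \<in> carrier L \<Longrightarrow> (algebraic over K) x" by (rule algebraic_extension)

lemma Irr_props:
  assumes "x \<in> carrier L"
  shows "Irr K x \<in> carrier (K[X])" "pirreducible K (Irr K x)" "lead_coeff (Irr K x) = \<one>" "eval (Irr K x) x = \<zero>"
  using IrrE[OF subfield_axioms assms alg[OF assms]] .

lemma Irr_set: "x \<in> carrier L \<Longrightarrow> set (Irr K x) \<subseteq> K"
  using Irr_props(1) polynomial_incl[of K] by (simp add: univ_poly_carrier)

lemma Irr_not_Nil: "x \<in> carrier L \<Longrightarrow> Irr K x \<noteq> []"
  using pirreducibleE(1)[OF Ksub Irr_props(1,2)] by blast

lemma Irr_degree: "x \<in> carrier L \<Longrightarrow> degree (Irr K x) \<ge> 1"
  using pirreducible_degree[OF subfield_axioms Irr_props(1,2)] by blast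

lemma Irr_poly: "x \<in> carrier L \<Longrightarrow> Irr K x \<in> carrier (poly_ring L)"
  using Irr_props(1) carrier_polynomial_shell[OF Ksub] by blast

text \<open>The length of a nonempty list exceeds its degree by one, so the length bound gives
  \<open>q\<close> a smaller degree than the minimal polynomial, which divides it. No normalization
  of \<open>q\<close> is presupposed because derivatives are inserted here.\<close>

lemma Irr_degree_le:
  assumes x: "x \<in> carrier L" and q: "set q \<subseteq> K" "eval q x = \<zero>" "length q \<le> degree (Irr K x)"
  shows "coeff q i = \<zero>"
proof -
  have qL: "set q \<subseteq> carrier L" using q KL by blast
  have N: "normalize q \<in> carrier (K[X])"
    using normalize_gives_polynomial[OF q(1)] by (simp add: univ_poly_carrier)
  have "eval (normalize q) x = \<zero>" using eval_normalize[OF qL x] q(2) by simp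
  then have "Irr K x pdivides normalize q"
    using Irr_minimal[OF subfield_axioms x alg[OF x] N] by blast
  then have "normalize q = [] \<or> degree (Irr K x) \<le> degree (normalize q)"
    using pdivides_imp_degree_le[OF Ksub Irr_props(1)[OF x] N] by blast
  then have "normalize q = []"
    using normalize_length_le[of q] q(3) Irr_degree[OF x] by (cases "normalize q") auto
  then show ?thesis using normalize_coeff[of q] by (metis coeff.simps(1))
qed

lemma Irr_root:
  assumes x: "x \<in> carrier L" and a: "a \<in> carrier L" "eval (Irr K x) a = \<zero>"
  shows "Irr K a = Irr K x"
  using minimal_polynomial_is_unique[OF subfield_axioms a(1) alg[OF a(1)]]
    Irr_props(1-3)[OF x] Irr_props[OF a(1)] a(2) by (metis (no_types, lifting))

text \<open>The minimal polynomial of \<open>x\<close> is also that of its root \<open>a\<close>.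
  Its derivative vanishes at \<open>a\<close> and has smaller degree, so all coefficients of the
  derivative are zero.\<close>

lemma double_root_coeff:
  assumes x: "x \<in> carrier L" and a: "a \<in> carrier L" and m: "alg_mult (Irr K x) a \<ge> 2"
  shows "add_pow L (Suc i) (coeff (Irr K x) (Suc i)) = \<zero>"
proof -
  let ?P = "Irr K x"
  note d = eval_pder_double_root[OF Irr_poly[OF x] a m]
  have Pa: "Irr K a = ?P" using Irr_root[OF x a d(1)] .
  have "set q \<subseteq> K \<Longrightarrow> set (pder q) \<subseteq> K" for q
    by (induct q) (auto simp: subring_add_pow[OF Ksub])
  then have "coeff (pder ?P) i = \<zero>"
    using Irr_degree_le[OF a, of "pder ?P"] Irr_set[OF x] d(2) Pa length_pder[of ?P] by auto
  then show ?thesis using coeff_pder[of ?P i] Irr_not_Nil[OF x] Irr_set[OF x] KL by auto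
qed

lemma coeff_Irr_degree: "x \<in> carrier L \<Longrightarrow> coeff (Irr K x) (degree (Irr K x)) = \<one>"
  using lead_coeff_simp[OF Irr_not_Nil] Irr_props(3) by simp

text \<open>A multiple root would kill the derivative, whose leading coefficient is the degree times
  \<open>\<one>\<close>.\<close>

lemma char_0_simple_roots:
  assumes c: "\<And>n. n > 0 \<Longrightarrow> add_pow L (n::nat) \<one> \<noteq> \<zero>"
    and x: "x \<in> carrier L" and a: "a \<in> carrier L"
  shows "alg_mult (Irr K x) a \<le> 1"
proof (rule ccontr)
  assume "\<not> ?thesis"
  then have m: "alg_mult (Irr K x) a \<ge> 2" by simp
  obtain i where i: "degree (Irr K x) = Suc i" using Irr_degree[OF x] by (cases "degree (Irr K x)") auto
  show False using double_root_coeff[OF x a m, of i] coeff_Irr_degree[OF x] c[of "Suc i"] i by auto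
qed

text \<open>Outside \<open>K\<close> the degree is at least two, and the roots counted with
  multiplicity are as many as the degree; a simple root \<open>x\<close> cannot account for all of
  them.\<close>

lemma other_root:
  assumes x: "x \<in> carrier L" "x \<notin> K" and m: "alg_mult (Irr K x) x \<le> 1"
  obtains y where "y \<in> carrier L" "eval (Irr K x) y = \<zero>" "y \<noteq> x"
proof -
  let ?P = "Irr K x"
  have "degree ?P \<noteq> 1"
  proof
    assume 1: "degree ?P = 1"
    then have "\<ominus> (inv (lead_coeff ?P) \<otimes> const_term ?P) = x"
      using degree_one_root_condition[OF Irr_poly[OF x(1)] 1, of x] Irr_props(4)[OF x(1)] Irr_not_Nil[OF x(1)] x(1)
      unfolding is_root_def by simp
    moreover have "inv (lead_coeff ?P) \<otimes> const_term ?P \<in> K"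
      using degree_one_root(2)[OF subfield_axioms Irr_props(1)[OF x(1)] 1] .
    ultimately show False using subringE(5)[OF Ksub] x(2) by metis
  qed
  then have deg: "degree ?P \<ge> 2" using Irr_degree[OF x(1)] by linarith
  have sz: "size (roots ?P) = degree ?P"
    using roots_over_carrier[OF Irr_poly[OF x(1)]] unfolding splitted_def .
  have "\<not> set_mset (roots ?P) \<subseteq> {x}"
  proof
    assume "set_mset (roots ?P) \<subseteq> {x}"
    then have "size (roots ?P) \<le> count (roots ?P) x"
      by (metis order_refl set_mset_subset_singletonD size_replicate_mset count_replicate_mset)
    then show False using sz deg m alg_mult_eq_count_roots[OF Irr_poly[OF x(1)]] by simp
  qed
  then obtain y where "y \<in># roots ?P" "y \<noteq> x" by blast
  then show ?thesis using that roots_mem_iff_is_root[OF Irr_poly[OF x(1)]] unfolding is_root_def by blast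
qed

lemma aut_hom: "\<tau> \<in> auts \<Longrightarrow> ring_hom_ring L L \<tau>"
  unfolding auts_def using ring_axioms by (simp add: ring_hom_ringI2)

lemma
  assumes t: "\<tau> \<in> auts"
  shows aut_closed: "x \<in> carrier L \<Longrightarrow> \<tau> x \<in> carrier L"
    and aut_mult: "x \<in> carrier L \<Longrightarrow> y \<in> carrier L \<Longrightarrow> \<tau> (x \<otimes> y) = \<tau> x \<otimes> \<tau> y"
    and aut_add: "x \<in> carrier L \<Longrightarrow> y \<in> carrier L \<Longrightarrow> \<tau> (x \<oplus> y) = \<tau> x \<oplus> \<tau> y"
    and aut_minus: "x \<in> carrier L \<Longrightarrow> \<tau> (\<ominus> x) = \<ominus> \<tau> x"
    and aut_one: "\<tau> \<one> = \<one>" and aut_zero: "\<tau> \<zero> = \<zero>"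
    and aut_pow: "x \<in> carrier L \<Longrightarrow> \<tau> (x [^] (n::nat)) = \<tau> x [^] n"
    and aut_fix: "k \<in> K \<Longrightarrow> \<tau> k = k"
    and aut_inj: "x \<in> carrier L \<Longrightarrow> y \<in> carrier L \<Longrightarrow> \<tau> x = \<tau> y \<longleftrightarrow> x = y"
proof -
  interpret H: ring_hom_ring L L \<tau> using aut_hom[OF t] .
  show "x \<in> carrier L \<Longrightarrow> \<tau> x \<in> carrier L"
    and "x \<in> carrier L \<Longrightarrow> y \<in> carrier L \<Longrightarrow> \<tau> (x \<otimes> y) = \<tau> x \<otimes> \<tau> y"
    and "x \<in> carrier L \<Longrightarrow> y \<in> carrier L \<Longrightarrow> \<tau> (x \<oplus> y) = \<tau> x \<oplus> \<tau> y"
    and "x \<in> carrier L \<Longrightarrow> \<tau> (\<ominus> x) = \<ominus> \<tau> x"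
    and "\<tau> \<one> = \<one>" and "\<tau> \<zero> = \<zero>"
    and "x \<in> carrier L \<Longrightarrow> \<tau> (x [^] (n::nat)) = \<tau> x [^] n"
    by (simp_all add: H.hom_nat_pow)
  show "k \<in> K \<Longrightarrow> \<tau> k = k" using t unfolding auts_def by blast
  show "x \<in> carrier L \<Longrightarrow> y \<in> carrier L \<Longrightarrow> \<tau> x = \<tau> y \<longleftrightarrow> x = y"
    using t unfolding auts_def by (auto dest: inj_onD)
qed

lemma aut_eq_zero: "\<tau> \<in> auts \<Longrightarrow> x \<in> carrier L \<Longrightarrow> \<tau> x = \<zero> \<longleftrightarrow> x = \<zero>"
  by (metis aut_inj aut_zero zero_closed)

lemma aut_inverse:
  assumes "\<tau> \<in> auts" "x \<in> carrier L" "x \<noteq> \<zero>" shows "\<tau> (inv x) = inv (\<tau> x)"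
proof -
  have "x \<in> Units L" using assms field_Units by blast
  then have i: "inv x \<in> carrier L" "x \<otimes> inv x = \<one>" by auto
  then have "\<tau> x \<otimes> \<tau> (inv x) = \<one>" using aut_mult[OF assms(1,2) i(1)] aut_one[OF assms(1)] by simp
  then show ?thesis using aut_closed[OF assms(1)] assms(2) i(1) by (metis comm_inv_char)
qed

lemma aut_id: "id \<in> auts" unfolding auts_def by auto

lemma aut_comp: "\<sigma>' \<in> auts \<Longrightarrow> \<tau> \<in> auts \<Longrightarrow> \<sigma>' \<circ> \<tau> \<in> auts"
  unfolding auts_def using ring_hom_trans[of \<tau> L L \<sigma>' L] image_comp[of \<sigma>' \<tau> "carrier L"]
  by (auto simp del: image_comp simp: comp_inj_on)

lemma aut_inv:
  assumes t: "\<tau> \<in> auts"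
  obtains \<rho> where "\<rho> \<in> auts" "\<And>x. x \<in> carrier L \<Longrightarrow> \<rho> (\<tau> x) = x" "\<And>x. x \<in> carrier L \<Longrightarrow> \<tau> (\<rho> x) = x"
proof -
  have b: "inj_on \<tau> (carrier L)" "\<tau> ` carrier L = carrier L" using t unfolding auts_def by auto
  let ?r = "inv_into (carrier L) \<tau>"
  have 1: "?r (\<tau> x) = x" if "x \<in> carrier L" for x using b that by simp
  have 2: "\<tau> (?r x) = x" if "x \<in> carrier L" for x using b that by (simp add: f_inv_into_f)
  have 3: "?r x \<in> carrier L" if "x \<in> carrier L" for x using b that by (metis inv_into_into)
  have "?r \<in> ring_hom L L"
  proof (rule ring_hom_memI)
    fix x y assume xy: "x \<in> carrier L" "y \<in> carrier L"
    show "?r x \<in> carrier L" using 3 xy by blast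
    have "\<tau> (?r x \<otimes> ?r y) = x \<otimes> y" "\<tau> (?r x \<oplus> ?r y) = x \<oplus> y"
      using aut_mult[OF t] aut_add[OF t] 2 3 xy by simp_all
    then show "?r (x \<otimes> y) = ?r x \<otimes> ?r y" "?r (x \<oplus> y) = ?r x \<oplus> ?r y"
      using 1[of "?r x \<otimes> ?r y"] 1[of "?r x \<oplus> ?r y"] 3 xy by simp_all
  next
    show "?r \<one> = \<one>" using 1[of \<one>] aut_one[OF t] by simp
  qed
  moreover have "?r ` carrier L = carrier L"
  proof
    show "?r ` carrier L \<subseteq> carrier L" using 3 by blast
    show "carrier L \<subseteq> ?r ` carrier L"
    proof
      fix x assume x: "x \<in> carrier L"
      then show "x \<in> ?r ` carrier L" using 1[OF x] aut_closed[OF t x] by (metis imageI)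
    qed
  qed
  moreover have "inj_on ?r (carrier L)" using 2 by (metis inj_onI)
  moreover have "?r k = k" if "k \<in> K" for k using 1[of k] aut_fix[OF t that] KL that by auto
  ultimately have "?r \<in> auts" unfolding auts_def by blast
  then show ?thesis using that 1 2 by blast
qed

definition orbit :: "'a \<Rightarrow> 'a set" where "orbit x = (\<lambda>\<tau>. \<tau> x) ` auts"

lemma orbit_self: "x \<in> orbit x"
  unfolding orbit_def using aut_id by (intro image_eqI[of _ _ id]) auto

lemma orbit_carrier: "x \<in> carrier L \<Longrightarrow> orbit x \<subseteq> carrier L"
  unfolding orbit_def using aut_closed by auto

lemma orbit_finite:
  assumes x: "x \<in> carrier L" shows "finite (orbit x)"
proof -
  have "is_root (Irr K x) (\<tau> x)" if t: "\<tau> \<in> auts" for \<tau>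
  proof -
    interpret H: ring_hom_ring L L \<tau> using aut_hom[OF t] .
    have "map \<tau> (Irr K x) = Irr K x" using Irr_set[OF x] aut_fix[OF t] by (intro map_idI) auto
    then have "eval (Irr K x) (\<tau> x) = \<tau> (eval (Irr K x) x)"
      using H.eval_hom'[OF x, of "Irr K x"] Irr_set[OF x] KL by auto
    then show ?thesis using Irr_props(4)[OF x] Irr_not_Nil[OF x] aut_closed[OF t x] aut_zero[OF t]
      unfolding is_root_def by auto
  qed
  then have "orbit x \<subseteq> {y. is_root (Irr K x) y}" unfolding orbit_def by auto
  then show ?thesis using finite_number_of_roots[OF Irr_poly[OF x]] finite_subset by blast
qed

lemma orbit_stable:
  assumes "\<tau> \<in> auts" and that: "x \<in> carrier L" shows "\<tau> ` orbit x = orbit x"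
proof
  show "\<tau> ` orbit x \<subseteq> orbit x"
  proof
    fix y assume "y \<in> \<tau> ` orbit x"
    then obtain s where s: "s \<in> auts" "y = (\<tau> \<circ> s) x" unfolding orbit_def by auto
    then show "y \<in> orbit x" unfolding orbit_def using aut_comp[OF assms(1) s(1)] by blast
  qed
  show "orbit x \<subseteq> \<tau> ` orbit x"
  proof
    fix y assume "y \<in> orbit x"
    then obtain s where s: "s \<in> auts" "y = s x" unfolding orbit_def by blast
    obtain r where r: "r \<in> auts" "\<And>z. z \<in> carrier L \<Longrightarrow> \<tau> (r z) = z" using aut_inv[OF assms(1)] by metis
    have "y = \<tau> ((r \<circ> s) x)" using r(2)[OF aut_closed[OF s(1) that]] s(2) by simp
    moreover have "(r \<circ> s) x \<in> orbit x" unfolding orbit_def using aut_comp[OF r(1) s(1)] by blast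
    ultimately show "y \<in> \<tau> ` orbit x" by blast
  qed
qed

end

section \<open>The separable closure and its automorphisms\<close>

locale char_p_closure = algebraic_closure L K + char_p_field L p
  for L (structure) and K and p
begin

lemma frob_power_inj:
  "a \<in> carrier L \<Longrightarrow> b \<in> carrier L \<Longrightarrow> a [^] (p ^ n) = b [^] (p ^ n) \<Longrightarrow> a = b"
proof (induct n)
  case (Suc n)
  have "c [^] (p ^ Suc n) = frob (c [^] (p ^ n))" if "c \<in> carrier L" for c
    using that by (simp add: nat_pow_pow mult.commute)
  then have "a [^] (p ^ n) = b [^] (p ^ n)"
    using Suc frob_inj[of "a [^] (p ^ n)" "b [^] (p ^ n)"] by auto
  then show ?case using Suc by blast
qed simp

text \<open>This reformulation carries the closure properties: lists are joined for a sum and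
  multiplied out for a product.\<close>

lemma sep_iff: "sep K x \<longleftrightarrow> (\<exists>Us. frob_spanned K Us \<and> x \<in> Span K Us)"
proof
  assume "sep K x"
  then show "\<exists>Us. frob_spanned K Us \<and> x \<in> Span K Us"
    using sep_imp_frob_spanned[OF subfield_axioms] alg unfolding sep_def by simp
next
  assume "\<exists>Us. frob_spanned K Us \<and> x \<in> Span K Us"
  then obtain Us where U: "frob_spanned K Us" "x \<in> Span K Us" by blast
  then have "x \<in> carrier L" using Span_in_carrier[OF KL] unfolding frob_spanned_def by blast
  then show "sep K x" using frob_spanned_imp_sep[OF subfield_axioms U] alg by blast
qed

lemma sep_carrier: "sep K x \<Longrightarrow> x \<in> carrier L" unfolding sep_def by blast

lemma sep_base: "k \<in> K \<Longrightarrow> sep K k"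
  using simple_extension_incl[OF KL, of "frob k"] KL unfolding sep_def by (auto simp: subset_iff)

lemma sep_add: assumes "sep K x" "sep K y" shows "sep K (x \<oplus> y)"
proof -
  obtain Us Vs where U: "frob_spanned K Us" "x \<in> Span K Us" and V: "frob_spanned K Vs" "y \<in> Span K Vs"
    using assms sep_iff by blast
  have c: "set Us \<subseteq> carrier L" "set Vs \<subseteq> carrier L" "set (Us @ Vs) \<subseteq> carrier L"
    using U V unfolding frob_spanned_def by auto
  have "x \<oplus> y \<in> Span K (Us @ Vs)"
    using mono_Span_append(1)[OF subfield_axioms c(1,2)] mono_Span_append(2)[OF subfield_axioms c(2,1)]
      Span_subgroup_props(3)[OF subfield_axioms c(3)] U V by blast
  then show ?thesis using frob_spanned_append[OF subfield_axioms U(1) V(1)] sep_iff by blast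
qed

lemma sep_mult: assumes "sep K x" "sep K y" shows "sep K (x \<otimes> y)"
proof -
  obtain Us Vs where U: "frob_spanned K Us" "x \<in> Span K Us" and V: "frob_spanned K Vs" "y \<in> Span K Vs"
    using assms sep_iff by blast
  let ?W = "concat (map (\<lambda>u. map ((\<otimes>) u) Vs) Us)"
  have W: "frob_spanned K ?W" using frob_spanned_mult[OF subfield_axioms U(1) V(1)] .
  have c: "set Us \<subseteq> carrier L" "set Vs \<subseteq> carrier L" "set ?W \<subseteq> carrier L"
    using U V W unfolding frob_spanned_def by auto
  have "x \<otimes> y \<in> Span K ?W"
    using Span_base_incl[OF subfield_axioms c(3)]
    by (intro Span_mult[OF subfield_axioms Span_is_subalgebra[OF subfield_axioms c(3)] m_comm c(1,2) _ U(2) V(2)]) auto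
  then show ?thesis using W sep_iff by blast
qed

lemma sep_subfield: "subfield {x. sep K x} L"
proof (rule intermediate_subfield)
  show "subring {x. sep K x} L"
  proof (rule subringI)
    fix h assume h: "h \<in> {x. sep K x}"
    have "\<ominus> \<one> \<in> K" using subringE(3,5)[OF Ksub] by blast
    then have "sep K (\<ominus> \<one> \<otimes> h)" using sep_mult sep_base h by blast
    then show "\<ominus> h \<in> {x. sep K x}" using h sep_carrier by (simp add: l_minus)
  qed (use sep_carrier sep_add sep_mult sep_base subringE(3)[OF Ksub] in auto)
  show "K \<subseteq> {x. sep K x}" using sep_base by blast
qed

text \<open>An automorphism over \<open>K\<close> carries the expression of \<open>x\<close> as a
  polynomial in \<open>x^p\<close> to the same expression for the image.\<close>

lemma sep_aut:
  assumes t: "\<tau> \<in> auts" and x: "sep K x" shows "sep K (\<tau> x)"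
proof -
  have xc: "x \<in> carrier L" using sep_carrier[OF x] .
  have "\<tau> z \<in> simple_extension K (\<tau> y)" if "z \<in> simple_extension K y" "y \<in> carrier L" for y z
    using that(1)
  proof (induct rule: simple_extension.induct)
    case zero then show ?case by (simp add: aut_zero[OF t])
  next
    case (lin k1 k2)
    have "k1 \<in> carrier L" using lin(1) simple_extension_in_carrier[OF KL that(2)] by blast
    moreover have "k2 \<in> carrier L" using lin KL by blast
    ultimately have "\<tau> (k1 \<otimes> y \<oplus> k2) = \<tau> k1 \<otimes> \<tau> y \<oplus> k2"
      using aut_add[OF t] aut_mult[OF t] aut_fix[OF t lin(3)] that(2) by simp
    then show ?case using simple_extension.lin[OF lin(2,3)] by simp
  qed
  from this[of x "frob x"] show ?thesis
    using x xc aut_closed[OF t xc] aut_pow[OF t xc] unfolding sep_def by simp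
qed

text \<open>Take the exponent for which the degree of \<open>x^(p^n)\<close> over \<open>K\<close>
  is least. Passing to one further p-th power gives a subfield of no smaller degree, hence the same
  field, which is separability.\<close>

lemma exists_sep_power:
  assumes x: "x \<in> carrier L" shows "\<exists>n. sep K (x [^] (p ^ n))"
proof -
  let ?d = "\<lambda>n. degree (Irr K (x [^] (p ^ n)))"
  obtain n where n: "\<And>m. ?d n \<le> ?d m" using ex_has_least_nat[of "\<lambda>_. True" 0 ?d] by auto
  let ?y = "x [^] (p ^ n)"
  have y: "?y \<in> carrier L" "frob ?y \<in> carrier L" using x by auto
  have "frob ?y = x [^] (p ^ Suc n)" using x by (simp add: nat_pow_pow mult.commute)
  then have le: "degree (Irr K ?y) \<le> degree (Irr K (frob ?y))" using n[of "Suc n"] by metis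
  note S = simple_extension_is_subring[OF Ksub]
  have sub: "simple_extension K (frob ?y) \<subseteq> simple_extension K ?y"
    using simple_extension_subring_incl[OF S[OF y(1)] simple_extension_incl[OF KL y(1)]]
      subring_nat_pow[OF S[OF y(1)] simple_extension_mem[OF Ksub y(1)]] by blast
  note d1 = dimension_simple_extension[OF subfield_axioms y(1) alg[OF y(1)]]
  note d2 = dimension_simple_extension[OF subfield_axioms y(2) alg[OF y(2)]]
  obtain Vs where Vs: "set Vs \<subseteq> carrier L" "independent K Vs" "length Vs = degree (Irr K (frob ?y))" "Span K Vs = simple_extension K (frob ?y)"
    using exists_base[OF subfield_axioms d2] by blast
  have "length Vs \<le> degree (Irr K ?y)"
    using independent_length_le_dimension[OF subfield_axioms d1 Vs(2)] Span_base_incl[OF subfield_axioms Vs(1)] Vs(4) sub by blast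
  then have "degree (Irr K ?y) = degree (Irr K (frob ?y))" using le Vs(3) by linarith
  then have "simple_extension K (frob ?y) = simple_extension K ?y"
    using equal_of_dimension[OF subfield_axioms _ d1 sub] d2 by simp
  then have "sep K ?y" unfolding sep_def using y(1) simple_extension_mem[OF Ksub y(1)] by simp
  then show ?thesis by blast
qed

lemma sep_degree:
  assumes x: "sep K x" shows "degree (Irr K (frob x)) = degree (Irr K x)"
proof -
  have y: "x \<in> carrier L" "frob x \<in> carrier L" using sep_carrier[OF x] by auto
  note S = simple_extension_is_subring[OF Ksub]
  have "simple_extension K (frob x) \<subseteq> simple_extension K x"
    using simple_extension_subring_incl[OF S[OF y(1)] simple_extension_incl[OF KL y(1)]]
      subring_nat_pow[OF S[OF y(1)] simple_extension_mem[OF Ksub y(1)]] by blast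
  moreover have "simple_extension K x \<subseteq> simple_extension K (frob x)"
    using simple_extension_subring_incl[OF S[OF y(2)] simple_extension_incl[OF KL y(2)]] x unfolding sep_def by blast
  ultimately show ?thesis
    using dimension_simple_extension[OF subfield_axioms y(1) alg[OF y(1)]]
      dimension_simple_extension[OF subfield_axioms y(2) alg[OF y(2)]] dimension_is_inj[OF subfield_axioms]
    by (metis subset_antisym)
qed

text \<open>With a multiple root only exponents divisible by \<open>p\<close> survive, so the
  minimal polynomial has the form \<open>g(X^p)\<close>. Then \<open>g\<close> annihilates
  \<open>x^p\<close>, although its degree is below that of \<open>x^p\<close>, which for separable
  \<open>x\<close> equals the degree of \<open>x\<close>.\<close>

lemma sep_simple_roots:
  assumes x: "sep K x" and a: "a \<in> carrier L"
  shows "alg_mult (Irr K x) a \<le> 1"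
proof (rule ccontr)
  assume "\<not> ?thesis"
  then have m: "alg_mult (Irr K x) a \<ge> 2" by simp
  have xc: "x \<in> carrier L" using sep_carrier[OF x] .
  let ?P = "Irr K x" and ?c = "coeff (Irr K x)" and ?m = "degree (Irr K x)"
  have cK: "?c i \<in> K" for i
  proof -
    have "?c i \<in> set ?P \<union> {\<zero>}" using coeff_img(3)[of ?P] by blast
    then show ?thesis using Irr_set[OF xc] subringE(2)[OF Ksub] by (auto simp: subset_iff)
  qed
  then have cL: "?c i \<in> carrier L" for i using KL by blast
  have c0: "?c i = \<zero>" if ndvd: "\<not> p dvd i" for i
  proof -
    obtain j where j: "i = Suc j" using ndvd by (cases i) auto
    have z: "add_pow L i (?c i) = \<zero>" using double_root_coeff[OF xc a m, of j] j by simp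
    have "add_pow L p (?c i) = \<zero>"
      using add_pow_ldistr[of \<one> "?c i" p] char_p cL[of i] by simp
    then have pz: "add_pow L (p * n) (?c i) = \<zero>" for n
      using cL[of i] by (simp add: add.nat_pow_pow[symmetric])
    \<comment> \<open>Both \<open>i\<close> and \<open>p\<close> annihilate the coefficient; a
      Bezout relation shows that the coefficient itself is zero.\<close>
    have "coprime i p" using ndvd prime_p by (metis coprime_commute prime_imp_coprime)
    then obtain u v where uv: "i * u = p * v + 1"
      using coprime_bezout_strong[of i p] p_gt_1 by auto
    have "add_pow L (i * u) (?c i) = add_pow L (p * v) (?c i) \<oplus> ?c i"
      unfolding uv using cL by (simp add: add.nat_pow_mult[symmetric])
    moreover have "add_pow L (i * u) (?c i) = \<zero>"
      using z cL[of i] by (simp add: add.nat_pow_pow[symmetric])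
    ultimately show ?thesis using pz cL by simp
  qed
  have "?c ?m = \<one>" using coeff_Irr_degree[OF xc] .
  then have "p dvd ?m" using c0[of ?m] by auto
  then obtain J where J: "?m = p * J" by (auto simp: dvd_def)
  have Jm: "J < ?m" using J p_gt_1 Irr_degree[OF xc] mult_less_mono1[of 1 p J] by (cases "J = 0") auto
  define g where "g = map (\<lambda>j. ?c (p * j)) (rev [0..<Suc J])"
  have g: "set g \<subseteq> K" "length g = Suc J" "coeff g j = ?c (p * j)" if "j < Suc J" for j
    using cK that coeff_map_rev[of j "Suc J"] unfolding g_def by (auto simp del: upt_Suc)
  have lP: "length ?P = Suc ?m" using Irr_not_Nil[OF xc] by (cases ?P) auto
  have gK: "set g \<subseteq> K" "length g = Suc J" using g[of 0] by auto
  have "\<zero> = (\<Oplus>i\<in>{..<Suc ?m}. ?c i \<otimes> x [^] i)"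
    using eval_eq_finsum[of ?P x] Irr_set[OF xc] KL Irr_props(4)[OF xc] xc lP by auto
  also have "\<dots> = (\<Oplus>i\<in>(*) p ` {..<Suc J}. ?c i \<otimes> x [^] i)"
  proof (rule add.finprod_mono_neutral_cong_right)
    show "(*) p ` {..<Suc J} \<subseteq> {..<Suc ?m}" unfolding J by (auto simp: less_Suc_eq_le)
    fix i assume i: "i \<in> {..<Suc ?m} - (*) p ` {..<Suc J}"
    have "\<not> p dvd i" using i p_gt_1 unfolding J by (auto simp: dvd_def image_iff less_Suc_eq_le)
    then show "?c i \<otimes> x [^] i = \<zero>" using c0 xc by simp
  qed (use cL xc in auto)
  also have "\<dots> = (\<Oplus>j\<in>{..<Suc J}. ?c (p * j) \<otimes> x [^] (p * j))"
    by (rule add.finprod_reindex) (use cL xc p_gt_1 in \<open>auto simp: inj_on_def\<close>)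
  also have "\<dots> = (\<Oplus>j\<in>{..<Suc J}. coeff g j \<otimes> frob x [^] j)"
    by (intro finsum_cong') (use g cL xc in \<open>auto simp: nat_pow_pow\<close>)
  also have "\<dots> = eval g (frob x)"
    using eval_eq_finsum[of g "frob x"] gK KL xc by auto
  finally have "eval g (frob x) = \<zero>" by simp
  then have "coeff g J = \<zero>"
    using Irr_degree_le[of "frob x" g J] gK xc Jm sep_degree[OF x] by auto
  then show False using g(3)[of J] J \<open>?c ?m = \<one>\<close> by auto
qed

lemma sep_moved:
  assumes x: "sep K x" "x \<notin> K"
  obtains \<tau> where "\<tau> \<in> auts" "\<tau> x \<noteq> x"
proof -
  have xc: "x \<in> carrier L" using sep_carrier[OF x(1)] .
  obtain y where y: "y \<in> carrier L" "eval (Irr K x) y = \<zero>" "y \<noteq> x"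
    using other_root[OF xc x(2) sep_simple_roots[OF x(1) xc]] .
  then show ?thesis using exists_aut[OF xc y(1,2)] that by metis
qed

lemma sep_fixed: "sep K x \<Longrightarrow> (\<And>\<tau>. \<tau> \<in> auts \<Longrightarrow> \<tau> x = x) \<Longrightarrow> x \<in> K"
  using sep_moved by metis

lemma pure_fixed:
  assumes "x \<in> carrier L" "x [^] (p ^ n) \<in> K" "\<tau> \<in> auts" shows "\<tau> x = x"
  using frob_power_inj[of "\<tau> x" x n] aut_pow[OF assms(3,1), of "p ^ n"] aut_fix[OF assms(3,2)] aut_closed[OF assms(3,1)] assms(1) by simp

end

subsection \<open>Preorders of valuations\<close>

text \<open>A valuation is encoded by the preorder \<open>le x y \<longleftrightarrow> v x \<le> v y\<close> on the field, with \<open>\<zero>\<close> on top, so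
  that no value group is needed. Equality of values is \<open>eqv\<close>, and \<open>near x y\<close> says that \<open>x\<close> and \<open>y\<close> have
  the same leading term, i.e. \<open>v x < v (x - y)\<close>.\<close>

locale preval = field +
  fixes le :: "'a \<Rightarrow> 'a \<Rightarrow> bool"
  assumes le_total: "x \<in> carrier R \<Longrightarrow> y \<in> carrier R \<Longrightarrow> le x y \<or> le y x"
    and le_trans: "le x y \<Longrightarrow> le y z \<Longrightarrow> x \<in> carrier R \<Longrightarrow> y \<in> carrier R \<Longrightarrow> z \<in> carrier R \<Longrightarrow> le x z"
    and le_zero: "x \<in> carrier R \<Longrightarrow> le x \<zero>"
    and zero_le: "x \<in> carrier R \<Longrightarrow> le \<zero> x \<Longrightarrow> x = \<zero>"
    and le_mult_right: "le x y \<Longrightarrow> x \<in> carrier R \<Longrightarrow> y \<in> carrier R \<Longrightarrow> z \<in> carrier R \<Longrightarrow> le (x \<otimes> z) (y \<otimes> z)"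
    and le_add: "le z x \<Longrightarrow> le z y \<Longrightarrow> x \<in> carrier R \<Longrightarrow> y \<in> carrier R \<Longrightarrow> z \<in> carrier R \<Longrightarrow> le z (x \<oplus> y)"
begin

definition lt :: "'a \<Rightarrow> 'a \<Rightarrow> bool" where "lt x y \<longleftrightarrow> \<not> le y x"
definition eqv :: "'a \<Rightarrow> 'a \<Rightarrow> bool" where "eqv x y \<longleftrightarrow> le x y \<and> le y x"
definition near :: "'a \<Rightarrow> 'a \<Rightarrow> bool" where "near x y \<longleftrightarrow> lt x (x \<ominus> y)"

lemma le_refl: "x \<in> carrier R \<Longrightarrow> le x x" using le_total by blast

lemma lt_imp_le: "lt x y \<Longrightarrow> x \<in> carrier R \<Longrightarrow> y \<in> carrier R \<Longrightarrow> le x y"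
  unfolding lt_def using le_total by blast

lemma lt_le_trans: "lt x y \<Longrightarrow> le y z \<Longrightarrow> x \<in> carrier R \<Longrightarrow> y \<in> carrier R \<Longrightarrow> z \<in> carrier R \<Longrightarrow> lt x z"
  unfolding lt_def using le_trans by blast

lemma le_lt_trans: "le x y \<Longrightarrow> lt y z \<Longrightarrow> x \<in> carrier R \<Longrightarrow> y \<in> carrier R \<Longrightarrow> z \<in> carrier R \<Longrightarrow> lt x z"
  unfolding lt_def using le_trans by blast

lemma lt_irrefl: "x \<in> carrier R \<Longrightarrow> \<not> lt x x"
  unfolding lt_def using le_refl by blast

lemma lt_nonzero: "lt x y \<Longrightarrow> x \<in> carrier R \<Longrightarrow> y \<in> carrier R \<Longrightarrow> x \<noteq> \<zero>"
  unfolding lt_def using le_zero by blast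

lemma lt_zero: "x \<in> carrier R \<Longrightarrow> lt x \<zero> \<longleftrightarrow> x \<noteq> \<zero>"
  unfolding lt_def using zero_le le_zero le_refl by blast

lemma eqv_refl: "x \<in> carrier R \<Longrightarrow> eqv x x" unfolding eqv_def using le_refl by blast
lemma eqv_sym: "eqv x y \<Longrightarrow> eqv y x" unfolding eqv_def by blast
lemma eqv_trans: "eqv x y \<Longrightarrow> eqv y z \<Longrightarrow> x \<in> carrier R \<Longrightarrow> y \<in> carrier R \<Longrightarrow> z \<in> carrier R \<Longrightarrow> eqv x z"
  unfolding eqv_def using le_trans by blast

lemma eqv_zero: "eqv x y \<Longrightarrow> x \<in> carrier R \<Longrightarrow> y \<in> carrier R \<Longrightarrow> x = \<zero> \<longleftrightarrow> y = \<zero>"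
  unfolding eqv_def using zero_le le_zero by blast

lemma inv_props:
  assumes "x \<in> carrier R" "x \<noteq> \<zero>"
  shows "inv x \<in> carrier R" "x \<otimes> inv x = \<one>" "inv x \<otimes> x = \<one>" "inv x \<noteq> \<zero>"
proof -
  have "x \<in> Units R" using assms field_Units by blast
  then show "inv x \<in> carrier R" "x \<otimes> inv x = \<one>" "inv x \<otimes> x = \<one>" by auto
  then show "inv x \<noteq> \<zero>" using assms by force
qed

lemma le_cancel:
  assumes "x \<in> carrier R" "y \<in> carrier R" "z \<in> carrier R" "z \<noteq> \<zero>"
  shows "le (x \<otimes> z) (y \<otimes> z) \<longleftrightarrow> le x y"
proof
  note i = inv_props[OF assms(3,4)]
  assume "le (x \<otimes> z) (y \<otimes> z)"
  then have "le (x \<otimes> z \<otimes> inv z) (y \<otimes> z \<otimes> inv z)" using assms i by (meson le_mult_right m_closed)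
  then show "le x y" using assms i by (simp add: m_assoc)
qed (use assms le_mult_right in blast)

lemma lt_cancel:
  assumes "x \<in> carrier R" "y \<in> carrier R" "z \<in> carrier R" "z \<noteq> \<zero>"
  shows "lt (x \<otimes> z) (y \<otimes> z) \<longleftrightarrow> lt x y"
  unfolding lt_def using le_cancel assms by blast

lemma le_mult:
  assumes "le a b" "le c d" "a \<in> carrier R" "b \<in> carrier R" "c \<in> carrier R" "d \<in> carrier R"
  shows "le (a \<otimes> c) (b \<otimes> d)"
proof -
  have "le (a \<otimes> c) (b \<otimes> c)" using le_mult_right assms by blast
  moreover have "le (b \<otimes> c) (b \<otimes> d)" using le_mult_right[of c d b] assms by (simp add: m_comm)
  ultimately show ?thesis using le_trans[of "a \<otimes> c" "b \<otimes> c"] assms by simp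
qed

lemma eqv_mult:
  assumes "eqv a b" "eqv c d" "a \<in> carrier R" "b \<in> carrier R" "c \<in> carrier R" "d \<in> carrier R"
  shows "eqv (a \<otimes> c) (b \<otimes> d)"
  using assms le_mult unfolding eqv_def by blast

lemma lt_mult:
  assumes "lt a b" "le c d" "c \<noteq> \<zero>" "a \<in> carrier R" "b \<in> carrier R" "c \<in> carrier R" "d \<in> carrier R"
  shows "lt (a \<otimes> c) (b \<otimes> d)"
proof -
  have "lt (a \<otimes> c) (b \<otimes> c)" using lt_cancel assms by blast
  moreover have "le (b \<otimes> c) (b \<otimes> d)" using le_mult_right[of c d b] assms by (simp add: m_comm)
  ultimately show ?thesis using lt_le_trans[of "a \<otimes> c" "b \<otimes> c"] assms by simp
qed

text \<open>The square of \<open>-1\<close> is \<open>1\<close>, so multiplying a comparison between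
  \<open>-1\<close> and \<open>1\<close> by \<open>-1\<close> reverses it and both directions
  hold.\<close>

lemma eqv_minus: assumes "x \<in> carrier R" shows "eqv (\<ominus> x) x"
proof -
  have "eqv (\<ominus> \<one>) \<one>"
  proof -
    have "le (\<ominus> \<one>) \<one> \<Longrightarrow> le \<one> (\<ominus> \<one>)" using le_mult_right[of "\<ominus> \<one>" \<one> "\<ominus> \<one>"] by (simp add: l_minus)
    moreover have "le \<one> (\<ominus> \<one>) \<Longrightarrow> le (\<ominus> \<one>) \<one>" using le_mult_right[of \<one> "\<ominus> \<one>" "\<ominus> \<one>"] by (simp add: l_minus)
    ultimately show ?thesis unfolding eqv_def using le_total[of "\<ominus> \<one>" \<one>] by auto
  qed
  from eqv_mult[OF this eqv_refl[OF assms]] assms show ?thesis by (simp add: l_minus)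
qed

lemma lt_add:
  assumes "lt z x" "lt z y" "x \<in> carrier R" "y \<in> carrier R" "z \<in> carrier R"
  shows "lt z (x \<oplus> y)"
proof (cases "le x y")
  case True
  then have "le x (x \<oplus> y)" using le_add le_refl assms by blast
  then show ?thesis using lt_le_trans[OF assms(1)] assms by simp
next
  case False
  then have "le y x" using le_total assms by blast
  then have "le y (x \<oplus> y)" using le_add le_refl assms by blast
  then show ?thesis using lt_le_trans[OF assms(2)] assms by simp
qed

lemma le_minus:
  assumes "le z x" "x \<in> carrier R" "z \<in> carrier R" shows "le z (\<ominus> x)"
  using eqv_minus[OF assms(2)] assms le_trans[of z x "\<ominus> x"] unfolding eqv_def by simp

lemma lt_minus:
  assumes "lt z x" "x \<in> carrier R" "z \<in> carrier R" shows "lt z (\<ominus> x)"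
  using eqv_minus[OF assms(2)] assms lt_le_trans[of z x "\<ominus> x"] unfolding eqv_def by simp

lemma le_pow: "le x y \<Longrightarrow> x \<in> carrier R \<Longrightarrow> y \<in> carrier R \<Longrightarrow> le (x [^] (n::nat)) (y [^] n)"
  by (induct n) (auto intro: le_mult le_refl)

lemma eqv_pow: "eqv x y \<Longrightarrow> x \<in> carrier R \<Longrightarrow> y \<in> carrier R \<Longrightarrow> eqv (x [^] (n::nat)) (y [^] n)"
  unfolding eqv_def using le_pow by blast

lemma pow_nonzero: "x \<in> carrier R \<Longrightarrow> x \<noteq> \<zero> \<Longrightarrow> x [^] (n::nat) \<noteq> \<zero>"
  by (induct n) (auto simp: integral_iff)

lemma lt_pow:
  assumes "lt x y" "x \<in> carrier R" "y \<in> carrier R" "n > 0"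
  shows "lt (x [^] (n::nat)) (y [^] n)"
  using assms(4)
proof (induct n)
  case (Suc n)
  have x: "x \<noteq> \<zero>" using lt_nonzero assms by blast
  have "le (x [^] n) (y [^] n)" using le_pow[OF lt_imp_le[OF assms(1-3)]] assms by blast
  then have "lt (x \<otimes> x [^] n) (y \<otimes> y [^] n)"
    using lt_mult[OF assms(1), of "x [^] n" "y [^] n"] pow_nonzero[OF assms(2) x] assms by simp
  then show ?case using assms by (simp add: m_comm)
qed simp

lemma near_refl: "x \<in> carrier R \<Longrightarrow> x \<noteq> \<zero> \<Longrightarrow> near x x"
  unfolding near_def by (simp add: lt_zero a_minus_def r_neg)

text \<open>If \<open>y\<close> had larger value than \<open>x\<close>, then \<open>x\<close>, being
  the sum of its difference to \<open>y\<close> and of \<open>y\<close>, would have larger value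
  than itself.\<close>

lemma near_eqv:
  assumes "near x y" "x \<in> carrier R" "y \<in> carrier R"
  shows "eqv x y"
proof -
  let ?d = "x \<ominus> y"
  have d: "lt x ?d" "?d \<in> carrier R" using assms unfolding near_def by auto
  have y: "y = x \<oplus> \<ominus> ?d" using assms(2,3) by (simp add: a_minus_def minus_add a_assoc[symmetric] r_neg) 
  have "le x (x \<oplus> \<ominus> ?d)" using d assms lt_imp_le by (intro le_add le_minus le_refl) auto
  then have "le x y" using y by simp
  moreover have "le y x"
  proof (rule ccontr)
    assume "\<not> le y x"
    then have "lt x y" unfolding lt_def .
    then have "lt x (?d \<oplus> y)" using lt_add d assms by blast
    moreover have "?d \<oplus> y = x" using assms(2,3) by (simp add: a_minus_def a_assoc l_neg)
    ultimately show False using lt_irrefl assms by simp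
  qed
  ultimately show ?thesis unfolding eqv_def by blast
qed

lemma near_nonzero:
  assumes "near x y" "x \<in> carrier R" "y \<in> carrier R"
  shows "x \<noteq> \<zero>" "y \<noteq> \<zero>"
proof -
  show "x \<noteq> \<zero>" using lt_nonzero assms unfolding near_def by blast
  then show "y \<noteq> \<zero>" using near_eqv[OF assms] eqv_zero assms by blast
qed

lemma near_sym:
  assumes "near x y" "x \<in> carrier R" "y \<in> carrier R"
  shows "near y x"
proof -
  have "lt x (\<ominus> (x \<ominus> y))" using assms lt_minus unfolding near_def by simp
  moreover have "\<ominus> (x \<ominus> y) = y \<ominus> x" using assms by (simp add: a_minus_def minus_add a_comm)
  ultimately have "lt x (y \<ominus> x)" by simp
  then show ?thesis unfolding near_def
    using le_lt_trans[of y x] near_eqv[OF assms] assms unfolding eqv_def by simp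
qed

lemma near_trans:
  assumes "near x y" "near y z" "x \<in> carrier R" "y \<in> carrier R" "z \<in> carrier R"
  shows "near x z"
proof -
  have "lt x (y \<ominus> z)"
    using le_lt_trans[of x y] near_eqv[OF assms(1)] assms unfolding near_def eqv_def by simp
  then have "lt x ((x \<ominus> y) \<oplus> (y \<ominus> z))" using lt_add assms unfolding near_def by simp
  moreover have "(x \<ominus> y) \<oplus> (y \<ominus> z) = x \<ominus> z"
    using assms(3-5) by (simp add: a_minus_def a_assoc r_neg1)
  ultimately show ?thesis unfolding near_def by simp
qed

lemma near_mult_right:
  assumes "near x y" "z \<noteq> \<zero>" "x \<in> carrier R" "y \<in> carrier R" "z \<in> carrier R"
  shows "near (x \<otimes> z) (y \<otimes> z)"
proof -
  have "x \<otimes> z \<ominus> y \<otimes> z = (x \<ominus> y) \<otimes> z" using assms by (simp add: a_minus_def l_distr l_minus)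
  then show ?thesis using assms lt_cancel unfolding near_def by simp
qed

lemma near_cancel_right:
  assumes "near (x \<otimes> z) (y \<otimes> z)" "z \<noteq> \<zero>" "x \<in> carrier R" "y \<in> carrier R" "z \<in> carrier R"
  shows "near x y"
proof -
  have "x \<otimes> z \<ominus> y \<otimes> z = (x \<ominus> y) \<otimes> z" using assms by (simp add: a_minus_def l_distr l_minus)
  then show ?thesis using assms lt_cancel unfolding near_def by simp
qed

lemma near_mult:
  assumes "near x y" "near x' y'" "x \<in> carrier R" "y \<in> carrier R" "x' \<in> carrier R" "y' \<in> carrier R"
  shows "near (x \<otimes> x') (y \<otimes> y')"
proof -
  have "near (x \<otimes> x') (y \<otimes> x')" using near_mult_right near_nonzero assms by blast
  moreover have "near (y \<otimes> x') (y \<otimes> y')"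
    using near_mult_right[OF assms(2), of y] near_nonzero[OF assms(1)] assms by (simp add: m_comm)
  ultimately show ?thesis using near_trans assms by (meson m_closed)
qed

lemma near_pow:
  assumes "near x y" "x \<in> carrier R" "y \<in> carrier R" shows "near (x [^] (n::nat)) (y [^] n)"
  by (induct n) (auto intro: near_refl near_mult assms)

lemma near_divide:
  assumes "near (a \<otimes> w) c" "near a b" "a \<in> carrier R" "w \<in> carrier R" "b \<in> carrier R" "c \<in> carrier R"
  shows "near w (c \<otimes> inv b)"
proof -
  have ab: "a \<noteq> \<zero>" "b \<noteq> \<zero>" using near_nonzero assms by blast+
  note i = inv_props[OF assms(5) ab(2)]
  have "a \<otimes> w \<noteq> \<zero>" using near_nonzero(1)[OF assms(1)] assms by simp
  then have w: "w \<noteq> \<zero>" using assms by auto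
  have "near (b \<otimes> w) (a \<otimes> w)" using near_mult_right[OF near_sym[OF assms(2)] w] assms by blast
  then have "near (b \<otimes> w) c" using near_trans[OF _ assms(1)] assms by simp
  moreover have "c \<otimes> inv b \<otimes> b = c" using assms i by (simp add: m_assoc)
  ultimately have "near (w \<otimes> b) (c \<otimes> inv b \<otimes> b)" using m_comm[of w b] assms(4,5) by simp
  then show ?thesis by (rule near_cancel_right[OF _ ab(2)]) (use assms i in auto)
qed

section \<open>Dominant terms of sums, products and elementary symmetric functions\<close>

lemma finsum_le:
  assumes "finite I" "f \<in> I \<rightarrow> carrier R" "\<And>i. i \<in> I \<Longrightarrow> le z (f i)" "z \<in> carrier R"
  shows "le z (\<Oplus>i\<in>I. f i)"
  using assms(1-3)
  by (induct I rule: finite_induct) (auto simp: le_zero assms(4) intro!: le_add)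

text \<open>The condition \<open>z \<noteq> \<zero>\<close> covers the empty sum:
  \<open>\<zero>\<close> is the top element and lies strictly above every other element
  only.\<close>

lemma finsum_lt:
  assumes "finite I" "f \<in> I \<rightarrow> carrier R" "\<And>i. i \<in> I \<Longrightarrow> lt z (f i)" "z \<in> carrier R" "z \<noteq> \<zero>"
  shows "lt z (\<Oplus>i\<in>I. f i)"
  using assms(1-3)
  by (induct I rule: finite_induct) (auto simp: lt_zero assms(4,5) intro!: lt_add)

lemma near_finsum:
  assumes I: "finite I" "f \<in> I \<rightarrow> carrier R" and t: "t \<in> I" "f t \<noteq> \<zero>"
    and lt: "\<And>i. i \<in> I \<Longrightarrow> i \<noteq> t \<Longrightarrow> lt (f t) (f i)"
  shows "near (f t) (\<Oplus>i\<in>I. f i)"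
proof -
  have ft: "f t \<in> carrier R" using I t by auto
  have c: "f \<in> I - {t} \<rightarrow> carrier R" using I by auto
  let ?s = "\<Oplus>i\<in>I - {t}. f i"
  have s: "?s \<in> carrier R" using c by simp
  have "lt (f t) ?s" using I c t lt ft by (intro finsum_lt) auto
  then have l: "lt (f t) (\<ominus> ?s)" using lt_minus s ft by blast
  have "(\<Oplus>i\<in>I. f i) = (\<Oplus>i\<in>insert t (I - {t}). f i)" using t by (simp add: insert_absorb)
  also have "\<dots> = f t \<oplus> ?s" using I c ft by (subst finsum_insert) auto
  finally have "f t \<ominus> (\<Oplus>i\<in>I. f i) = \<ominus> ?s"
    using ft s by (simp add: a_minus_def minus_add a_assoc[symmetric] r_neg)
  then show ?thesis unfolding near_def using l by simp
qed

lemma finprod_le: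
  assumes "finite I" "f \<in> I \<rightarrow> carrier R" "g \<in> I \<rightarrow> carrier R" "\<And>i. i \<in> I \<Longrightarrow> le (f i) (g i)"
  shows "le (\<Otimes>i\<in>I. f i) (\<Otimes>i\<in>I. g i)"
  using assms
  by (induct I rule: finite_induct) (auto intro!: le_mult le_refl)

lemma finprod_nonzero:
  assumes "f \<in> I \<rightarrow> carrier R" "\<And>i. i \<in> I \<Longrightarrow> f i \<noteq> \<zero>"
  shows "(\<Otimes>i\<in>I. f i) \<noteq> \<zero>"
  using assms
  by (induct I rule: infinite_finite_induct) (auto simp: integral_iff Pi_def)

lemma finprod_lt:
  assumes I: "finite I" "f \<in> I \<rightarrow> carrier R" "g \<in> I \<rightarrow> carrier R" "\<And>i. i \<in> I \<Longrightarrow> le (f i) (g i)"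
    and nz: "\<And>i. i \<in> I \<Longrightarrow> f i \<noteq> \<zero>" and t: "t \<in> I" "lt (f t) (g t)"
  shows "lt (\<Otimes>i\<in>I. f i) (\<Otimes>i\<in>I. g i)"
proof -
  have c: "f \<in> I - {t} \<rightarrow> carrier R" "g \<in> I - {t} \<rightarrow> carrier R" "f t \<in> carrier R" "g t \<in> carrier R"
    using I t by auto
  have "lt (f t \<otimes> (\<Otimes>i\<in>I - {t}. f i)) (g t \<otimes> (\<Otimes>i\<in>I - {t}. g i))"
    using c I nz t by (intro lt_mult finprod_le finprod_nonzero) auto
  moreover have "(\<Otimes>i\<in>I. f i) = f t \<otimes> (\<Otimes>i\<in>I - {t}. f i)"
    using finprod_insert[of "I - {t}" t f] c I t by (simp add: insert_absorb)
  moreover have "(\<Otimes>i\<in>I. g i) = g t \<otimes> (\<Otimes>i\<in>I - {t}. g i)"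
    using finprod_insert[of "I - {t}" t g] c I t by (simp add: insert_absorb)
  ultimately show ?thesis by simp
qed

definition esym :: "nat \<Rightarrow> 'a set \<Rightarrow> 'a" where
  "esym k Z = (\<Oplus>S\<in>{S. S \<subseteq> Z \<and> card S = k}. \<Otimes>x\<in>S. x)"

lemma esym_closed: "Z \<subseteq> carrier R \<Longrightarrow> esym k Z \<in> carrier R"
  unfolding esym_def by (intro finsum_closed) (auto intro!: finprod_closed)

text \<open>Exchange argument: a bijection from \<open>A - S\<close> to \<open>S - A\<close>
  replaces each factor by one of strictly larger value. At least one factor is exchanged, and the
  common nonzero part over \<open>A \<inter> S\<close> cancels.\<close>

lemma prod_subset_lt:
  assumes Z: "finite Z" "Z \<subseteq> carrier R - {\<zero>}" and A: "A \<subseteq> Z"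
    and lt: "\<And>a c. a \<in> A \<Longrightarrow> c \<in> Z - A \<Longrightarrow> lt a c"
    and S: "S \<subseteq> Z" "card S = card A" "S \<noteq> A"
  shows "lt (\<Otimes>x\<in>A. x) (\<Otimes>x\<in>S. x)"
proof -
  have fin: "finite A" "finite S" using Z A S finite_subset by blast+
  have "card (A - S) = card (S - A)"
    using fin S(2) card_Diff_subset_Int[of A S] card_Diff_subset_Int[of S A] by (simp add: Int_commute)
  then obtain h where h: "bij_betw h (A - S) (S - A)"
    using fin by (metis finite_Diff finite_same_card_bij)
  have "A - S \<noteq> {}"
  proof
    assume "A - S = {}"
    then have "A \<subseteq> S" by blast
    then show False using card_subset_eq[OF fin(2), of A] S by auto
  qed
  then obtain t where t: "t \<in> A - S" by blast
  have c: "(\<lambda>x. x) \<in> B \<rightarrow> carrier R" if "B \<subseteq> Z" for B using Z that by auto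
  have hi: "h i \<in> S - A" if "i \<in> A - S" for i using h that by (auto simp: bij_betw_def)
  have hc: "h \<in> A - S \<rightarrow> carrier R" using hi S Z by auto
  have hlt: "lt i (h i)" if "i \<in> A - S" for i using lt[of i "h i"] hi[OF that] that S by auto
  have "(\<Otimes>x\<in>S - A. x) = (\<Otimes>x\<in>A - S. h x)"
    using finprod_reindex[of "\<lambda>x. x" h "A - S"] h c[of "S - A"] S(1) unfolding bij_betw_def by auto
  moreover have "lt (\<Otimes>x\<in>A - S. x) (\<Otimes>x\<in>A - S. h x)"
    using fin hc hlt A Z t hi S(1) by (intro finprod_lt[of _ _ _ t] lt_imp_le) (auto 0 3)
  ultimately have l: "lt (\<Otimes>x\<in>A - S. x) (\<Otimes>x\<in>S - A. x)" by simp
  have cl: "(\<Otimes>x\<in>B. x) \<in> carrier R" if "B \<subseteq> Z" for B using c[OF that] by simp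
  have nz: "(\<Otimes>x\<in>A \<inter> S. x) \<noteq> \<zero>" using A Z by (intro finprod_nonzero) auto
  have dec: "(\<Otimes>x\<in>B. x) = (\<Otimes>x\<in>B - C. x) \<otimes> (\<Otimes>x\<in>B \<inter> C. x)" if "B \<subseteq> Z" for B C
  proof -
    have "(\<Otimes>x\<in>(B - C) \<union> (B \<inter> C). x) = (\<Otimes>x\<in>B - C. x) \<otimes> (\<Otimes>x\<in>B \<inter> C. x)"
      using that Z c finite_subset[OF that Z(1)] by (intro finprod_Un_disjoint) auto
    moreover have "(B - C) \<union> (B \<inter> C) = B" by blast
    ultimately show ?thesis by simp
  qed
  show ?thesis
    unfolding dec[OF A, of S] dec[OF S(1), of A]
    using lt_cancel[of "\<Otimes>x\<in>A - S. x" "\<Otimes>x\<in>S - A. x" "\<Otimes>x\<in>A \<inter> S. x"] l nz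
      cl[of "A - S"] cl[of "S - A"] cl[of "A \<inter> S"] A S(1)
    by (auto simp: Int_commute)
qed

text \<open>On an initial segment \<open>A\<close> of \<open>Z\<close> the term \<open>\<Prod>A\<close> is the unique one of smallest value in the
  elementary symmetric function of degree \<open>card A\<close>.\<close>

lemma near_esym:
  assumes Z: "finite Z" "Z \<subseteq> carrier R - {\<zero>}" and A: "A \<subseteq> Z"
    and lt: "\<And>a c. a \<in> A \<Longrightarrow> c \<in> Z - A \<Longrightarrow> lt a c"
  shows "near (\<Otimes>x\<in>A. x) (esym (card A) Z)"
  unfolding esym_def
proof (rule near_finsum[where f = "\<lambda>S. \<Otimes>x\<in>S. x"])
  show "finite {S. S \<subseteq> Z \<and> card S = card A}" using Z(1) by simp
  show "(\<lambda>S. \<Otimes>x\<in>S. x) \<in> {S. S \<subseteq> Z \<and> card S = card A} \<rightarrow> carrier R"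
    using Z by (auto intro!: finprod_closed)
  show "(\<Otimes>x\<in>A. x) \<noteq> \<zero>" using A Z by (intro finprod_nonzero) auto
qed (use A prod_subset_lt[OF assms] in auto)

end

lemma (in ring_hom_cring) hom_finprod_image:
  assumes "A \<subseteq> carrier R" "inj_on h A"
  shows "h (\<Otimes>x\<in>A. x) = (\<Otimes>\<^bsub>S\<^esub>x\<in>h ` A. x)"
proof -
  have "(\<lambda>x. x) \<in> h ` A \<rightarrow> carrier S" using assms(1) by auto
  from S.finprod_reindex[OF this assms(2)] show ?thesis
    using hom_finprod[of "\<lambda>x. x" A] assms(1) by (auto simp: comp_def)
qed

subsection \<open>Henselization\<close>

locale valued_closure = char_p_closure L K p + preval L le
  for L (structure) and K and p and le
begin

lemma aut_prod:
  assumes t: "\<tau> \<in> auts" and A: "A \<subseteq> carrier L"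
  shows "\<tau> (\<Otimes>x\<in>A. x) = (\<Otimes>x\<in>\<tau> ` A. x)"
proof -
  interpret H: ring_hom_cring L L \<tau>
    using aut_hom[OF t] by (intro ring_hom_cring.intro ring_hom_cring_axioms.intro is_cring) (simp add: ring_hom_ring.homh)
  have "inj_on \<tau> A" using t A unfolding auts_def by (auto intro: inj_on_subset)
  then show ?thesis using H.hom_finprod_image[OF A] by blast
qed

text \<open>An automorphism that permutes \<open>Z\<close> also permutes the subsets of
  \<open>Z\<close> of a given size, hence the summands.\<close>

lemma aut_esym:
  assumes t: "\<tau> \<in> auts" and Z: "finite Z" "Z \<subseteq> carrier L" "\<tau> ` Z = Z"
  shows "\<tau> (esym k Z) = esym k Z"
proof -
  interpret H: ring_hom_cring L L \<tau>
    using aut_hom[OF t] by (intro ring_hom_cring.intro ring_hom_cring_axioms.intro is_cring) (simp add: ring_hom_ring.homh)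
  let ?I = "{S. S \<subseteq> Z \<and> card S = k}" and ?f = "\<lambda>S. \<Otimes>x\<in>S. x"
  have inj: "inj_on \<tau> Z" using t Z unfolding auts_def by (auto intro: inj_on_subset)
  have f: "?f \<in> ?I \<rightarrow> carrier L" using Z by (auto intro!: finprod_closed)
  have ii: "inj_on ((`) \<tau>) ?I" using inj by (auto simp: inj_on_def inj_on_image_eq_iff)
  have sub: "(`) \<tau> ` ?I \<subseteq> ?I"
  proof (rule image_subsetI)
    fix S assume "S \<in> ?I"
    then show "\<tau> ` S \<in> ?I" using Z inj card_image[of \<tau> S] by (auto intro: inj_on_subset)
  qed
  have I: "(`) \<tau> ` ?I = ?I" using endo_inj_surj[OF _ sub ii] Z(1) by simp
  have "\<tau> (esym k Z) = (\<Oplus>S\<in>?I. \<tau> (?f S))"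
    unfolding esym_def using H.hom_finsum[OF f] by (simp add: comp_def)
  also have "\<dots> = (\<Oplus>S\<in>?I. ?f (\<tau> ` S))"
    using aut_prod[OF t] Z aut_closed[OF t] by (intro finsum_cong') (auto intro!: finprod_closed)
  also have "\<dots> = (\<Oplus>S\<in>(`) \<tau> ` ?I. ?f S)"
    using add.finprod_reindex[OF _ ii, of ?f] f I by simp
  finally show ?thesis unfolding I esym_def .
qed

lemma sep_one: "sep K \<one>" using sep_base subringE(3)[OF Ksub] by blast

lemma sep_zero: "sep K \<zero>" using sep_base subringE(2)[OF Ksub] by blast

lemma sep_inv: "sep K x \<Longrightarrow> x \<noteq> \<zero> \<Longrightarrow> sep K (inv x)"
  using subfield_m_inv(1)[OF sep_subfield, of x] by blast

lemma sep_pow: "sep K x \<Longrightarrow> sep K (x [^] (n::nat))"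
  by (induct n) (auto intro: sep_one sep_mult)

lemma sep_finprod: "(\<And>x. x \<in> A \<Longrightarrow> sep K (f x)) \<Longrightarrow> sep K (\<Otimes>x\<in>A. f x)"
proof (induct A rule: infinite_finite_induct)
  case (insert a A)
  then have "f \<in> A \<rightarrow> carrier L" "f a \<in> carrier L" using sep_carrier by auto
  then show ?case using insert by (simp add: sep_mult)
qed (auto intro: sep_one)

lemma sep_finsum: "(\<And>x. x \<in> A \<Longrightarrow> sep K (f x)) \<Longrightarrow> sep K (\<Oplus>x\<in>A. f x)"
proof (induct A rule: infinite_finite_induct)
  case (insert a A)
  then have "f \<in> A \<rightarrow> carrier L" "f a \<in> carrier L" using sep_carrier by auto
  then show ?case using insert by (simp add: sep_add)
qed (auto intro: sep_zero)

lemma sep_esym: "(\<And>x. x \<in> Z \<Longrightarrow> sep K x) \<Longrightarrow> sep K (esym k Z)"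
  unfolding esym_def by (intro sep_finsum sep_finprod) blast

definition core :: "'a \<Rightarrow> bool" where
  "core t \<longleftrightarrow> sep K t \<and> eqv t \<one> \<and> (\<forall>\<tau>\<in>auts. \<tau> t = t \<or> lt \<one> (\<tau> t))"

definition hens :: "'a set" where
  "hens = {x. sep K x \<and> (\<exists>t. core t \<and> (\<forall>\<tau>\<in>auts. \<tau> t = t \<longrightarrow> \<tau> x = x))}"

lemma core_nonzero: "core t \<Longrightarrow> t \<noteq> \<zero>"
  unfolding core_def using eqv_zero[of t \<one>] sep_carrier by auto

text \<open>The dichotomy in \<open>core\<close> turns the stabilizer into a condition on one value.
  In particular every automorphism that preserves the valuation fixes \<open>t\<close>.\<close>

lemma core_fixed_iff:
  assumes "core t" "\<tau> \<in> auts" shows "\<tau> t = t \<longleftrightarrow> eqv (\<tau> t) \<one>"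
  using assms unfolding core_def lt_def eqv_def by auto

text \<open>All conjugates of \<open>s\<close> and \<open>t\<close> have nonnegative value, so a
  conjugate of the product has value zero only if both factors are fixed. The stabilizer of the
  product is thus the intersection of the two stabilizers; this directedness makes
  \<open>hens\<close> a ring.\<close>

lemma core_mult:
  assumes s: "core s" and t: "core t"
  shows "core (s \<otimes> t)" "\<tau> \<in> auts \<Longrightarrow> \<tau> (s \<otimes> t) = s \<otimes> t \<Longrightarrow> \<tau> s = s \<and> \<tau> t = t"
proof -
  have c: "s \<in> carrier L" "t \<in> carrier L" using s t sep_carrier unfolding core_def by auto
  have e: "eqv (s \<otimes> t) \<one>" using eqv_mult[of s \<one> t \<one>] s t c unfolding core_def by simp
  have *: "\<tau> s = s \<and> \<tau> t = t \<or> lt \<one> (\<tau> (s \<otimes> t))" if a: "\<tau> \<in> auts" for \<tau>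
  proof -
    have tc: "\<tau> s \<in> carrier L" "\<tau> t \<in> carrier L" using aut_closed[OF a] c by auto
    have "le \<one> (\<tau> y)" if "core y" for y
    proof (cases "\<tau> y = y")
      case True then show ?thesis using that unfolding core_def eqv_def by simp
    next
      case False
      then have "lt \<one> (\<tau> y)" using that a unfolding core_def by blast
      then show ?thesis using lt_imp_le[of \<one> "\<tau> y"] aut_closed[OF a sep_carrier] that unfolding core_def by blast
    qed
    then have le: "le \<one> (\<tau> s)" "le \<one> (\<tau> t)" using s t by blast+
    show ?thesis
    proof (cases "\<tau> s = s \<and> \<tau> t = t")
      case False
      then have "lt \<one> (\<tau> s) \<or> lt \<one> (\<tau> t)" using s t a unfolding core_def by blast
      then have "lt \<one> (\<tau> s \<otimes> \<tau> t)"
        using lt_mult[of \<one> "\<tau> s" \<one> "\<tau> t"] lt_mult[of \<one> "\<tau> t" \<one> "\<tau> s"] le tc m_comm[OF tc] by auto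
      then show ?thesis using aut_mult[OF a] c by simp
    qed blast
  qed
  show "core (s \<otimes> t)"
    unfolding core_def using e * s t sep_mult aut_mult c unfolding core_def by metis
  assume a: "\<tau> \<in> auts" "\<tau> (s \<otimes> t) = s \<otimes> t"
  then have "\<not> lt \<one> (\<tau> (s \<otimes> t))" using e unfolding lt_def eqv_def by simp
  then show "\<tau> s = s \<and> \<tau> t = t" using *[OF a(1)] by blast
qed

lemma core_one: "core \<one>"
  unfolding core_def using sep_one eqv_refl aut_one by simp

lemma hens_sep: "x \<in> hens \<Longrightarrow> sep K x" unfolding hens_def by blast

lemma hens_carrier: "hens \<subseteq> carrier L" using hens_sep sep_carrier by blast

lemma K_hens: "K \<subseteq> hens"
  unfolding hens_def using sep_base core_one aut_fix by blast

lemma hens_subfield: "subfield hens L"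
proof (rule intermediate_subfield[OF _ K_hens])
  have 2: "\<exists>t. core t \<and> (\<forall>\<tau>\<in>auts. \<tau> t = t \<longrightarrow> \<tau> x = x \<and> \<tau> y = y)" if "x \<in> hens" "y \<in> hens" for x y
  proof -
    obtain s t where "core s" "\<forall>\<tau>\<in>auts. \<tau> s = s \<longrightarrow> \<tau> x = x" "core t" "\<forall>\<tau>\<in>auts. \<tau> t = t \<longrightarrow> \<tau> y = y"
      using \<open>x \<in> hens\<close> \<open>y \<in> hens\<close> unfolding hens_def by blast
    then show ?thesis using core_mult[of s t] by (intro exI[of _ "s \<otimes> t"]) blast
  qed
  show "subring hens L"
  proof (rule subringI)
    show "hens \<subseteq> carrier L" by (rule hens_carrier)
    show "\<one> \<in> hens" using K_hens subringE(3)[OF Ksub] by blast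
    fix x assume x: "x \<in> hens"
    then obtain t where t: "core t" "\<forall>\<tau>\<in>auts. \<tau> t = t \<longrightarrow> \<tau> x = x" unfolding hens_def by blast
    have xc: "x \<in> carrier L" using x hens_carrier by blast
    have "sep K (\<ominus> x)"
      using subringE(5)[OF subfieldE(1)[OF sep_subfield]] hens_sep[OF x] by blast
    moreover have "\<tau> (\<ominus> x) = \<ominus> x" if "\<tau> \<in> auts" "\<tau> t = t" for \<tau>
    proof -
      have "\<tau> x = x" using t(2) that by blast
      then show ?thesis using aut_minus[OF that(1) xc] by simp
    qed
    ultimately show "\<ominus> x \<in> hens" unfolding hens_def using t(1) by blast
    fix y assume y: "y \<in> hens"
    have yc: "y \<in> carrier L" using y hens_carrier by blast
    obtain s where s: "core s" "\<forall>\<tau>\<in>auts. \<tau> s = s \<longrightarrow> \<tau> x = x \<and> \<tau> y = y" using 2[OF x y] by blast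
    have "\<tau> (x \<otimes> y) = x \<otimes> y" "\<tau> (x \<oplus> y) = x \<oplus> y" if "\<tau> \<in> auts" "\<tau> s = s" for \<tau>
      using s that aut_mult[OF that(1) xc yc] aut_add[OF that(1) xc yc] by auto
    then show "x \<otimes> y \<in> hens" "x \<oplus> y \<in> hens"
      unfolding hens_def using s(1) sep_mult sep_add hens_sep[OF x] hens_sep[OF y] by blast+
  qed
qed

text \<open>An automorphism over \<open>E\<close> preserves the value of \<open>t\<close>, so it
  fixes \<open>t\<close> and with it \<open>x\<close>. Being separable over \<open>E\<close> and
  fixed by all these automorphisms, \<open>x\<close> lies in \<open>E\<close>.\<close>

lemma hens_minimal:
  assumes E: "subfield E L" "K \<subseteq> E"
    and inv: "\<And>\<tau> x. \<tau> \<in> algebraic_closure.auts L E \<Longrightarrow> x \<in> carrier L \<Longrightarrow> eqv (\<tau> x) x"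
  shows "hens \<subseteq> E"
proof
  interpret E: algebraic_closure L E using intermediate_algebraic_closure[OF E] .
  interpret E: char_p_closure L E p ..
  fix x assume x: "x \<in> hens"
  then obtain t where t: "core t" "\<forall>\<tau>\<in>auts. \<tau> t = t \<longrightarrow> \<tau> x = x" unfolding hens_def by blast
  show "x \<in> E"
  proof (rule E.sep_fixed)
    show "sep E x" using sep_mono[OF E(2)] hens_sep[OF x] by blast
    fix \<tau> assume a: "\<tau> \<in> E.auts"
    then have a': "\<tau> \<in> auts" using E(2) unfolding E.auts_def auts_def by blast
    have tc: "t \<in> carrier L" using t(1) sep_carrier unfolding core_def by blast
    have "eqv (\<tau> t) \<one>"
      using eqv_trans[OF inv[OF a tc]] t(1) tc aut_closed[OF a' tc] unfolding core_def by simp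
    then show "\<tau> x = x" using core_fixed_iff[OF t(1) a'] t(2) a' by blast
  qed
qed

text \<open>The core of \<open>Z\<close> is the product over all initial segments \<open>A\<close> of \<open>Z\<close> of \<open>\<Prod>A\<close> divided by the
  elementary symmetric function of degree \<open>card A\<close>, which is fixed by all automorphisms.\<close>

lemma exists_core:
  assumes Z: "finite Z" "Z \<subseteq> carrier L - {\<zero>}" "\<And>\<tau>. \<tau> \<in> auts \<Longrightarrow> \<tau> ` Z = Z" "\<And>z. z \<in> Z \<Longrightarrow> sep K z"
  shows "\<exists>t. core t \<and> (\<forall>\<tau>\<in>auts. \<tau> t = t \<longleftrightarrow> (\<forall>z\<in>Z. eqv (\<tau> z) z))"
proof -
  \<comment> \<open>Initial segments by value. The strict inequality keeps elements of equal value
    together, either all inside or all outside.\<close>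
  define I where "I = {A. A \<subseteq> Z \<and> (\<forall>a\<in>A. \<forall>c\<in>Z - A. lt a c)}"
  define P where "P A = (\<Otimes>x\<in>A. x)" for A :: "'a set"
  define e where "e A = esym (card A) Z" for A :: "'a set"
  define u where "u A = P A \<otimes> inv (e A)" for A
  have Zc: "Z \<subseteq> carrier L" using Z(2) by blast
  have finI: "finite I" unfolding I_def using Z(1) by simp
  have Pc: "P A \<in> carrier L" if "A \<subseteq> Z" for A unfolding P_def using that Zc by (intro finprod_closed) auto
  have ec: "e A \<in> carrier L" for A unfolding e_def using esym_closed[OF Zc] .
  have near: "near (P A) (e A)" if "A \<in> I" for A
    unfolding P_def e_def using near_esym[OF Z(1,2)] that unfolding I_def by auto
  have e0: "e A \<noteq> \<zero>" if "A \<in> I" for A using near_nonzero(2)[OF near[OF that]] Pc ec that unfolding I_def by blast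
  have ei: "inv (e A) \<in> carrier L" "e A \<otimes> inv (e A) = \<one>" "inv (e A) \<noteq> \<zero>" if "A \<in> I" for A
    using inv_props[OF ec e0[OF that]] by auto
  have uc: "u A \<in> carrier L" if "A \<in> I" for A unfolding u_def using Pc ei that unfolding I_def by simp
  have u1: "eqv (u A) \<one>" if "A \<in> I" for A
  proof -
    have "eqv (P A \<otimes> inv (e A)) (e A \<otimes> inv (e A))"
      using near_eqv[OF near[OF that] Pc ec] that ei[OF that] Pc ec eqv_refl unfolding I_def by (intro eqv_mult) auto
    then show ?thesis unfolding u_def using ei[OF that] by simp
  qed
  have tu: "\<tau> (u A) = P (\<tau> ` A) \<otimes> inv (e A)" if "A \<in> I" "\<tau> \<in> auts" for A \<tau>
  proof -
    have AZ: "A \<subseteq> Z" using that(1) unfolding I_def by blast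
    have "\<tau> (e A) = e A" unfolding e_def using aut_esym[OF that(2) Z(1) Zc Z(3)[OF that(2)]] .
    then have "\<tau> (inv (e A)) = inv (e A)" using aut_inverse[OF that(2) ec e0[OF that(1)]] by simp
    moreover have "\<tau> (P A) = P (\<tau> ` A)" unfolding P_def using aut_prod[OF that(2)] AZ Zc by blast
    ultimately show ?thesis unfolding u_def using aut_mult[OF that(2) Pc[OF AZ] ei(1)[OF that(1)]] by simp
  qed
  \<comment> \<open>The denominator is fixed, while the product over \<open>A\<close> becomes the
    product over another subset of the same size, which has strictly larger value.\<close>
  have tul: "lt \<one> (\<tau> (u A))" if A: "A \<in> I" and t: "\<tau> \<in> auts" and ne: "\<tau> ` A \<noteq> A" for A \<tau>
  proof -
    have AZ: "A \<subseteq> Z" using A unfolding I_def by blast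
    have inj: "inj_on \<tau> A" using t AZ Zc unfolding auts_def by (auto intro: inj_on_subset)
    have S: "\<tau> ` A \<subseteq> Z" using Z(3)[OF t] AZ by blast
    have "lt (P A) (P (\<tau> ` A))"
      unfolding P_def using prod_subset_lt[OF Z(1,2) AZ _ S card_image[OF inj] ne] A unfolding I_def by blast
    then have "lt (u A) (\<tau> (u A))"
      unfolding u_def tu[OF A t, unfolded u_def] using lt_cancel Pc[OF AZ] Pc[OF S] ei[OF A] by blast
    then show ?thesis using le_lt_trans[of \<one> "u A"] u1[OF A] uc[OF A] aut_closed[OF t] unfolding eqv_def by simp
  qed
  have tue: "\<tau> (u A) = u A" if "A \<in> I" "\<tau> \<in> auts" "\<tau> ` A = A" for A \<tau>
    using tu[OF that(1,2)] that(3) unfolding u_def by simp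
  define t where "t = (\<Otimes>A\<in>I. u A)"
  have tt: "\<tau> t = (\<Otimes>A\<in>I. \<tau> (u A))" if a: "\<tau> \<in> auts" for \<tau>
  proof -
    interpret H: ring_hom_cring L L \<tau>
      using aut_hom[OF a] by (intro ring_hom_cring.intro ring_hom_cring_axioms.intro is_cring) (simp add: ring_hom_ring.homh)
    show ?thesis unfolding t_def using H.hom_finprod[of u I] uc by (auto simp: comp_def)
  qed
  have prod1: "(\<Otimes>A\<in>I. \<one>) = \<one>" by simp
  have t1: "eqv t \<one>"
  proof -
    have "le (\<Otimes>A\<in>I. u A) (\<Otimes>A\<in>I. \<one>)" "le (\<Otimes>A\<in>I. \<one>) (\<Otimes>A\<in>I. u A)"
      using finI uc u1 unfolding eqv_def by (intro finprod_le; auto)+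
    then show ?thesis unfolding eqv_def t_def by simp
  qed
  have fixd: "\<tau> t = t" if "\<tau> \<in> auts" "\<forall>A\<in>I. \<tau> ` A = A" for \<tau>
    unfolding tt[OF that(1)] unfolding t_def using tue that uc by (intro finprod_cong') auto
  have mv: "lt \<one> (\<tau> t)" if a: "\<tau> \<in> auts" and B: "B \<in> I" "\<tau> ` B \<noteq> B" for \<tau> B
  proof -
    have "le \<one> (\<tau> (u A))" if A: "A \<in> I" for A
      using tul[OF A a] tue[OF A a] u1[OF A] lt_imp_le[of \<one> "\<tau> (u A)"] aut_closed[OF a uc[OF A]]
      unfolding eqv_def by fastforce
    then have "lt (\<Otimes>A\<in>I. \<one>) (\<Otimes>A\<in>I. \<tau> (u A))"
      using tul[OF B(1) a B(2)] finI aut_closed[OF a uc] B(1) by (intro finprod_lt[of _ _ _ B]) auto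
    then show ?thesis unfolding tt[OF a] prod1 .
  qed
  have core: "core t"
    unfolding core_def
  proof (intro conjI ballI)
    show "sep K t" unfolding t_def u_def
    proof (rule sep_finprod)
      fix A assume A: "A \<in> I"
      have "sep K (P A)" unfolding P_def using A Z(4) unfolding I_def by (intro sep_finprod) auto
      moreover have "sep K (inv (e A))" using sep_inv[OF _ e0[OF A]] sep_esym[of Z] Z(4) unfolding e_def by blast
      ultimately show "sep K (P A \<otimes> inv (e A))" by (rule sep_mult)
    qed
    fix \<tau> assume "\<tau> \<in> auts"
    then show "\<tau> t = t \<or> lt \<one> (\<tau> t)" using fixd mv by blast
  qed (rule t1)
  have stab: "(\<forall>A\<in>I. \<tau> ` A = A) \<longleftrightarrow> (\<forall>z\<in>Z. eqv (\<tau> z) z)" if a: "\<tau> \<in> auts" for \<tau>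
  proof
    assume h: "\<forall>A\<in>I. \<tau> ` A = A"
    show "\<forall>z\<in>Z. eqv (\<tau> z) z"
    proof
      fix z assume z: "z \<in> Z"
      have zc: "z \<in> carrier L" "\<tau> z \<in> Z" using z Zc Z(3)[OF a] by auto
      \<comment> \<open>The closed and the open segment ending at \<open>z\<close>. Stability of the
        closed one bounds the value of \<open>\<tau> z\<close> from above, stability of the open one
        bounds it from below.\<close>
      let ?A = "{y \<in> Z. le y z}" and ?B = "{y \<in> Z. lt y z}"
      have "?A \<in> I" unfolding I_def using Zc zc le_lt_trans[of _ z] by (auto simp: lt_def[of z] subset_iff)
      with h have "\<tau> ` ?A = ?A" by (rule bspec)
      then have 1: "le (\<tau> z) z" using z le_refl[OF zc(1)] by blast
      have "?B \<in> I" unfolding I_def using Zc zc lt_le_trans[of _ z] by (auto simp: lt_def[of _ z] subset_iff)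
      with h have B: "\<tau> ` ?B = ?B" by (rule bspec)
      have "le z (\<tau> z)"
      proof (rule ccontr)
        assume "\<not> le z (\<tau> z)"
        then have "\<tau> z \<in> \<tau> ` ?B" using B zc(2) unfolding lt_def by blast
        then obtain y where "y \<in> ?B" "\<tau> y = \<tau> z" by force
        then have "lt z z" using aut_inj[OF a, of y z] zc(1) Zc by auto
        then show False using lt_irrefl zc(1) by blast
      qed
      then show "eqv (\<tau> z) z" using 1 unfolding eqv_def by blast
    qed
  next
    assume h: "\<forall>z\<in>Z. eqv (\<tau> z) z"
    show "\<forall>A\<in>I. \<tau> ` A = A"
    proof
      fix A assume A: "A \<in> I"
      have AZ: "A \<subseteq> Z" using A unfolding I_def by blast
      have "\<tau> ` A \<subseteq> A"
      proof (rule image_subsetI, rule ccontr)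
        fix x assume x: "x \<in> A" "\<tau> x \<notin> A"
        then have "\<tau> x \<in> Z - A" using Z(3)[OF a] AZ by blast
        then have "lt x (\<tau> x)" using A x unfolding I_def by blast
        then show False using h AZ x unfolding lt_def eqv_def by blast
      qed
      moreover have "inj_on \<tau> A" using a AZ Zc unfolding auts_def by (auto intro: inj_on_subset)
      ultimately show "\<tau> ` A = A" using endo_inj_surj finite_subset[OF AZ Z(1)] by blast
    qed
  qed
  have "\<tau> t = t \<longleftrightarrow> (\<forall>z\<in>Z. eqv (\<tau> z) z)" if a: "\<tau> \<in> auts" for \<tau>
  proof -
    have "\<tau> t = t \<longleftrightarrow> (\<forall>A\<in>I. \<tau> ` A = A)"
      using fixd[OF a] mv[OF a] core_fixed_iff[OF core a] unfolding eqv_def lt_def by auto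
    then show ?thesis using stab[OF a] by blast
  qed
  then show ?thesis using core by blast
qed

lemma orbit_sep: "sep K x \<Longrightarrow> y \<in> orbit x \<Longrightarrow> sep K y"
  unfolding orbit_def using sep_aut by blast

lemma orbit_nonzero: "x \<in> carrier L \<Longrightarrow> x \<noteq> \<zero> \<Longrightarrow> orbit x \<subseteq> carrier L - {\<zero>}"
  unfolding orbit_def using aut_closed aut_eq_zero by auto

text \<open>For separable \<open>x\<close> the element \<open>e\<close> is the product over the
  orbit \<open>R\<close> of \<open>x\<close> under the stabilizer of a core element. In the given
  preorder all of \<open>R\<close> has the value of \<open>x\<close>; in the other one the symmetric
  functions of \<open>R\<close>, which lie in \<open>hens\<close>, exclude any spread of values. So
  the \<open>n\<close>-th power of \<open>x\<close> has the value of \<open>e\<close> in both. It is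
  a Newton polygon argument with one slope.\<close>

lemma hens_unique:
  assumes "preval L le'"
    and agree: "\<And>x y. x \<in> hens \<Longrightarrow> y \<in> hens \<Longrightarrow> le x y \<longleftrightarrow> le' x y"
    and x: "x \<in> carrier L" "x \<noteq> \<zero>"
  shows "\<exists>n>0. \<exists>e\<in>hens. eqv (x [^] (n::nat)) e \<and> le' (x [^] n) e \<and> le' e (x [^] n)"
proof -
  interpret V: preval L le' by fact
  have sepcase: "\<exists>n>0. \<exists>e\<in>hens. eqv (x [^] (n::nat)) e \<and> V.eqv (x [^] n) e"
    if x: "sep K x" "x \<noteq> \<zero>" for x
  proof -
    have xc: "x \<in> carrier L" using sep_carrier[OF x(1)] .
    let ?Z = "orbit x"
    obtain t where t: "core t" "\<And>\<tau>. \<tau> \<in> auts \<Longrightarrow> \<tau> t = t \<longleftrightarrow> (\<forall>z\<in>?Z. eqv (\<tau> z) z)"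
      using exists_core[OF orbit_finite[OF xc] orbit_nonzero[OF xc x(2)] orbit_stable[OF _ xc] orbit_sep[OF x(1)]] by metis
    define D where "D = {\<tau> \<in> auts. \<tau> t = t}"
    define R where "R = (\<lambda>\<tau>. \<tau> x) ` D"
    have RZ: "R \<subseteq> ?Z" unfolding R_def D_def orbit_def by blast
    have R: "finite R" "R \<subseteq> carrier L - {\<zero>}" "R \<subseteq> carrier L" "\<And>r. r \<in> R \<Longrightarrow> sep K r"
      using finite_subset[OF RZ orbit_finite[OF xc]] orbit_nonzero[OF xc x(2)] RZ orbit_sep[OF x(1)] by blast+
    have xR: "x \<in> R" unfolding R_def D_def using aut_id by (auto intro!: image_eqI[of _ _ id])
    \<comment> \<open>An automorphism that fixes the core element of the orbit preserves all values
      on the orbit.\<close>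
    have Rx: "eqv r x" if "r \<in> R" for r
      using that t(2) orbit_self unfolding R_def D_def by auto
    have Rst: "\<tau> ` R = R" if a: "\<tau> \<in> auts" "\<tau> t = t" for \<tau>
    proof -
      have "\<tau> ` R \<subseteq> R"
      proof (rule image_subsetI)
        fix r assume "r \<in> R"
        then obtain s where "s \<in> auts" "s t = t" "r = s x" unfolding R_def D_def by blast
        then show "\<tau> r \<in> R" unfolding R_def D_def using aut_comp[OF a(1)] a(2)
          by (intro image_eqI[of _ _ "\<tau> \<circ> s"]) auto
      qed
      moreover have "inj_on \<tau> R" using a R(3) unfolding auts_def by (auto intro: inj_on_subset)
      ultimately show ?thesis using endo_inj_surj R(1) by blast
    qed
    have eh: "esym k R \<in> hens" for k
      unfolding hens_def using sep_esym[of R] R(4) t(1) aut_esym[OF _ R(1,3) Rst] by blast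
    define n where "n = card R"
    define e where "e = (\<Otimes>r\<in>R. r)"
    have n0: "n > 0" unfolding n_def using xR R(1) by (auto simp: card_gt_0_iff)
    have ehn: "e \<in> hens"
    proof -
      have "sep K e" unfolding e_def by (rule sep_finprod) (use R in auto)
      moreover have "\<tau> e = e" if "\<tau> \<in> auts" "\<tau> t = t" for \<tau>
        unfolding e_def using aut_prod[OF that(1) R(3)] Rst[OF that] by simp
      ultimately show ?thesis unfolding hens_def using t(1) by blast
    qed
    have ec: "e \<in> carrier L" using ehn hens_carrier by blast
    have hpow: "a [^] (m::nat) \<in> hens" if "a \<in> hens" for a m
      using subring_nat_pow[OF subfieldE(1)[OF hens_subfield] that] .
    have prodx: "eqv (\<Otimes>r\<in>S. r) (x [^] card S)" if "S \<subseteq> R" for S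
    proof -
      have "le (\<Otimes>r\<in>S. r) (\<Otimes>r\<in>S. x)" "le (\<Otimes>r\<in>S. x) (\<Otimes>r\<in>S. r)"
        using that R xc Rx finite_subset[OF that R(1)] unfolding eqv_def by (intro finprod_le; auto)+
      then show ?thesis unfolding eqv_def using finprod_const[OF xc, of S] by simp
    qed
    have ex: "eqv e (x [^] n)" unfolding e_def n_def using prodx by blast
    have powprod: "(\<Otimes>r\<in>S. r) [^] m = (\<Otimes>r\<in>S. r [^] (m::nat))" if "S \<subseteq> R" for S m
    proof -
      have c: "(\<lambda>r. r) \<in> S \<rightarrow> carrier L" using that R by auto
      have c': "(\<lambda>r. r [^] m) \<in> S \<rightarrow> carrier L" for m :: nat using that R by auto
      show ?thesis using c c' by (induct m) auto
    qed
    \<comment> \<open>\<open>A\<close> collects the elements whose value in the other preorder is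
      below the average given by \<open>e\<close>. It is an initial segment there, so its product
      and the symmetric function of degree \<open>card A\<close> have equal value.\<close>
    define A where "A = {r \<in> R. V.lt (r [^] n) e}"
    have AR: "A \<subseteq> R" unfolding A_def by blast
    have "A = {}"
    proof (rule ccontr)
      assume ne: "A \<noteq> {}"
      let ?k = "card A" and ?P = "\<Otimes>r\<in>A. r"
      have Pc: "?P \<in> carrier L" using AR R by (intro finprod_closed) auto
      have sc: "esym ?k R \<in> carrier L" using eh hens_carrier by blast
      have "V.lt a c" if "a \<in> A" "c \<in> R - A" for a c
      proof (rule ccontr)
        assume "\<not> V.lt a c"
        then have "le' c a" unfolding V.lt_def by blast
        then have "le' (c [^] n) (a [^] n)" using V.le_pow that AR R by blast
        moreover have "V.lt (a [^] n) e" "le' e (c [^] n)" using that unfolding A_def V.lt_def by auto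
        moreover have "a \<in> carrier L" "c \<in> carrier L" using that AR R by auto
        ultimately show False using V.le_trans[of e "c [^] n" "a [^] n"] ec unfolding V.lt_def by auto
      qed
      from V.near_eqv[OF V.near_esym[OF R(1,2) AR this]] have "V.eqv ?P (V.esym ?k R)"
        using Pc V.esym_closed[OF R(3)] by blast
      moreover have "V.esym ?k R = esym ?k R" unfolding V.esym_def esym_def ..
      ultimately have 1: "le' (esym ?k R) ?P" unfolding V.eqv_def by simp
      obtain a where a: "a \<in> A" using ne by blast
      have "V.lt (\<Otimes>r\<in>A. r [^] n) (\<Otimes>r\<in>A. e)"
        using a AR R ec finite_subset[OF AR R(1)] pow_nonzero[of _ n] V.lt_imp_le[of _ e]
        by (intro V.finprod_lt[of _ _ _ a]) (auto simp: A_def)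
      then have "V.lt (?P [^] n) (e [^] ?k)" unfolding powprod[OF AR] using finprod_const[OF ec, of A] by simp
      moreover have "le' (esym ?k R [^] n) (?P [^] n)" using V.le_pow[OF 1 sc Pc] .
      ultimately have "V.lt (esym ?k R [^] n) (e [^] ?k)" using V.le_lt_trans sc Pc ec by (meson nat_pow_closed)
      \<comment> \<open>Both sides lie in \<open>hens\<close>, so the strict inequality can be read
        in the first preorder. There it contradicts the fact that every summand of the symmetric
        function has the value of a power of \<open>x\<close>.\<close>
      then have l: "lt (esym ?k R [^] n) (e [^] ?k)"
        unfolding lt_def V.lt_def using agree[OF hpow[OF ehn] hpow[OF eh]] by blast
      have pl: "le (x [^] ?k) (\<Otimes>r\<in>S. r)" if "S \<subseteq> R" "card S = ?k" for S
        using prodx[OF that(1)] that(2) unfolding eqv_def by simp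
      have "le (x [^] ?k) (esym ?k R)"
        unfolding esym_def
      proof (rule finsum_le)
        show "(\<lambda>S. \<Otimes>x\<in>S. x) \<in> {S. S \<subseteq> R \<and> card S = ?k} \<rightarrow> carrier L"
          using R by (auto intro!: finprod_closed)
      qed (use R(1) pl xc in auto)
      then have "le ((x [^] ?k) [^] n) (esym ?k R [^] n)" using le_pow xc sc by blast
      moreover have "eqv (e [^] ?k) ((x [^] n) [^] ?k)" using eqv_pow[OF ex] ec xc by blast
      moreover have "(x [^] n) [^] ?k = (x [^] ?k) [^] n" using xc by (simp add: nat_pow_pow mult.commute)
      ultimately have "le (e [^] ?k) (esym ?k R [^] n)"
        unfolding eqv_def using le_trans[of "e [^] ?k" "(x [^] ?k) [^] n"] xc ec sc by simp
      then show False using l unfolding lt_def by blast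
    qed
    then have ge: "le' e (r [^] n)" if "r \<in> R" for r using that unfolding A_def V.lt_def by blast
    \<comment> \<open>No \<open>n\<close>-th power falls below \<open>e\<close>, and the product of
      these \<open>n\<close> powers is the \<open>n\<close>-th power of \<open>e\<close>. A single
      one strictly above \<open>e\<close> would spoil the balance.\<close>
    have "\<not> V.lt e (x [^] n)"
    proof
      assume l: "V.lt e (x [^] n)"
      have e0: "e \<noteq> \<zero>" unfolding e_def using R by (intro finprod_nonzero) auto
      have "V.lt (\<Otimes>r\<in>R. e) (\<Otimes>r\<in>R. r [^] n)"
        using ge R ec xR l e0 by (intro V.finprod_lt[of _ _ _ x]) auto
      then have "V.lt (e [^] n) (e [^] n)"
        using powprod[of R n] finprod_const[OF ec, of R] unfolding e_def[symmetric] n_def by simp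
      then show False using V.lt_irrefl ec by blast
    qed
    then have "V.eqv (x [^] n) e" using ge[OF xR] unfolding V.eqv_def V.lt_def by blast
    then show ?thesis using n0 ehn eqv_sym[OF ex] by blast
  qed
  \<comment> \<open>An arbitrary element is reached through a separable p-power of it, which is
    harmless because the claim concerns only some positive power.\<close>
  obtain m where m: "sep K (x [^] (p ^ m))" using exists_sep_power[OF x(1)] by blast
  obtain n e where n: "n > 0" "e \<in> hens" "eqv ((x [^] (p ^ m)) [^] (n::nat)) e" "V.eqv ((x [^] (p ^ m)) [^] n) e"
    using sepcase[OF m pow_nonzero[OF x]] by blast
  have "(x [^] (p ^ m)) [^] n = x [^] (p ^ m * n)" using x by (simp add: nat_pow_pow)
  moreover have "p ^ m * n > 0" using n(1) p_gt_1 by simp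
  ultimately show ?thesis using n unfolding V.eqv_def by metis
qed

text \<open>Let \<open>A\<close> be the conjugates of smaller value. Since \<open>w\<close> is the
  only conjugate of its value, adding \<open>w\<close> gives the next initial segment, and
  \<open>w\<close> is the quotient of the two products. Each product is near a symmetric function of
  the full orbit, which lies in \<open>K\<close>.\<close>

lemma isolated_near_base:
  assumes w: "sep K w" "w \<noteq> \<zero>" and iso: "\<And>\<tau>. \<tau> \<in> auts \<Longrightarrow> \<tau> w = w \<or> \<not> eqv (\<tau> w) w"
  shows "\<exists>c\<in>K. near w c"
proof -
  have wc: "w \<in> carrier L" using sep_carrier[OF w(1)] .
  let ?W = "orbit w"
  note W = orbit_finite[OF wc] orbit_nonzero[OF wc w(2)]
  have Wc: "?W \<subseteq> carrier L" using W(2) by blast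
  have eK: "esym k ?W \<in> K" for k
    using sep_fixed[OF sep_esym[of ?W k, OF orbit_sep[OF w(1)]]] aut_esym[OF _ W(1) Wc orbit_stable[OF _ wc]] by blast
  let ?A = "{y \<in> ?W. lt y w}" and ?B = "{y \<in> ?W. le y w}"
  have "lt a c" if "a \<in> ?A" "c \<in> ?W - ?A" for a c
    using that lt_le_trans[of a w c] wc Wc by (auto simp: lt_def)
  then have A: "near (\<Otimes>x\<in>?A. x) (esym (card ?A) ?W)" by (intro near_esym[OF W]) auto
  have "lt a c" if "a \<in> ?B" "c \<in> ?W - ?B" for a c
    using that le_lt_trans[of a w c] wc Wc by (auto simp: lt_def)
  then have B: "near (\<Otimes>x\<in>?B. x) (esym (card ?B) ?W)" by (intro near_esym[OF W]) auto
  have "y \<in> ?A" if "y \<in> ?B" "y \<noteq> w" for y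
    using iso that unfolding orbit_def lt_def eqv_def by auto
  moreover have "?A \<subseteq> ?B" using lt_imp_le wc Wc by blast
  ultimately have BA: "?B = insert w ?A" using orbit_self le_refl[OF wc] by blast
  have fA: "finite ?A" using W(1) by simp
  have wA: "w \<notin> ?A" using lt_irrefl wc by blast
  have pA: "(\<Otimes>x\<in>?A. x) \<in> carrier L" using Wc by (intro finprod_closed) auto
  have "(\<Otimes>x\<in>?B. x) = w \<otimes> (\<Otimes>x\<in>?A. x)"
    unfolding BA using finprod_insert[OF fA wA, of "\<lambda>x. x"] wc Wc by auto
  then have "near ((\<Otimes>x\<in>?A. x) \<otimes> w) (esym (card ?B) ?W)" using B m_comm[OF pA wc] by simp
  from near_divide[OF this A pA wc] have "near w (esym (card ?B) ?W \<otimes> inv (esym (card ?A) ?W))"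
    using esym_closed[OF Wc] by blast
  moreover have "esym (card ?A) ?W \<in> K - {\<zero>}"
    using eK near_nonzero(2)[OF A pA] esym_closed[OF Wc] by blast
  then have "esym (card ?B) ?W \<otimes> inv (esym (card ?A) ?W) \<in> K"
    using subfield_m_inv(1)[OF subfield_axioms] subringE(6)[OF Ksub] eK by blast
  ultimately show ?thesis by blast
qed

text \<open>Multiplying \<open>x\<close> by a suitable power of the core element \<open>t\<close> separates its value from the
  values of all its proper conjugates.\<close>

lemma hens_immediate:
  assumes x: "x \<in> hens" "x \<noteq> \<zero>"
  shows "\<exists>c\<in>K. near x c"
proof -
  obtain t where t: "core t" "\<forall>\<tau>\<in>auts. \<tau> t = t \<longrightarrow> \<tau> x = x" using x unfolding hens_def by blast
  have xc: "x \<in> carrier L" using x hens_carrier by blast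
  have tc: "t \<in> carrier L" "t \<noteq> \<zero>" "eqv t \<one>" using t(1) sep_carrier core_nonzero unfolding core_def by auto
  \<comment> \<open>Exponents to be avoided: those for which a conjugate of the modified element has
    the value of \<open>x\<close>. If \<open>a\<close> has positive value, the value of
    \<open>a^n b\<close> grows strictly with \<open>n\<close>, so at most one exponent is bad for
    each pair.\<close>
  define B where "B a b = {n. eqv (a [^] (n::nat) \<otimes> b) x}" for a b
  have finB: "finite (B a b)" if "lt \<one> a" "a \<in> carrier L" "b \<in> carrier L" for a b
  proof -
    have "\<not> n < m" if "n \<in> B a b" "m \<in> B a b" for n m
    proof
      assume nm: "n < m"
      have e: "eqv (a [^] n \<otimes> b) x" "eqv (a [^] m \<otimes> b) x" using that unfolding B_def by auto
      have nz: "a [^] n \<otimes> b \<noteq> \<zero>" using e(1) eqv_zero[of "a [^] n \<otimes> b" x] x(2) xc \<open>a \<in> carrier L\<close> \<open>b \<in> carrier L\<close> by auto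
      have "lt (\<one> [^] (m - n)) (a [^] (m - n))" using lt_pow[OF \<open>lt \<one> a\<close>] nm \<open>a \<in> carrier L\<close> by simp
      then have "lt (\<one> \<otimes> (a [^] n \<otimes> b)) (a [^] (m - n) \<otimes> (a [^] n \<otimes> b))"
        using lt_cancel[of \<one> "a [^] (m - n)" "a [^] n \<otimes> b"] nz \<open>a \<in> carrier L\<close> \<open>b \<in> carrier L\<close> by simp
      moreover have "a [^] (m - n) \<otimes> (a [^] n \<otimes> b) = a [^] m \<otimes> b"
        using nm \<open>a \<in> carrier L\<close> \<open>b \<in> carrier L\<close> by (simp add: m_assoc[symmetric] nat_pow_mult)
      ultimately have "lt (a [^] n \<otimes> b) (a [^] m \<otimes> b)" using \<open>a \<in> carrier L\<close> \<open>b \<in> carrier L\<close> by simp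
      then show False
        using e le_trans[of "a [^] m \<otimes> b" x "a [^] n \<otimes> b"] xc \<open>a \<in> carrier L\<close> \<open>b \<in> carrier L\<close>
        unfolding lt_def eqv_def by simp
    qed
    then have "B a b = {} \<or> (\<exists>n. B a b = {n})" by (metis insertI1 linorder_neqE_nat subsetI subset_singletonD equalityI insertE empty_iff is_singletonI' is_singleton_def)
    then show ?thesis by auto
  qed
  let ?Q = "{(a, b). a \<in> orbit t \<and> lt \<one> a \<and> b \<in> orbit x}"
  have "finite (orbit t \<times> orbit x)" using orbit_finite tc xc by blast
  then have "finite ?Q" by (rule rev_finite_subset) auto
  then have "finite (\<Union>(a, b)\<in>?Q. B a b)"
    using finB orbit_carrier[OF tc(1)] orbit_carrier[OF xc] by (intro finite_UN_I) auto
  then obtain n where n: "n \<notin> (\<Union>(a, b)\<in>?Q. B a b)"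
    using ex_new_if_finite[OF infinite_UNIV_nat] by blast
  let ?w = "t [^] n \<otimes> x"
  have wc: "?w \<in> carrier L" using tc xc by simp
  have wx: "eqv ?w x" using eqv_mult[OF eqv_pow[OF tc(3), of n] eqv_refl[OF xc]] tc xc by simp
  have "\<exists>c\<in>K. near ?w c"
  proof (rule isolated_near_base)
    show "sep K ?w" using sep_mult sep_pow hens_sep[OF x(1)] t(1) unfolding core_def by blast
    show "?w \<noteq> \<zero>" using x(2) xc pow_nonzero[OF tc(1,2)] tc by (simp add: integral_iff)
    fix \<tau> assume a: "\<tau> \<in> auts"
    have tw: "\<tau> ?w = (\<tau> t) [^] n \<otimes> \<tau> x" using aut_mult[OF a] aut_pow[OF a] tc xc by simp
    show "\<tau> ?w = ?w \<or> \<not> eqv (\<tau> ?w) ?w"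
    proof (cases "\<tau> t = t")
      case True
      then have "\<tau> x = x" using t(2) a by blast
      then show ?thesis using tw True by simp
    next
      case False
      then have "lt \<one> (\<tau> t)" using t(1) a unfolding core_def by blast
      then have "(\<tau> t, \<tau> x) \<in> ?Q" using a unfolding orbit_def by blast
      then have "n \<notin> B (\<tau> t) (\<tau> x)" using n by blast
      then have "\<not> eqv (\<tau> ?w) x" unfolding B_def tw by blast
      then show ?thesis using eqv_trans[OF _ wx aut_closed[OF a wc] wc xc] by blast
    qed
  qed
  then obtain c where c: "c \<in> K" "near ?w c" by blast
  \<comment> \<open>\<open>t\<close> is isolated as well, since its proper conjugates have positive
    value; hence the auxiliary power of \<open>t\<close> can be divided out up to nearness.\<close>
  have "\<exists>s\<in>K. near t s"
  proof (rule isolated_near_base)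
    show "sep K t" using t(1) unfolding core_def by blast
    fix \<tau> assume a: "\<tau> \<in> auts"
    show "\<tau> t = t \<or> \<not> eqv (\<tau> t) t"
      using core_fixed_iff[OF t(1) a] eqv_trans[of "\<tau> t" t \<one>] tc aut_closed[OF a tc(1)] by auto
  qed (rule tc(2))
  then obtain s where s: "s \<in> K" "near t s" by blast
  have sc: "s \<in> carrier L" "c \<in> carrier L" using s c KL by auto
  have "near (t [^] n) (s [^] n)" using near_pow[OF s(2) tc(1) sc(1)] .
  from near_divide[OF c(2) this] have "near x (c \<otimes> inv (s [^] n))" using tc xc sc by simp
  moreover have "s [^] n \<in> K - {\<zero>}"
    using subring_nat_pow[OF Ksub s(1)] pow_nonzero[OF sc(1)] near_nonzero(2)[OF s(2) tc(1) sc(1)] by blast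
  then have "c \<otimes> inv (s [^] n) \<in> K"
    using subfield_m_inv(1)[OF subfield_axioms] subringE(6)[OF Ksub c(1)] by blast
  ultimately show ?thesis by blast
qed

end

subsection \<open>Residual and valuational independence\<close>

context preval
begin

lemma lt_add_eqv: "lt a b \<Longrightarrow> a \<in> carrier R \<Longrightarrow> b \<in> carrier R \<Longrightarrow> eqv (a \<oplus> b) a"
proof -
  assume l: "lt a b" and c: "a \<in> carrier R" "b \<in> carrier R"
  have "a \<ominus> (a \<oplus> b) = \<ominus> b" using c by (simp add: a_minus_def minus_add a_assoc[symmetric] r_neg)
  then have "near a (a \<oplus> b)" unfolding near_def using lt_minus l c by simp
  then show ?thesis using near_eqv eqv_sym c by blast
qed

lemma eqv_le_trans: "eqv x y \<Longrightarrow> le y z \<Longrightarrow> x \<in> carrier R \<Longrightarrow> y \<in> carrier R \<Longrightarrow> z \<in> carrier R \<Longrightarrow> le x z"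
  unfolding eqv_def using le_trans by blast

lemma le_eqv_trans: "le x y \<Longrightarrow> eqv y z \<Longrightarrow> x \<in> carrier R \<Longrightarrow> y \<in> carrier R \<Longrightarrow> z \<in> carrier R \<Longrightarrow> le x z"
  unfolding eqv_def using le_trans by blast

lemma exists_min:
  assumes "finite S" "S \<noteq> {}" "S \<subseteq> carrier R"
  shows "\<exists>m\<in>S. \<forall>x\<in>S. le m x"
  using assms
proof (induct S rule: finite_ne_induct)
  case (singleton x)
  then show ?case using le_refl by simp
next
  case (insert x S)
  then obtain m where m: "m \<in> S" "\<forall>y\<in>S. le m y" by auto
  show ?case
  proof (cases "le m x")
    case True then show ?thesis using m by auto
  next
    case False
    then have "le x m" using le_total insert m by blast
    then have "\<forall>y\<in>S. le x y" using m le_trans insert by (meson insert_subset subsetD)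
    then show ?thesis using le_refl insert by auto
  qed
qed

lemma combine_concat:
  assumes "length kss = length zs" "\<And>ks. ks \<in> set kss \<Longrightarrow> length ks = length Us \<and> set ks \<subseteq> carrier R"
    and "set Us \<subseteq> carrier R" "set zs \<subseteq> carrier R"
  shows "combine (concat kss) (concat (map (\<lambda>z. map (\<lambda>u. u \<otimes> z) Us) zs))
    = combine (map (\<lambda>ks. combine ks Us) kss) zs"
  using assms(1,2,4)
proof (induct kss zs rule: list_induct2)
  case Nil
  then show ?case by simp
next
  case (Cons ks kss z zs)
  have c: "set (concat kss) \<subseteq> carrier R" "set (concat (map (\<lambda>z. map (\<lambda>u. u \<otimes> z) Us) zs)) \<subseteq> carrier R"
    using Cons assms(3) by auto
  have "set (map (\<lambda>u. u \<otimes> z) Us) \<subseteq> carrier R" using Cons assms(3) by auto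
  from combine_append[OF _ _ this c] Cons assms(3)
  show ?case using combine_l_distr[of ks Us z] by simp
qed

lemma chunks:
  assumes "length ks = n * f" shows "\<exists>kss. concat kss = ks \<and> length kss = n \<and> (\<forall>c\<in>set kss. length c = f)"
  using assms
proof (induct n arbitrary: ks)
  case (Suc n)
  have "\<exists>kss. concat kss = drop f ks \<and> length kss = n \<and> (\<forall>c\<in>set kss. length c = f)"
    by (rule Suc(1)) (use Suc(2) in simp)
  then obtain kss where "concat kss = drop f ks" "length kss = n" "\<forall>c\<in>set kss. length c = f" by blast
  then show ?case using Suc(2) by (intro exI[of _ "take f ks # kss"]) auto
qed auto

text \<open>\<open>Us\<close> has residues that are linearly independent over the residue field of \<open>M\<close>.\<close>

definition res_indep :: "'a set \<Rightarrow> 'a list \<Rightarrow> bool" where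
  "res_indep M Us \<longleftrightarrow> set Us \<subseteq> carrier R \<and> (\<forall>u\<in>set Us. le \<one> u) \<and>
    (\<forall>ks. set ks \<subseteq> M \<longrightarrow> length ks = length Us \<longrightarrow> (\<forall>k\<in>set ks. le \<one> k) \<longrightarrow> lt \<one> (combine ks Us)
      \<longrightarrow> (\<forall>k\<in>set ks. lt \<one> k))"

lemma res_indepD:
  assumes "res_indep M Us" "set ks \<subseteq> M" "length ks = length Us" "\<And>k. k \<in> set ks \<Longrightarrow> le \<one> k" "lt \<one> (combine ks Us)" "k \<in> set ks"
  shows "lt \<one> k"
  using assms unfolding res_indep_def by blast

definition res_basis :: "'a set \<Rightarrow> 'a set \<Rightarrow> 'a list \<Rightarrow> bool" where
  "res_basis N M Us \<longleftrightarrow> res_indep M Us \<and> set Us \<subseteq> N \<and>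
    (\<forall>x\<in>N. le \<one> x \<longrightarrow> (\<exists>ks. set ks \<subseteq> M \<and> length ks = length Us \<and> (\<forall>k\<in>set ks. le \<one> k) \<and> lt \<one> (x \<ominus> combine ks Us)))"

text \<open>The elements of \<open>Z\<close> have values in distinct cosets of the value group of \<open>M\<close>.\<close>

definition val_indep :: "'a set \<Rightarrow> 'a set \<Rightarrow> bool" where
  "val_indep M Z \<longleftrightarrow> Z \<subseteq> carrier R - {\<zero>} \<and> (\<forall>z\<in>Z. \<forall>z'\<in>Z. \<forall>k\<in>M - {\<zero>}. eqv (k \<otimes> z) z' \<longrightarrow> z = z')"

definition transversal :: "'a set \<Rightarrow> 'a set \<Rightarrow> 'a set \<Rightarrow> bool" where
  "transversal N M Z \<longleftrightarrow> val_indep M Z \<and> Z \<subseteq> N \<and> (\<forall>x\<in>N - {\<zero>}. \<exists>z\<in>Z. \<exists>k\<in>M - {\<zero>}. eqv x (k \<otimes> z))"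

lemma combine_le:
  assumes "set ks \<subseteq> carrier R" "set Us \<subseteq> carrier R" "\<And>k. k \<in> set ks \<Longrightarrow> le m k" "\<And>u. u \<in> set Us \<Longrightarrow> le \<one> u" "m \<in> carrier R"
  shows "le m (combine ks Us)"
  using assms(1-4)
proof (induct ks Us rule: combine.induct)
  case (1 k ks u us)
  have "le (m \<otimes> \<one>) (k \<otimes> u)" using 1(2-5) assms(5) by (intro le_mult) auto
  moreover have "le m (combine ks us)" using 1 by auto
  ultimately show ?case using 1(2-5) assms(5) by (simp add: le_add)
qed (use assms(5) le_zero in auto)

lemma combine_diff_lt:
  assumes "length ks = length Us" "length ks' = length Us" "set ks \<subseteq> carrier R" "set ks' \<subseteq> carrier R" "set Us \<subseteq> carrier R"
    "\<And>i. i < length Us \<Longrightarrow> lt \<one> (ks ! i \<ominus> ks' ! i)" "\<And>u. u \<in> set Us \<Longrightarrow> le \<one> u"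
  shows "lt \<one> (combine ks Us \<ominus> combine ks' Us)"
  using assms
proof (induct Us arbitrary: ks ks')
  case Nil
  then show ?case by (simp add: lt_zero a_minus_def)
next
  case (Cons u Us)
  obtain k l where k: "ks = k # l" using Cons(2) by (cases ks) auto
  obtain k' l' where k': "ks' = k' # l'" using Cons(3) by (cases ks') auto
  have c: "k \<in> carrier R" "k' \<in> carrier R" "u \<in> carrier R" "combine l Us \<in> carrier R" "combine l' Us \<in> carrier R"
    using Cons(2-6) k k' by auto
  have i: "lt \<one> (l ! i \<ominus> l' ! i)" if "i < length Us" for i using Cons(7)[of "Suc i"] that k k' by simp
  have "lt \<one> (combine l Us \<ominus> combine l' Us)"
    using Cons(2-6,8) k k' i by (intro Cons(1)) auto
  moreover have "lt (\<one> \<otimes> \<one>) ((k \<ominus> k') \<otimes> u)"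
    using Cons(7)[of 0] Cons(8) k k' c by (intro lt_mult) auto
  ultimately have "lt \<one> (((k \<ominus> k') \<otimes> u) \<oplus> (combine l Us \<ominus> combine l' Us))" using c by (intro lt_add) auto
  moreover have "((k \<ominus> k') \<otimes> u) \<oplus> (combine l Us \<ominus> combine l' Us) = (k \<otimes> u \<oplus> combine l Us) \<ominus> (k' \<otimes> u \<oplus> combine l' Us)"
    using c by (simp add: a_minus_def l_distr l_minus minus_add a_ac)
  ultimately show ?case using k k' by simp
qed

text \<open>After division by a coefficient of least value all coefficients are integral and one of
  them is \<open>\<one>\<close>. By residual independence the combination cannot then have positive
  value, so it has value zero.\<close>

lemma res_indep_combine:
  assumes M: "subfield M R" and U: "res_indep M Us" and ks: "set ks \<subseteq> M" "length ks = length Us"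
    and nz: "\<exists>k\<in>set ks. k \<noteq> \<zero>"
  shows "\<exists>k0\<in>set ks. k0 \<noteq> \<zero> \<and> eqv (combine ks Us) k0 \<and> (\<forall>k\<in>set ks. le k0 k)"
proof -
  have MR: "M \<subseteq> carrier R" using subfieldE(3)[OF M] .
  have Uc: "set Us \<subseteq> carrier R" "\<And>u. u \<in> set Us \<Longrightarrow> le \<one> u" using U unfolding res_indep_def by auto
  have kc: "set ks \<subseteq> carrier R" using ks MR by blast
  obtain k0 where k0: "k0 \<in> set ks" "\<forall>k\<in>set ks. le k0 k"
    using exists_min[of "set ks"] nz kc by (metis List.finite_set empty_iff)
  have k0c: "k0 \<in> carrier R" using k0 kc by blast
  have k0n: "k0 \<noteq> \<zero>" using nz k0(2) zero_le kc by auto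
  note i = inv_props[OF k0c k0n]
  have iM: "inv k0 \<in> M" using subfield_m_inv(1)[OF M, of k0] k0 k0n ks by blast
  let ?ks = "map ((\<otimes>) (inv k0)) ks" and ?y = "combine ks Us"
  have y: "?y \<in> carrier R" using kc Uc by simp
  have e: "inv k0 \<otimes> ?y = combine ?ks Us" using combine_r_distr[OF kc Uc(1) i(1)] .
  have le1: "le \<one> (inv k0 \<otimes> k)" if "k \<in> set ks" for k
    using le_mult_right[of k0 k "inv k0"] k0 that kc i k0c m_comm[of k "inv k0"] by auto
  have "le \<one> (combine ?ks Us)" using combine_le[of ?ks Us \<one>] kc i le1 Uc by auto
  moreover have "\<not> lt \<one> (combine ?ks Us)"
  proof
    assume "lt \<one> (combine ?ks Us)"
    moreover have "set ?ks \<subseteq> M" using ks(1) iM subringE(6)[OF subfieldE(1)[OF M]] by auto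
    ultimately have "lt \<one> (inv k0 \<otimes> k0)"
      using res_indepD[OF U, of ?ks] ks(2) le1 k0(1) by auto
    then show False using i lt_irrefl by simp
  qed
  ultimately have "eqv (inv k0 \<otimes> ?y) \<one>" unfolding e eqv_def lt_def by blast
  then have "eqv (k0 \<otimes> (inv k0 \<otimes> ?y)) (k0 \<otimes> \<one>)" using eqv_refl[OF k0c] k0c i y by (intro eqv_mult) auto
  then have "eqv ?y k0" using k0c i y by (simp add: m_assoc[symmetric])
  then show ?thesis using k0 k0n by blast
qed

text \<open>Summands with values in distinct cosets do not interfere.\<close>

lemma val_indep_combine:
  assumes M: "subfield M R" and "length ys = length zs" "distinct zs" "val_indep M (set zs)" "set ys \<subseteq> carrier R"
    and "\<And>y. y \<in> set ys \<Longrightarrow> y = \<zero> \<or> (\<exists>k\<in>M - {\<zero>}. eqv y k)"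
  shows "(set ys \<subseteq> {\<zero>} \<and> combine ys zs = \<zero>) \<or>
    (\<exists>i<length zs. ys ! i \<noteq> \<zero> \<and> eqv (combine ys zs) (ys ! i \<otimes> zs ! i) \<and> (\<forall>j<length zs. le (combine ys zs) (ys ! j \<otimes> zs ! j)))"
  using assms(2-6)
proof (induct ys zs rule: list_induct2)
  case Nil
  then show ?case by simp
next
  case (Cons y ys z zs)
  have MR: "M \<subseteq> carrier R" using subfieldE(3)[OF M] .
  have vi: "val_indep M (set zs)" using Cons(4) unfolding val_indep_def by auto
  have c: "y \<in> carrier R" "z \<in> carrier R" "z \<noteq> \<zero>" "set zs \<subseteq> carrier R" "set ys \<subseteq> carrier R"
    using Cons(4,5) unfolding val_indep_def by auto
  let ?x = "combine ys zs"
  have xc: "?x \<in> carrier R" using c by simp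
  have IH: "(set ys \<subseteq> {\<zero>} \<and> ?x = \<zero>) \<or>
    (\<exists>i<length zs. ys ! i \<noteq> \<zero> \<and> eqv ?x (ys ! i \<otimes> zs ! i) \<and> (\<forall>j<length zs. le ?x (ys ! j \<otimes> zs ! j)))"
    using Cons(2) Cons(3,6) vi c by auto
  have jc: "ys ! j \<otimes> zs ! j \<in> carrier R" if "j < length zs" for j
    using c that Cons(1) by (metis m_closed nth_mem subsetD)
  show ?case
  proof (cases "y = \<zero>")
    case True
    then have e: "combine (y # ys) (z # zs) = ?x" using c xc by simp
    from IH show ?thesis
    proof
      assume "set ys \<subseteq> {\<zero>} \<and> ?x = \<zero>" then show ?thesis using True e by auto
    next
      assume "\<exists>i<length zs. ys ! i \<noteq> \<zero> \<and> eqv ?x (ys ! i \<otimes> zs ! i) \<and> (\<forall>j<length zs. le ?x (ys ! j \<otimes> zs ! j))"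
      then obtain i where i: "i < length zs" "ys ! i \<noteq> \<zero>" "eqv ?x (ys ! i \<otimes> zs ! i)" "\<forall>j<length zs. le ?x (ys ! j \<otimes> zs ! j)" by blast
      have "le ?x (((y # ys) ! j) \<otimes> ((z # zs) ! j))" if "j < Suc (length zs)" for j
        using that i(4) True c le_zero[OF xc] by (cases j) auto
      then show ?thesis unfolding e using i by (intro disjI2 exI[of _ "Suc i"]) auto
    qed
  next
    case False
    have yz: "y \<otimes> z \<in> carrier R" "y \<otimes> z \<noteq> \<zero>" using c False by (auto simp: integral_iff)
    have xs: "combine (y # ys) (z # zs) = y \<otimes> z \<oplus> ?x" by simp
    have sc: "y \<otimes> z \<oplus> ?x \<in> carrier R" using yz xc by simp
    from IH show ?thesis
    proof
      assume z: "set ys \<subseteq> {\<zero>} \<and> ?x = \<zero>"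
      have "le (y \<otimes> z) (((y # ys) ! j) \<otimes> ((z # zs) ! j))" if "j < Suc (length zs)" for j
      proof (cases j)
        case (Suc i)
        then have "ys ! i \<in> set ys" using that Cons(1) by simp
        then have "ys ! i = \<zero>" using z by blast
        moreover have "zs ! i \<in> carrier R" using Suc that c(4) by (auto simp: subset_iff)
        ultimately show ?thesis using Suc le_zero[OF yz(1)] by simp
      qed (use le_refl yz in auto)
      then show ?thesis unfolding xs using z yz False eqv_refl[OF yz(1)] by (intro disjI2 exI[of _ 0]) auto
    next
      assume "\<exists>i<length zs. ys ! i \<noteq> \<zero> \<and> eqv ?x (ys ! i \<otimes> zs ! i) \<and> (\<forall>j<length zs. le ?x (ys ! j \<otimes> zs ! j))"
      then obtain i where i: "i < length zs" "ys ! i \<noteq> \<zero>" "eqv ?x (ys ! i \<otimes> zs ! i)" "\<forall>j<length zs. le ?x (ys ! j \<otimes> zs ! j)" by blast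
      have yi: "ys ! i \<in> set ys" "zs ! i \<in> set zs" using i(1) Cons(1) by auto
      obtain k where k: "k \<in> M - {\<zero>}" "eqv y k" using Cons(6)[of y] False by auto
      obtain l where l: "l \<in> M - {\<zero>}" "eqv (ys ! i) l" using Cons(6)[of "ys ! i"] i(2) yi by auto
      have lc: "l \<in> carrier R" "l \<noteq> \<zero>" "k \<in> carrier R" "k \<noteq> \<zero>" "ys ! i \<in> carrier R" "zs ! i \<in> carrier R" using k l MR yi c by auto
      \<comment> \<open>\<open>y\<close> and \<open>ys ! i\<close> have values of elements of
        \<open>M\<close>, so equality would put \<open>z\<close> and \<open>zs ! i\<close> into one
        coset, against distinctness of the list.\<close>
      have "\<not> eqv (y \<otimes> z) ?x"
      proof
        assume "eqv (y \<otimes> z) ?x"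
        then have "eqv (y \<otimes> z) (ys ! i \<otimes> zs ! i)" using eqv_trans[OF _ i(3)] yz xc lc by simp
        moreover have "eqv (k \<otimes> z) (y \<otimes> z)" using eqv_mult[OF eqv_sym[OF k(2)] eqv_refl[OF c(2)]] lc c by blast
        moreover have "eqv (ys ! i \<otimes> zs ! i) (l \<otimes> zs ! i)" using eqv_mult[OF l(2) eqv_refl[OF lc(6)]] lc by blast
        ultimately have "eqv (k \<otimes> z) (l \<otimes> zs ! i)" using eqv_trans lc c yz by (meson m_closed)
        from eqv_mult[OF eqv_refl[OF inv_props(1)[OF lc(1,2)]] this]
        have "eqv (inv l \<otimes> (k \<otimes> z)) (inv l \<otimes> (l \<otimes> zs ! i))"
          using inv_props(1)[OF lc(1,2)] lc c by auto
        then have "eqv ((inv l \<otimes> k) \<otimes> z) (zs ! i)" using inv_props[OF lc(1,2)] lc c by (simp add: m_assoc[symmetric])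
        moreover have "inv l \<otimes> k \<in> M - {\<zero>}"
          using subfield_m_inv(1)[OF M l(1)] k(1) subringE(6)[OF subfieldE(1)[OF M]] lc inv_props[OF lc(1,2)] by (auto simp: integral_iff)
        ultimately have "z = zs ! i" using Cons(4) yi(2) unfolding val_indep_def by auto
        then show False using Cons(3) yi(2) by auto
      qed
      then consider "lt (y \<otimes> z) ?x" | "lt ?x (y \<otimes> z)" unfolding lt_def eqv_def by blast
      then show ?thesis
      proof cases
        case 1
        then have e: "eqv (y \<otimes> z \<oplus> ?x) (y \<otimes> z)" using lt_add_eqv yz xc by blast
        have le: "le (y \<otimes> z \<oplus> ?x) ?x" using eqv_le_trans[OF e lt_imp_le[OF 1]] yz xc by simp
        have "le (y \<otimes> z \<oplus> ?x) (((y # ys) ! j) \<otimes> ((z # zs) ! j))" if "j < Suc (length zs)" for j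
        proof (cases j)
          case 0 then show ?thesis using e unfolding eqv_def by simp
        next
          case (Suc m) then show ?thesis using le_trans[OF le, of "ys ! m \<otimes> zs ! m"] i(4) that sc xc jc by auto
        qed
        then show ?thesis unfolding xs using e False by (intro disjI2 exI[of _ 0]) auto
      next
        case 2
        then have e: "eqv (y \<otimes> z \<oplus> ?x) ?x" using lt_add_eqv[of ?x "y \<otimes> z"] yz xc by (simp add: a_comm)
        have le: "le (y \<otimes> z \<oplus> ?x) ?x" using e unfolding eqv_def by blast
        have le2: "le (y \<otimes> z \<oplus> ?x) (y \<otimes> z)" using eqv_le_trans[OF e lt_imp_le[OF 2]] yz xc by simp
        have "le (y \<otimes> z \<oplus> ?x) (((y # ys) ! j) \<otimes> ((z # zs) ! j))" if "j < Suc (length zs)" for j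
        proof (cases j)
          case 0 then show ?thesis using le2 by simp
        next
          case (Suc m) then show ?thesis using le_trans[OF le, of "ys ! m \<otimes> zs ! m"] i(4) that sc xc jc by auto
        qed
        moreover have "eqv (y \<otimes> z \<oplus> ?x) (ys ! i \<otimes> zs ! i)" using eqv_trans[OF e i(3)] sc xc jc[OF i(1)] by blast
        ultimately show ?thesis unfolding xs using i by (intro disjI2 exI[of _ "Suc i"]) auto
      qed
    qed
  qed
qed

abbreviation prods :: "'a list \<Rightarrow> 'a list \<Rightarrow> 'a list" where
  "prods Us zs \<equiv> concat (map (\<lambda>z. map (\<lambda>u. u \<otimes> z) Us) zs)"

lemma length_prods: "length (prods Us zs) = length zs * length Us"
  by (induct zs) auto

text \<open>The coefficients are cut into one block per element of \<open>zs\<close>; each block has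
  the value of its least coefficient, and the blocks do not interfere. The last clause keeps that
  least coefficient as \<open>k0\<close>: it is what later turns integrality of the sum into
  integrality of each coefficient.\<close>

lemma prods_combine:
  assumes M: "subfield M R" and U: "res_indep M Us" and z: "distinct zs" "val_indep M (set zs)"
    and ks: "set ks \<subseteq> M" "length ks = length zs * length Us"
  shows "\<exists>kss. concat kss = ks \<and> length kss = length zs \<and>
     combine ks (prods Us zs) = combine (map (\<lambda>ks. combine ks Us) kss) zs \<and>
     (\<forall>i<length zs. length (kss ! i) = length Us \<and> set (kss ! i) \<subseteq> M) \<and>
     (\<forall>i<length zs. \<forall>k\<in>set (kss ! i). k \<noteq> \<zero> \<longrightarrow> combine ks (prods Us zs) \<noteq> \<zero>) \<and>
     (\<forall>i<length zs. \<forall>k\<in>set (kss ! i). \<exists>k0\<in>M. le k0 k \<and> le (combine ks (prods Us zs)) (k0 \<otimes> zs ! i))"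
proof -
  have MR: "M \<subseteq> carrier R" using subfieldE(3)[OF M] .
  have Uc: "set Us \<subseteq> carrier R" using U unfolding res_indep_def by auto
  have zc: "set zs \<subseteq> carrier R" "\<zero> \<notin> set zs" using z unfolding val_indep_def by auto
  obtain kss where kss: "concat kss = ks" "length kss = length zs" "\<forall>c\<in>set kss. length c = length Us"
    using chunks[OF ks(2)] by blast
  have km: "set c \<subseteq> M" if "c \<in> set kss" for c
  proof -
    have "set c \<subseteq> set ks" unfolding kss(1)[symmetric] using that by auto
    then show ?thesis using ks(1) by blast
  qed
  let ?ys = "map (\<lambda>ks. combine ks Us) kss" and ?x = "combine ks (prods Us zs)"
  have x: "?x = combine ?ys zs"
    using combine_concat[of kss zs Us] kss km MR Uc zc by blast
  have ysc: "set ?ys \<subseteq> carrier R" using km MR Uc by (auto intro!: combine_in_carrier)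
  have xc: "?x \<in> carrier R" unfolding x using ysc zc by simp
  have yk: "combine c Us = \<zero> \<and> set c \<subseteq> {\<zero>} \<or> (\<exists>k0\<in>set c. k0 \<noteq> \<zero> \<and> eqv (combine c Us) k0 \<and> (\<forall>k\<in>set c. le k0 k))" if "c \<in> set kss" for c
  proof (cases "\<exists>k\<in>set c. k \<noteq> \<zero>")
    case True
    then show ?thesis using res_indep_combine[OF M U km[OF that]] kss(3) that by blast
  next
    case False
    then have s: "set c \<subseteq> {\<zero>}" by blast
    then have "c = replicate (length Us) \<zero>" using kss(3) that by (metis replicate_length_same subset_iff singletonD)
    then show ?thesis using combine_replicate[OF Uc] s by simp
  qed
  have "y = \<zero> \<or> (\<exists>k\<in>M - {\<zero>}. eqv y k)" if "y \<in> set ?ys" for y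
    using that yk km by fastforce
  from val_indep_combine[OF M _ z ysc this]
  have alt: "(set ?ys \<subseteq> {\<zero>} \<and> ?x = \<zero>) \<or>
    (\<exists>i<length zs. ?ys ! i \<noteq> \<zero> \<and> eqv ?x (?ys ! i \<otimes> zs ! i) \<and> (\<forall>j<length zs. le ?x (?ys ! j \<otimes> zs ! j)))"
    unfolding x using kss(2) by simp
  have zi: "zs ! i \<in> carrier R" "zs ! i \<noteq> \<zero>" if "i < length zs" for i
    using zc nth_mem[OF that] by (metis subsetD)+
  have ci: "kss ! i \<in> set kss" if "i < length zs" for i using that kss(2) by simp
  have yi: "combine (kss ! i) Us \<in> carrier R" if "i < length zs" for i
    using km[OF ci[OF that]] MR Uc by (intro combine_in_carrier) auto
  have le: "le ?x (combine (kss ! j) Us \<otimes> zs ! j)" if "j < length zs" for j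
    using alt
  proof
    assume a: "set ?ys \<subseteq> {\<zero>} \<and> ?x = \<zero>"
    then have "combine (kss ! j) Us = \<zero>" using ci[OF that] by auto
    then show ?thesis using le_zero[OF xc] zi[OF that] by simp
  next
    assume "\<exists>i<length zs. ?ys ! i \<noteq> \<zero> \<and> eqv ?x (?ys ! i \<otimes> zs ! i) \<and> (\<forall>j<length zs. le ?x (?ys ! j \<otimes> zs ! j))"
    then show ?thesis using that kss(2) by auto
  qed
  have nz: "?x \<noteq> \<zero>" if "i < length zs" "k \<in> set (kss ! i)" "k \<noteq> \<zero>" for i k
  proof
    assume x0: "?x = \<zero>"
    have "combine (kss ! i) Us \<noteq> \<zero>"
      using yk[OF ci[OF that(1)]] that eqv_zero yi[OF that(1)] km[OF ci[OF that(1)]] MR by blast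
    then have "combine (kss ! i) Us \<otimes> zs ! i \<noteq> \<zero>" using yi zi that by (simp add: integral_iff)
    then show False using le[OF that(1)] zero_le x0 yi zi that by (metis m_closed)
  qed
  have bd: "\<exists>k0\<in>M. le k0 k \<and> le ?x (k0 \<otimes> zs ! i)" if i: "i < length zs" and k: "k \<in> set (kss ! i)" for i k
  proof -
    have kM: "k \<in> M" using km[OF ci[OF i]] k by blast
    then have kc: "k \<in> carrier R" using MR by blast
    from yk[OF ci[OF i]] show ?thesis
    proof
      assume "combine (kss ! i) Us = \<zero> \<and> set (kss ! i) \<subseteq> {\<zero>}"
      then have "k = \<zero>" using k by blast
      then show ?thesis using kM le_refl[OF kc] le_zero[OF xc] zi[OF i] by (intro bexI[of _ k]) auto
    next
      assume "\<exists>k0\<in>set (kss ! i). k0 \<noteq> \<zero> \<and> eqv (combine (kss ! i) Us) k0 \<and> (\<forall>k\<in>set (kss ! i). le k0 k)"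
      then obtain k0 where k0: "k0 \<in> set (kss ! i)" "eqv (combine (kss ! i) Us) k0" "\<forall>k\<in>set (kss ! i). le k0 k" by blast
      have k0M: "k0 \<in> M" using km[OF ci[OF i]] k0 by blast
      have "eqv (combine (kss ! i) Us \<otimes> zs ! i) (k0 \<otimes> zs ! i)"
        using eqv_mult[OF k0(2) eqv_refl[OF zi(1)[OF i]]] yi[OF i] zi[OF i] k0M MR by blast
      then have "le ?x (k0 \<otimes> zs ! i)"
        using le_eqv_trans[OF le[OF i]] xc yi[OF i] zi[OF i] k0M MR by (meson m_closed subsetD)
      then show ?thesis using k0 k k0M by blast
    qed
  qed
  show ?thesis
    using kss x km ci nz bd by (intro exI[of _ kss]) auto
qed

text \<open>This independence is the source of the fundamental inequality: ramification index times
  inertia degree is at most the degree.\<close>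

lemma prods_independent:
  assumes M: "subfield M R" and U: "res_indep M Us" and z: "distinct zs" "val_indep M (set zs)"
  shows "independent M (prods Us zs)"
proof (rule ccontr)
  assume d: "dependent M (prods Us zs)"
  have c: "set (prods Us zs) \<subseteq> carrier R" using U z unfolding res_indep_def val_indep_def by auto
  obtain ks where ks: "length ks = length (prods Us zs)" "combine ks (prods Us zs) = \<zero>" "set ks \<subseteq> M" "set ks \<noteq> {\<zero>}"
    using dependent_imp_non_trivial_combine[OF M c d] .
  have ne: "prods Us zs \<noteq> []" using d by (metis li_Nil)
  obtain kss where kss: "concat kss = ks" "length kss = length zs"
     "\<forall>i<length zs. \<forall>k\<in>set (kss ! i). k \<noteq> \<zero> \<longrightarrow> combine ks (prods Us zs) \<noteq> \<zero>"
    using prods_combine[OF M U z ks(3)] ks(1) length_prods by metis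
  have "set ks \<subseteq> {\<zero>}"
  proof
    fix k assume "k \<in> set ks"
    then obtain c where "c \<in> set kss" "k \<in> set c" using kss(1) by auto
    then obtain i where "i < length zs" "k \<in> set (kss ! i)" using kss(2) by (auto simp: in_set_conv_nth)
    then show "k \<in> {\<zero>}" using kss(3) ks(2) by auto
  qed
  moreover have "set ks \<noteq> {}" using ks(1) ne by auto
  ultimately show False using ks(4) by (metis subset_singletonD)
qed

end

section \<open>Cosets of values and initial segments\<close>

context preval
begin

lemma combine_subring:
  "subring S R \<Longrightarrow> set ks \<subseteq> S \<Longrightarrow> set Us \<subseteq> S \<Longrightarrow> combine ks Us \<in> S"
  by (induct ks Us rule: combine.induct) (auto intro: subringE(2,6,7))

definition cong :: "'a set \<Rightarrow> 'a \<Rightarrow> 'a \<Rightarrow> bool" where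
  "cong M x y \<longleftrightarrow> (\<exists>k\<in>M - {\<zero>}. eqv x (k \<otimes> y))"

definition initial :: "'a set \<Rightarrow> 'a set \<Rightarrow> 'a set" where
  "initial N M = {x \<in> N - {\<zero>}. le \<one> x \<and> (\<forall>m\<in>M - {\<zero>}. lt \<one> m \<longrightarrow> lt x m)}"

definition init_full :: "'a set \<Rightarrow> 'a set \<Rightarrow> bool" where
  "init_full N M \<longleftrightarrow> (\<forall>x\<in>N - {\<zero>}. \<exists>y\<in>initial N M. cong M x y)"

lemma transversal_cong:
  "transversal N M Z \<longleftrightarrow> val_indep M Z \<and> Z \<subseteq> N \<and> (\<forall>x\<in>N - {\<zero>}. \<exists>z\<in>Z. cong M x z)"
  unfolding transversal_def cong_def by blast

context
  fixes M assumes M: "subfield M R"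
begin

lemma MR: "M \<subseteq> carrier R" using subfieldE(3)[OF M] .

lemma M1: "\<one> \<in> M - {\<zero>}" using subringE(3)[OF subfieldE(1)[OF M]] by simp

lemma Mmult: "k \<in> M - {\<zero>} \<Longrightarrow> l \<in> M - {\<zero>} \<Longrightarrow> k \<otimes> l \<in> M - {\<zero>}"
  using subringE(6)[OF subfieldE(1)[OF M]] MR by (auto simp: integral_iff subset_iff)

lemma Minv: "k \<in> M - {\<zero>} \<Longrightarrow> inv k \<in> M - {\<zero>}" using subfield_m_inv(1)[OF M] .

lemma eqv_imp_cong: "eqv x y \<Longrightarrow> x \<in> carrier R \<Longrightarrow> y \<in> carrier R \<Longrightarrow> cong M x y"
  unfolding cong_def using M1 by (intro bexI[of _ \<one>]) simp_all

lemma cong_refl: "x \<in> carrier R \<Longrightarrow> cong M x x" using eqv_imp_cong eqv_refl by blast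

lemma cong_sym:
  assumes "cong M x y" "x \<in> carrier R" "y \<in> carrier R" shows "cong M y x"
proof -
  obtain k where k: "k \<in> M - {\<zero>}" "eqv x (k \<otimes> y)" using assms unfolding cong_def by blast
  have kc: "k \<in> carrier R" "k \<noteq> \<zero>" using k MR by auto
  note i = inv_props[OF kc]
  have "eqv (inv k \<otimes> x) (inv k \<otimes> (k \<otimes> y))" using eqv_mult[OF eqv_refl[OF i(1)] k(2)] i kc assms by simp
  then have "eqv y (inv k \<otimes> x)" using i kc assms eqv_sym by (simp add: m_assoc[symmetric])
  then show ?thesis unfolding cong_def using Minv[OF k(1)] by blast
qed

lemma cong_trans:
  assumes "cong M x y" "cong M y z" "x \<in> carrier R" "y \<in> carrier R" "z \<in> carrier R" shows "cong M x z"
proof -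
  obtain k l where k: "k \<in> M - {\<zero>}" "eqv x (k \<otimes> y)" and l: "l \<in> M - {\<zero>}" "eqv y (l \<otimes> z)"
    using assms unfolding cong_def by blast
  have c: "k \<in> carrier R" "l \<in> carrier R" using k l MR by auto
  have "eqv (k \<otimes> y) (k \<otimes> (l \<otimes> z))" using eqv_mult[OF eqv_refl[OF c(1)] l(2)] c assms by simp
  then have "eqv x (k \<otimes> l \<otimes> z)" using eqv_trans[OF k(2)] c assms by (simp add: m_assoc)
  then show ?thesis unfolding cong_def using Mmult[OF k(1) l(1)] by blast
qed

lemma val_indep_cong:
  "val_indep M Z \<longleftrightarrow> Z \<subseteq> carrier R - {\<zero>} \<and> (\<forall>z\<in>Z. \<forall>z'\<in>Z. cong M z z' \<longrightarrow> z = z')"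
proof -
  have "(\<exists>k\<in>M - {\<zero>}. eqv (k \<otimes> z) z') \<longleftrightarrow> cong M z' z" for z z' unfolding cong_def eqv_def by blast
  then show ?thesis unfolding val_indep_def by (metis (no_types, lifting))
qed

lemma exists_transversal:
  assumes S: "S \<subseteq> N - {\<zero>}" "N \<subseteq> carrier R" "\<And>x. x \<in> N - {\<zero>} \<Longrightarrow> \<exists>y\<in>S. cong M x y"
  shows "\<exists>Z\<subseteq>S. transversal N M Z"
proof -
  \<comment> \<open>Congruent elements satisfy the same defining predicate, so \<open>SOME\<close>
    picks the same representative for a whole coset.\<close>
  define r where "r x = (SOME y. y \<in> S \<and> cong M x y)" for x
  have r: "r x \<in> S" "cong M x (r x)" if "x \<in> N - {\<zero>}" for x
    using someI_ex[of "\<lambda>y. y \<in> S \<and> cong M x y"] S(3)[OF that] unfolding r_def by blast+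
  have req: "r x = r y" if "cong M x y" "x \<in> N - {\<zero>}" "y \<in> N - {\<zero>}" for x y
  proof -
    have xy: "x \<in> carrier R" "y \<in> carrier R" using that S(2) by auto
    have zc: "z \<in> carrier R" if "z \<in> S" for z using that S(1,2) by auto
    have yx: "cong M y x" using cong_sym[OF that(1) xy] .
    have "(z \<in> S \<and> cong M x z) = (z \<in> S \<and> cong M y z)" for z
      using cong_trans[OF yx _ xy(2,1) zc] cong_trans[OF that(1) _ xy zc] by blast
    then show ?thesis unfolding r_def by presburger
  qed
  let ?Z = "r ` (N - {\<zero>})"
  have ZS: "?Z \<subseteq> S" using r by blast
  have "transversal N M ?Z"
    unfolding transversal_cong val_indep_cong
  proof (intro conjI ballI impI)
    show "?Z \<subseteq> carrier R - {\<zero>}" "?Z \<subseteq> N" using ZS S by auto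
    fix z z' assume "z \<in> ?Z" "z' \<in> ?Z" "cong M z z'"
    then obtain x x' where x: "x \<in> N - {\<zero>}" "z = r x" "x' \<in> N - {\<zero>}" "z' = r x'" by blast
    have c: "x \<in> carrier R" "x' \<in> carrier R" "z \<in> carrier R" "z' \<in> carrier R"
      using x ZS S r(1) by blast+
    have "cong M x z" "cong M x' z'" using x r by auto
    then have "cong M x x'" using \<open>cong M z z'\<close> cong_trans cong_sym c by meson
    then show "z = z'" using req x by simp
  next
    fix x assume "x \<in> N - {\<zero>}"
    then show "\<exists>z\<in>?Z. cong M x z" using r by blast
  qed
  then show ?thesis using ZS by blast
qed

text \<open>With this one-element list, independence of the products bounds the number of cosets by
  the degree. Dually, the single representative \<open>\<one>\<close> bounds the length of a
  residually independent list.\<close>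

lemma res_indep_one: "res_indep M [\<one>]"
  unfolding res_indep_def
proof (intro conjI allI impI)
  fix ks assume ks: "set ks \<subseteq> M" "length ks = length [\<one>]" "lt \<one> (combine ks [\<one>])"
  then obtain k where k: "ks = [k]" by (cases ks) auto
  then show "\<forall>k\<in>set ks. lt \<one> k" using ks MR by (auto simp: subset_iff)
qed (auto simp: le_refl)

lemma val_indep_one: "val_indep M {\<one>}"
  unfolding val_indep_def by auto

lemma val_indep_card:
  assumes N: "subring N R" "dimension n M N" and Z: "val_indep M Z" "Z \<subseteq> N"
  shows "finite Z" "card Z \<le> n"
proof -
  have *: "card Y \<le> n" if Y: "finite Y" "Y \<subseteq> Z" for Y
  proof -
    obtain zs where zs: "set zs = Y" "distinct zs" using finite_distinct_list[OF Y(1)] by blast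
    have vi: "val_indep M (set zs)" using Z(1) Y zs unfolding val_indep_def by blast
    have "set (prods [\<one>] zs) \<subseteq> N" using zs Y Z N(1) subringE(1)[OF N(1)] by (auto simp: subset_iff)
    then have "length (prods [\<one>] zs) \<le> n"
      using independent_length_le_dimension[OF M N(2) prods_independent[OF M res_indep_one zs(2) vi]] by blast
    then show ?thesis using length_prods[of "[\<one>]" zs] zs distinct_card[OF zs(2)] by simp
  qed
  show "finite Z"
  proof (rule ccontr)
    assume "infinite Z"
    then obtain Y where "finite Y" "card Y = Suc n" "Y \<subseteq> Z" using infinite_arbitrarily_large by blast
    then show False using *[of Y] by simp
  qed
  then show "card Z \<le> n" using * by blast
qed

text \<open>A residually independent list of greatest length exists by the degree bound. It
  generates all residues, since an integral \<open>x\<close> appended to it produces a relation that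
  can be solved for \<open>x\<close> modulo positive value.\<close>

lemma res_basis_exists:
  assumes N: "subring N R" "dimension n M N" "M \<subseteq> N"
  shows "\<exists>Us. res_basis N M Us"
proof -
  have bound: "length Us \<le> n" if U: "res_indep M Us" "set Us \<subseteq> N" for Us
  proof -
    have "set (prods Us [\<one>]) \<subseteq> N" using U subringE(1)[OF N(1)] by (auto simp: subset_iff)
    moreover have "independent M (prods Us [\<one>])"
      using prods_independent[OF M U(1), of "[\<one>]"] val_indep_one by simp
    ultimately have "length (prods Us [\<one>]) \<le> n" using independent_length_le_dimension[OF M N(2)] by blast
    then show ?thesis by simp
  qed
  have "res_indep M []" unfolding res_indep_def by simp
  then obtain Us where U: "res_indep M Us" "set Us \<subseteq> N"
    and max: "\<And>Vs. res_indep M Vs \<Longrightarrow> set Vs \<subseteq> N \<Longrightarrow> length Vs \<le> length Us"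
    using ex_has_greatest_nat[of "\<lambda>Us. res_indep M Us \<and> set Us \<subseteq> N" "[]" length "Suc n"] bound
    by (auto simp: less_Suc_eq_le)
  have Uc: "set Us \<subseteq> carrier R" "\<And>u. u \<in> set Us \<Longrightarrow> le \<one> u" using U unfolding res_indep_def by auto
  have "\<exists>ks. set ks \<subseteq> M \<and> length ks = length Us \<and> (\<forall>k\<in>set ks. le \<one> k) \<and> lt \<one> (x \<ominus> combine ks Us)"
    if x: "x \<in> N" "le \<one> x" for x
  proof -
    have xc: "x \<in> carrier R" using x subringE(1)[OF N(1)] by blast
    have "\<not> res_indep M (Us @ [x])" using max[of "Us @ [x]"] U x by auto
    then obtain ls where ls: "set ls \<subseteq> M" "length ls = Suc (length Us)" "\<forall>k\<in>set ls. le \<one> k"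
      "lt \<one> (combine ls (Us @ [x]))" "\<not> (\<forall>k\<in>set ls. lt \<one> k)"
      using Uc xc x unfolding res_indep_def by auto
    obtain ks k where kk: "ls = ks @ [k]" using ls(2) by (metis append_butlast_last_id length_0_conv nat.distinct(1))
    have ks: "set ks \<subseteq> M" "length ks = length Us" "\<forall>k\<in>set ks. le \<one> k" "k \<in> M" "le \<one> k" using ls kk by auto
    have kc: "set ks \<subseteq> carrier R" "k \<in> carrier R" using ks MR by auto
    let ?c = "combine ks Us"
    have cc: "?c \<in> carrier R" using kc Uc by simp
    have l: "lt \<one> (?c \<oplus> k \<otimes> x)"
      using ls(4) combine_append[OF ks(2) kc(1) Uc(1), of "[k]" "[x]"] kc xc unfolding kk by simp
    \<comment> \<open>If the last coefficient had positive value, the relation would reduce to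
      \<open>Us\<close>, and independence would give all coefficients positive value.\<close>
    have nk: "\<not> lt \<one> k"
    proof
      assume lk: "lt \<one> k"
      then have "lt (\<one> \<otimes> \<one>) (k \<otimes> x)" using lt_mult[OF lk x(2)] kc xc by simp
      then have "lt \<one> (\<ominus> (k \<otimes> x))" using lt_minus kc xc by simp
      then have "lt \<one> ((?c \<oplus> k \<otimes> x) \<oplus> \<ominus> (k \<otimes> x))" using lt_add[OF l] kc xc cc by simp
      then have "lt \<one> ?c" using kc xc cc by (simp add: a_assoc r_neg)
      then have "\<forall>k\<in>set ks. lt \<one> k" using res_indepD[OF U(1) ks(1,2)] ks(3) by blast
      then show False using ls(5) lk kk by auto
    qed
    have k0: "k \<noteq> \<zero>" using nk lt_zero[of \<one>] by auto
    note i = inv_props[OF kc(2) k0]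
    have le1: "le \<one> (inv k)"
    proof -
      have "le k \<one>" using nk unfolding lt_def by blast
      then have "le (k \<otimes> inv k) (\<one> \<otimes> inv k)" using le_mult_right kc i by blast
      then show ?thesis using i by simp
    qed
    have iM: "inv k \<in> M" using Minv[of k] ks k0 by blast
    let ?m = "\<ominus> (inv k)"
    have mM: "?m \<in> M" "?m \<in> carrier R" "le \<one> ?m"
      using subringE(5)[OF subfieldE(1)[OF M] iM] i le_minus[OF le1] by auto
    let ?ks = "map ((\<otimes>) ?m) ks"
    have "combine ?ks Us = ?m \<otimes> ?c" using combine_r_distr[OF kc(1) Uc(1) mM(2)] by simp
    then have "x \<ominus> combine ?ks Us = inv k \<otimes> (?c \<oplus> k \<otimes> x)"
      using i xc cc kc by (simp add: a_minus_def l_minus r_distr m_assoc[symmetric] a_comm)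
    moreover have "lt (\<one> \<otimes> \<one>) ((?c \<oplus> k \<otimes> x) \<otimes> inv k)" using lt_mult[OF l le1] kc xc cc i by simp
    ultimately have "lt \<one> (x \<ominus> combine ?ks Us)" using kc xc cc i by (simp add: m_comm)
    moreover have "set ?ks \<subseteq> M" using mM(1) ks(1) subringE(6)[OF subfieldE(1)[OF M]] by auto
    moreover have "le \<one> (?m \<otimes> a)" if "a \<in> set ks" for a
      using le_mult[OF mM(3), of \<one> a] ks(3) that mM(2) kc by auto
    ultimately show ?thesis using ks(2) by (intro exI[of _ ?ks]) auto
  qed
  then show ?thesis using U unfolding res_basis_def by blast
qed

text \<open>Suppose \<open>x\<close> has the value of \<open>k y\<close> with \<open>k\<close> of
  positive value in \<open>M\<close>. As \<open>y\<close> is integral, \<open>x\<close> has at least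
  the value of \<open>k\<close>, which initiality of \<open>x\<close> forbids. The symmetric
  argument excludes negative value.\<close>

lemma initial_cong_eqv:
  assumes "x \<in> initial N M" "y \<in> initial N M" "cong M x y" "N \<subseteq> carrier R"
  shows "eqv x y"
proof -
  have *: "\<not> lt \<one> k" if "x \<in> initial N M" "y \<in> initial N M" "eqv x (k \<otimes> y)" "k \<in> M - {\<zero>}" for x y k
  proof
    assume l: "lt \<one> k"
    have c: "x \<in> carrier R" "y \<in> carrier R" "k \<in> carrier R" using that assms(4) MR unfolding initial_def by auto
    have xk: "lt x k" using l that unfolding initial_def by blast
    have "le (k \<otimes> \<one>) (k \<otimes> y)" using le_mult[OF le_refl[OF c(3)], of \<one> y] that c unfolding initial_def by auto
    then have "le k x" using le_eqv_trans[OF _ eqv_sym[OF that(3)]] c by simp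
    then show False using xk unfolding lt_def by blast
  qed
  obtain k where k: "k \<in> M - {\<zero>}" "eqv x (k \<otimes> y)" using assms unfolding cong_def by blast
  have c: "x \<in> carrier R" "y \<in> carrier R" "k \<in> carrier R" "k \<noteq> \<zero>" using k assms MR unfolding initial_def by auto
  note i = inv_props[OF c(3,4)]
  have "eqv (inv k \<otimes> x) (inv k \<otimes> (k \<otimes> y))" using eqv_mult[OF eqv_refl[OF i(1)] k(2)] i c by simp
  then have e: "eqv y (inv k \<otimes> x)" using i c eqv_sym by (simp add: m_assoc[symmetric])
  have "\<not> lt \<one> (inv k)" using *[OF assms(2,1) e Minv[OF k(1)]] .
  then have "le (inv k \<otimes> k) (\<one> \<otimes> k)" using le_mult_right i c unfolding lt_def by blast
  then have "le \<one> k" using i c by simp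
  then have "eqv k \<one>" using *[OF assms(1,2) k(2,1)] unfolding lt_def eqv_def by blast
  then have "eqv (k \<otimes> y) (\<one> \<otimes> y)" using eqv_mult eqv_refl c by blast
  then show ?thesis using eqv_trans[OF k(2)] c by simp
qed

text \<open>Distinct values in the initial segment lie in distinct cosets, so the values inject into
  the finite set of cosets, and equal cardinality means that every coset is met. The function
  \<open>f\<close> stands for the valuation, since a preorder has no value group of its own.\<close>

lemma init_full_card:
  assumes N: "N \<subseteq> carrier R" and Z: "transversal N M Z" "finite Z"
    and f: "\<And>x y. x \<in> N - {\<zero>} \<Longrightarrow> y \<in> N - {\<zero>} \<Longrightarrow> f x = f y \<longleftrightarrow> eqv x y"
  shows "card (f ` initial N M) = card Z \<longleftrightarrow> init_full N M"
proof -
  let ?I = "initial N M"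
  have I: "?I \<subseteq> N - {\<zero>}" unfolding initial_def by blast
  have Zc: "Z \<subseteq> N - {\<zero>}" using Z unfolding transversal_def val_indep_def by blast
  have zz: "z = z'" if "z \<in> Z" "z' \<in> Z" "cong M z z'" for z z'
    using Z(1)[unfolded transversal_cong val_indep_cong] that by blast
  define r where "r x = (SOME z. z \<in> Z \<and> cong M x z)" for x
  have r: "r x \<in> Z" "cong M x (r x)" if "x \<in> N - {\<zero>}" for x
    using someI_ex[of "\<lambda>z. z \<in> Z \<and> cong M x z"] Z(1) that unfolding r_def transversal_cong by blast+
  have rc: "r x = r y \<longleftrightarrow> cong M x y" if "x \<in> N - {\<zero>}" "y \<in> N - {\<zero>}" for x y
  proof
    have c: "x \<in> carrier R" "y \<in> carrier R" "r x \<in> carrier R" "r y \<in> carrier R"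
      using that N Zc r(1) by blast+
    show "r x = r y \<Longrightarrow> cong M x y" using r(2) that cong_trans cong_sym c by metis
    assume "cong M x y"
    then have "cong M (r x) (r y)" using r(2) that cong_trans cong_sym c by meson
    then show "r x = r y" using zz[OF r(1)[OF that(1)] r(1)[OF that(2)]] by blast
  qed
  have fr: "f x = f y \<longleftrightarrow> r x = r y" if "x \<in> ?I" "y \<in> ?I" for x y
  proof -
    have xy: "x \<in> N - {\<zero>}" "y \<in> N - {\<zero>}" "x \<in> carrier R" "y \<in> carrier R" using that I N by auto
    have "eqv x y \<longleftrightarrow> cong M x y"
      using initial_cong_eqv[OF that _ N] eqv_imp_cong[OF _ xy(3,4)] by (rule iffI[rotated])
    then show ?thesis using f[OF xy(1,2)] rc[OF xy(1,2)] by simp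
  qed
  have "bij_betw (\<lambda>c. r (inv_into ?I f c)) (f ` ?I) (r ` ?I)"
    unfolding bij_betw_def
  proof
    have ii: "inv_into ?I f c \<in> ?I" "f (inv_into ?I f c) = c" if "c \<in> f ` ?I" for c
      using that by (auto intro: inv_into_into f_inv_into_f)
    show "inj_on (\<lambda>c. r (inv_into ?I f c)) (f ` ?I)"
    proof (rule inj_onI)
      fix c d assume cd: "c \<in> f ` ?I" "d \<in> f ` ?I" "r (inv_into ?I f c) = r (inv_into ?I f d)"
      then show "c = d" using fr[OF ii(1)[OF cd(1)] ii(1)[OF cd(2)]] ii(2)[OF cd(1)] ii(2)[OF cd(2)] by simp
    qed
    show "(\<lambda>c. r (inv_into ?I f c)) ` f ` ?I = r ` ?I"
    proof
      show "(\<lambda>c. r (inv_into ?I f c)) ` f ` ?I \<subseteq> r ` ?I" using ii by blast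
      show "r ` ?I \<subseteq> (\<lambda>c. r (inv_into ?I f c)) ` f ` ?I"
      proof
        fix z assume "z \<in> r ` ?I"
        then obtain x where x: "x \<in> ?I" "z = r x" by blast
        then have "r (inv_into ?I f (f x)) = z" using fr ii[of "f x"] by blast
        then show "z \<in> (\<lambda>c. r (inv_into ?I f c)) ` f ` ?I" using x(1) by blast
      qed
    qed
  qed
  then have cc: "card (f ` ?I) = card (r ` ?I)" by (rule bij_betw_same_card)
  have rI: "r ` ?I \<subseteq> Z" using r(1) I by blast
  have "card (r ` ?I) = card Z \<longleftrightarrow> r ` ?I = Z" using card_subset_eq[OF Z(2) rI] by auto
  moreover have "r ` ?I = Z \<longleftrightarrow> init_full N M"
  proof
    assume e: "r ` ?I = Z"
    show "init_full N M" unfolding init_full_def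
    proof
      fix x assume x: "x \<in> N - {\<zero>}"
      then obtain y where "y \<in> ?I" "r x = r y" using e r(1)[OF x] by blast
      then show "\<exists>y\<in>?I. cong M x y" using rc x I by blast
    qed
  next
    assume h: "init_full N M"
    have "z \<in> r ` ?I" if z: "z \<in> Z" for z
    proof -
      have zN: "z \<in> N - {\<zero>}" using z Zc by blast
      then obtain y where y: "y \<in> ?I" "cong M z y" using h unfolding init_full_def by blast
      have "r z = r y" using rc zN y I by blast
      moreover have "r z = z" using zz[OF z r(1)[OF zN] r(2)[OF zN]] by simp
      ultimately show ?thesis using y by (metis imageI)
    qed
    then show "r ` ?I = Z" using rI by blast
  qed
  ultimately show ?thesis using cc by simp
qed

end

lemma cong_mono: "M \<subseteq> M' \<Longrightarrow> cong M x y \<Longrightarrow> cong M' x y" unfolding cong_def by blast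

text \<open>The representative found in \<open>N\<close> has the value of a product of
  \<open>x\<close> with an element of \<open>M\<close>, and this product already lies in
  \<open>E\<close>.\<close>

lemma init_full_lower:
  assumes M: "subfield M R" and E: "subfield E R" and ME: "M \<subseteq> E" and EN: "E \<subseteq> N" "N \<subseteq> carrier R"
    and full: "init_full N M"
  shows "init_full E M"
  unfolding init_full_def
proof
  fix x assume x: "x \<in> E - {\<zero>}"
  then obtain y where y: "y \<in> initial N M" "cong M x y" using full EN unfolding init_full_def by blast
  obtain k where k: "k \<in> M - {\<zero>}" "eqv y (k \<otimes> x)"
    using cong_sym[OF M y(2)] x y EN unfolding cong_def initial_def by blast
  have kx: "k \<otimes> x \<in> E - {\<zero>}" using Mmult[OF E, of k x] k x ME by blast
  have c: "x \<in> carrier R" "y \<in> carrier R" "k \<in> carrier R" "k \<otimes> x \<in> carrier R" using x y k ME EN kx unfolding initial_def by auto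
  have "k \<otimes> x \<in> initial E M"
    unfolding initial_def
  proof (intro CollectI conjI ballI impI)
    show "k \<otimes> x \<in> E - {\<zero>}" by (rule kx)
    show "le \<one> (k \<otimes> x)" using le_eqv_trans[OF _ k(2)] y c unfolding initial_def by simp
    fix m assume m: "m \<in> M - {\<zero>}" "lt \<one> m"
    then have "lt y m" using y unfolding initial_def by blast
    then show "lt (k \<otimes> x) m" using le_lt_trans[of "k \<otimes> x" y m] k(2) c m MR[OF M] unfolding eqv_def by blast
  qed
  moreover have "cong M x (k \<otimes> x)" using cong_sym[OF M _ c(4,1)] k(1) eqv_refl[OF c(4)] unfolding cong_def by blast
  ultimately show "\<exists>y\<in>initial E M. cong M x y" by blast
qed

text \<open>In the coset of \<open>x\<close> modulo \<open>E\<close>, choose an element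
  \<open>y\<close> of least value that is initial over \<open>M\<close>. Any positive value of
  \<open>E\<close> not exceeding that of \<open>y\<close> could be subtracted from it, giving a
  smaller candidate in the same coset. Hence \<open>y\<close> is initial over
  \<open>E\<close>.\<close>

lemma init_full_upper:
  assumes M: "subfield M R" and E: "subfield E R" and ME: "M \<subseteq> E" and N: "subfield N R" "E \<subseteq> N"
    and full: "init_full N M" and Z: "transversal N M Z" "finite Z"
  shows "init_full N E"
  unfolding init_full_def
proof
  have NR: "N \<subseteq> carrier R" using MR[OF N(1)] .
  fix x assume x: "x \<in> N - {\<zero>}"
  let ?C = "{y \<in> initial N M. cong E x y}"
  have Cc: "?C \<subseteq> N - {\<zero>}" unfolding initial_def by blast
  have Zc: "Z \<subseteq> N - {\<zero>}" using Z unfolding transversal_def val_indep_def by blast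
  have Cne: "?C \<noteq> {}" using full x cong_mono[OF ME] unfolding init_full_def by blast
  \<comment> \<open>One candidate per coset modulo \<open>M\<close> suffices, because initial
    elements of the same coset have equal value; the minimum is thus taken over a finite
    set.\<close>
  define Y where "Y = {z \<in> Z. \<exists>y\<in>?C. cong M y z}"
  define s where "s z = (SOME y. y \<in> ?C \<and> cong M y z)" for z
  have s: "s z \<in> ?C" "cong M (s z) z" if "z \<in> Y" for z
    using someI_ex[of "\<lambda>y. y \<in> ?C \<and> cong M y z"] that unfolding s_def Y_def by blast+
  have rep: "\<exists>z\<in>Y. cong M y z" if "y \<in> ?C" for y
    using Z(1) Cc that unfolding transversal_cong Y_def by blast
  have "finite (s ` Y)" using Z(2) unfolding Y_def by simp
  moreover have "s ` Y \<noteq> {}" using rep Cne by blast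
  moreover have "s ` Y \<subseteq> carrier R" using s(1) Cc NR by blast
  ultimately obtain y where y: "y \<in> s ` Y" "\<forall>w\<in>s ` Y. le y w" using exists_min by blast
  have yC: "y \<in> ?C" using y s by blast
  have yc: "y \<in> carrier R" "y \<noteq> \<zero>" "y \<in> N" "x \<in> carrier R" using yC Cc NR x by auto
  have min: "le y w" if w: "w \<in> ?C" for w
  proof -
    obtain z where z: "z \<in> Y" "cong M w z" using rep[OF w] by blast
    have c: "w \<in> carrier R" "s z \<in> carrier R" "z \<in> carrier R" using w s(1)[OF z(1)] Cc NR z(1) Zc unfolding Y_def by auto
    have "cong M w (s z)" using cong_trans[OF M z(2) cong_sym[OF M s(2)[OF z(1)]]] c by blast
    then have "eqv (s z) w" using initial_cong_eqv[OF M _ _ _ NR, of w "s z"] w s(1)[OF z(1)] eqv_sym by blast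
    then show ?thesis using le_eqv_trans[of y "s z" w] y(2) z(1) yc c by blast
  qed
  have "y \<in> initial N E"
    unfolding initial_def
  proof (intro CollectI conjI ballI impI)
    show "y \<in> N - {\<zero>}" "le \<one> y" using yC unfolding initial_def by auto
    fix m assume m: "m \<in> E - {\<zero>}" "lt \<one> m"
    have mc: "m \<in> carrier R" "m \<noteq> \<zero>" using m MR[OF E] by auto
    note i = inv_props[OF mc]
    show "lt y m"
    proof (rule ccontr)
      assume "\<not> lt y m"
      then have my: "le m y" unfolding lt_def by blast
      \<comment> \<open>The smaller candidate: integral because \<open>m\<close> has at most the
        value of \<open>y\<close>, and below \<open>y\<close> because \<open>m\<close> has positive
        value.\<close>
      let ?w = "y \<otimes> inv m"
      have wc: "?w \<in> carrier R" using yc i by simp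
      have wN: "?w \<in> N - {\<zero>}"
        using Mmult[OF N(1), of y "inv m"] Minv[OF N(1), of m] m N(2) yc by blast
      have "le (m \<otimes> inv m) ?w" using le_mult_right[OF my mc(1) yc(1) i(1)] .
      then have w1: "le \<one> ?w" using i by simp
      have "lt (\<one> \<otimes> ?w) (m \<otimes> ?w)" using lt_cancel[of \<one> m ?w] m(2) mc wc wN by blast
      moreover have "m \<otimes> ?w = y" using m_lcomm[OF mc(1) yc(1) i(1)] yc i by simp
      ultimately have wy: "lt ?w y" using wc by simp
      have "?w \<in> initial N M"
        unfolding initial_def
      proof (intro CollectI conjI ballI impI)
        fix d assume d: "d \<in> M - {\<zero>}" "lt \<one> d"
        then have "lt y d" using yC unfolding initial_def by blast
        then show "lt ?w d" using lt_le_trans[OF wy lt_imp_le] wc yc d MR[OF M] by blast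
      qed (use wN w1 in auto)
      moreover have "cong E x ?w"
      proof -
        have "cong E y ?w" unfolding cong_def using m(1) eqv_refl[OF yc(1)] \<open>m \<otimes> ?w = y\<close> by (intro bexI[of _ m]) auto
        moreover have "cong E x y" using yC by blast
        ultimately show ?thesis using cong_trans[OF E] yc wc by blast
      qed
      ultimately have "le y ?w" using min by blast
      then show False using wy unfolding lt_def by blast
    qed
  qed
  then show "\<exists>y\<in>initial N E. cong E x y" using yC by blast
qed

text \<open>Multiplicativity of the ramification index. Modulo \<open>E\<close> the factor
  \<open>z\<close> is invisible, which determines \<open>w\<close>; cancelling \<open>w\<close> then
  determines \<open>z\<close> modulo \<open>M\<close>.\<close>

lemma transversal_mult:
  assumes M: "subfield M R" and E: "subfield E R" and ME: "M \<subseteq> E" and N: "subfield N R" "E \<subseteq> N"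
    and Z: "transversal E M Z" and W: "transversal N E W"
  shows "transversal N M ((\<lambda>(z, w). z \<otimes> w) ` (Z \<times> W))" "inj_on (\<lambda>(z, w). z \<otimes> w) (Z \<times> W)"
proof -
  have Zc: "Z \<subseteq> E - {\<zero>}" and Wc: "W \<subseteq> N - {\<zero>}" using Z W unfolding transversal_def val_indep_def by blast+
  have NR: "N \<subseteq> carrier R" using MR[OF N(1)] .
  have key: "z = z' \<and> w = w'"
    if h: "z \<in> Z" "z' \<in> Z" "w \<in> W" "w' \<in> W" "cong M (z \<otimes> w) (z' \<otimes> w')" for z z' w w'
  proof -
    obtain k where k: "k \<in> M - {\<zero>}" "eqv (z \<otimes> w) (k \<otimes> (z' \<otimes> w'))" using h(5) unfolding cong_def by blast
    have e: "z \<in> E - {\<zero>}" "z' \<in> E - {\<zero>}" "k \<in> E - {\<zero>}" using h Zc k ME by auto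
    have c: "z \<in> carrier R" "z' \<in> carrier R" "k \<in> carrier R" "w \<in> carrier R" "w' \<in> carrier R" "z \<noteq> \<zero>" "w' \<noteq> \<zero>" "w \<noteq> \<zero>"
      using e h Wc NR N(2) by auto
    note i = inv_props[OF c(1,6)]
    have "eqv (inv z \<otimes> (z \<otimes> w)) (inv z \<otimes> (k \<otimes> (z' \<otimes> w')))" using eqv_mult[OF eqv_refl[OF i(1)] k(2)] i c by simp
    then have "eqv w ((inv z \<otimes> (k \<otimes> z')) \<otimes> w')" using i c by (simp add: m_assoc[symmetric])
    moreover have "inv z \<otimes> (k \<otimes> z') \<in> E - {\<zero>}" using Mmult[OF E] Minv[OF E] e by blast
    ultimately have "cong E w w'" unfolding cong_def by blast
    then have ww: "w = w'" using W[unfolded transversal_cong val_indep_cong[OF E]] h by blast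
    have "eqv (z \<otimes> w) ((k \<otimes> z') \<otimes> w)" using k(2) c ww by (simp add: m_assoc)
    then have "eqv z (k \<otimes> z')" unfolding eqv_def using le_cancel c by simp
    then have "cong M z z'" unfolding cong_def using k(1) by blast
    then have "z = z'" using Z[unfolded transversal_cong val_indep_cong[OF M]] h by blast
    then show ?thesis using ww by blast
  qed
  have zw: "z \<otimes> w \<in> N - {\<zero>}" if "z \<in> Z" "w \<in> W" for z w
    using Mmult[OF N(1), of z w] that Zc Wc N(2) by blast
  have zwc: "z \<otimes> w \<in> carrier R" if "z \<in> Z" "w \<in> W" for z w using zw[OF that] NR by blast
  show "inj_on (\<lambda>(z, w). z \<otimes> w) (Z \<times> W)"
  proof (rule inj_onI, clarify)
    fix z w z' w' assume a: "z \<in> Z" "w \<in> W" "z' \<in> Z" "w' \<in> W" "z \<otimes> w = z' \<otimes> w'"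
    then have "cong M (z \<otimes> w) (z' \<otimes> w')" using cong_refl[OF M zwc] by metis
    then show "z = z' \<and> w = w'" using key a by blast
  qed
  show "transversal N M ((\<lambda>(z, w). z \<otimes> w) ` (Z \<times> W))"
    unfolding transversal_cong val_indep_cong[OF M]
  proof (intro conjI ballI impI)
    show "(\<lambda>(z, w). z \<otimes> w) ` (Z \<times> W) \<subseteq> carrier R - {\<zero>}" "(\<lambda>(z, w). z \<otimes> w) ` (Z \<times> W) \<subseteq> N"
      using zw NR by auto
    fix a b assume "a \<in> (\<lambda>(z, w). z \<otimes> w) ` (Z \<times> W)" "b \<in> (\<lambda>(z, w). z \<otimes> w) ` (Z \<times> W)" "cong M a b"
    then show "a = b" using key by auto
  next
    fix x assume x: "x \<in> N - {\<zero>}"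
    then obtain w e where w: "w \<in> W" "e \<in> E - {\<zero>}" "eqv x (e \<otimes> w)"
      using W unfolding transversal_def by blast
    obtain z where z: "z \<in> Z" "cong M e z" using Z w(2) unfolding transversal_cong by blast
    have c: "x \<in> carrier R" "w \<in> carrier R" "e \<in> carrier R" "z \<in> carrier R" using x w z Wc Zc NR N(2) by auto
    obtain k where k: "k \<in> M - {\<zero>}" "eqv e (k \<otimes> z)" using z(2) unfolding cong_def by blast
    have kc: "k \<in> carrier R" using k MR[OF M] by blast
    have "eqv (e \<otimes> w) (k \<otimes> z \<otimes> w)" using eqv_mult[OF k(2) eqv_refl[OF c(2)]] c kc by simp
    then have "eqv x (k \<otimes> (z \<otimes> w))" using eqv_trans[OF w(3)] c kc by (simp add: m_assoc)
    then have "cong M x (z \<otimes> w)" unfolding cong_def using k(1) by blast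
    then show "\<exists>y\<in>(\<lambda>(z, w). z \<otimes> w) ` (Z \<times> W). cong M x y" using z w by auto
  qed
qed

text \<open>Multiplicativity of the inertia degree. An integral element is approximated by
  \<open>Ws\<close> with integral coefficients in \<open>E\<close>, and these by \<open>Us\<close>
  with integral coefficients in \<open>M\<close>; both errors have positive value.\<close>

lemma res_basis_prods:
  assumes M: "subfield M R" and E: "subfield E R" and ME: "M \<subseteq> E" and N: "subfield N R" "E \<subseteq> N"
    and U: "res_basis E M Us" and W: "res_basis N E Ws"
  shows "res_basis N M (prods Us Ws)"
proof -
  have NR: "N \<subseteq> carrier R" using MR[OF N(1)] .
  have Ui: "res_indep M Us" "set Us \<subseteq> E" and Wi: "res_indep E Ws" "set Ws \<subseteq> N" using U W unfolding res_basis_def by auto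
  have Uc: "set Us \<subseteq> carrier R" "\<And>u. u \<in> set Us \<Longrightarrow> le \<one> u" using Ui unfolding res_indep_def by auto
  have Wc: "set Ws \<subseteq> carrier R" "\<And>u. u \<in> set Ws \<Longrightarrow> le \<one> u" using Wi unfolding res_indep_def by auto
  have MRc: "M \<subseteq> carrier R" using MR[OF M] .
  have yE: "combine c Us \<in> E" if "set c \<subseteq> M" for c
    using combine_subring[OF subfieldE(1)[OF E]] that ME Ui(2) by blast
  have ri: "res_indep M (prods Us Ws)"
    unfolding res_indep_def
  proof (intro conjI allI impI)
    show "set (prods Us Ws) \<subseteq> carrier R" using Uc Wc by auto
    show "\<forall>u\<in>set (prods Us Ws). le \<one> u"
    proof
      fix x assume "x \<in> set (prods Us Ws)"
      then obtain u w where "u \<in> set Us" "w \<in> set Ws" "x = u \<otimes> w" by auto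
      then show "le \<one> x" using le_mult[of \<one> u \<one> w] Uc Wc by auto
    qed
    fix ks assume ks: "set ks \<subseteq> M" "length ks = length (prods Us Ws)" "\<forall>k\<in>set ks. le \<one> k" "lt \<one> (combine ks (prods Us Ws))"
    obtain kss where kss: "concat kss = ks" "length kss = length Ws" "\<forall>c\<in>set kss. length c = length Us"
      using chunks[of ks "length Ws" "length Us"] ks(2) length_prods by metis
    have sub: "set c \<subseteq> M" "\<forall>k\<in>set c. le \<one> k" if "c \<in> set kss" for c
    proof -
      have "set c \<subseteq> set ks" unfolding kss(1)[symmetric] using that by auto
      then show "set c \<subseteq> M" "\<forall>k\<in>set c. le \<one> k" using ks by blast+
    qed
    let ?ys = "map (\<lambda>ks. combine ks Us) kss"
    have "combine ks (prods Us Ws) = combine ?ys Ws"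
      using combine_concat[OF kss(2) _ Uc(1) Wc(1)] kss sub(1) MRc by blast
    then have l: "lt \<one> (combine ?ys Ws)" using ks(4) by simp
    have ys: "set ?ys \<subseteq> E" using yE sub by auto
    have y1: "le \<one> y" if "y \<in> set ?ys" for y
    proof -
      obtain c where c: "c \<in> set kss" "y = combine c Us" using \<open>y \<in> set ?ys\<close> by auto
      have "set c \<subseteq> carrier R" using sub(1)[OF c(1)] MRc by blast
      then show ?thesis unfolding c(2) using sub(2)[OF c(1)] Uc by (intro combine_le) auto
    qed
    have yl: "lt \<one> y" if "y \<in> set ?ys" for y
      using res_indepD[OF Wi(1) ys _ y1 l that] kss(2) by simp
    show "\<forall>k\<in>set ks. lt \<one> k"
    proof
      fix k assume "k \<in> set ks"
      then obtain c where c: "c \<in> set kss" "k \<in> set c" using kss(1) by auto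
      then have "lt \<one> (combine c Us)" using yl by auto
      then show "lt \<one> k" using res_indepD[OF Ui(1) sub(1)[OF c(1)]] kss(3) c sub(2)[OF c(1)] by blast
    qed
  qed
  have span: "\<exists>ks. set ks \<subseteq> M \<and> length ks = length (prods Us Ws) \<and> (\<forall>k\<in>set ks. le \<one> k) \<and> lt \<one> (x \<ominus> combine ks (prods Us Ws))"
    if x: "x \<in> N" "le \<one> x" for x
  proof -
    have xc: "x \<in> carrier R" using x NR by blast
    obtain ys where ys: "set ys \<subseteq> E" "length ys = length Ws" "\<forall>y\<in>set ys. le \<one> y" "lt \<one> (x \<ominus> combine ys Ws)"
      using W x unfolding res_basis_def by blast
    define g where "g y = (SOME ks. set ks \<subseteq> M \<and> length ks = length Us \<and> (\<forall>k\<in>set ks. le \<one> k) \<and> lt \<one> (y \<ominus> combine ks Us))" for y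
    have g: "set (g y) \<subseteq> M" "length (g y) = length Us" "\<forall>k\<in>set (g y). le \<one> k" "lt \<one> (y \<ominus> combine (g y) Us)" if "y \<in> set ys" for y
    proof -
      have "\<exists>ks. set ks \<subseteq> M \<and> length ks = length Us \<and> (\<forall>k\<in>set ks. le \<one> k) \<and> lt \<one> (y \<ominus> combine ks Us)"
        using U ys that unfolding res_basis_def by blast
      from someI_ex[OF this]
      show "set (g y) \<subseteq> M" "length (g y) = length Us" "\<forall>k\<in>set (g y). le \<one> k" "lt \<one> (y \<ominus> combine (g y) Us)"
        unfolding g_def by blast+
    qed
    let ?kss = "map g ys"
    let ?zs = "map (\<lambda>ks. combine ks Us) ?kss"
    have ysc: "set ys \<subseteq> carrier R" using ys(1) N(2) NR by blast
    have zsc: "set ?zs \<subseteq> carrier R" using g(1) yE N(2) NR by fastforce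
    have eq: "combine (concat ?kss) (prods Us Ws) = combine ?zs Ws"
      using g(1,2) MRc ys(2) by (intro combine_concat Uc(1) Wc(1)) auto
    have "lt \<one> (combine ys Ws \<ominus> combine ?zs Ws)"
      using ys(2) ysc zsc Wc g(4) by (intro combine_diff_lt) auto
    then have "lt \<one> ((x \<ominus> combine ys Ws) \<oplus> (combine ys Ws \<ominus> combine ?zs Ws))"
      using ys(4) xc ysc zsc Wc(1) by (intro lt_add) auto
    moreover have "(x \<ominus> combine ys Ws) \<oplus> (combine ys Ws \<ominus> combine ?zs Ws) = x \<ominus> combine ?zs Ws"
      using xc combine_in_carrier[OF ysc Wc(1)] combine_in_carrier[OF zsc Wc(1)]
      by (simp add: a_minus_def a_assoc r_neg1)
    ultimately have "lt \<one> (x \<ominus> combine (concat ?kss) (prods Us Ws))" unfolding eq by simp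
    moreover have "length (concat ?kss) = length (prods Us Ws)"
    proof -
      have "length (concat (map g ys')) = length ys' * length Us" if "set ys' \<subseteq> set ys" for ys'
        using that g(2) by (induct ys') auto
      then show ?thesis using ys(2) length_prods by simp
    qed
    ultimately show ?thesis using g(1,3) by (intro exI[of _ "concat ?kss"]) auto
  qed
  have "set (prods Us Ws) \<subseteq> N"
    using Ui(2) Wi(2) N(2) subringE(6)[OF subfieldE(1)[OF N(1)]] by (auto simp: subset_iff)
  then show ?thesis using ri span unfolding res_basis_def by blast
qed

text \<open>When the degree equals the product of the two lengths, the products form a basis of the
  whole field. Representatives in the initial segment are too small to compensate a negative value
  from \<open>M\<close>, so integral elements have integral coefficients.\<close>

lemma integral_generators:
  assumes M: "subfield M R" and N: "subfield N R" "M \<subseteq> N"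
    and U: "res_basis N M Us" and zs: "distinct zs" "transversal N M (set zs)" "set zs \<subseteq> initial N M"
    and dim: "dimension (length zs * length Us) M N"
    and x: "x \<in> N" "le \<one> x"
  shows "\<exists>ks. set ks \<subseteq> M \<and> (\<forall>k\<in>set ks. le \<one> k) \<and> x = combine ks (prods Us zs)"
proof -
  have MRc: "M \<subseteq> carrier R" and NR: "N \<subseteq> carrier R" using MR[OF M] MR[OF N(1)] .
  have Ui: "res_indep M Us" "set Us \<subseteq> N" using U unfolding res_basis_def by auto
  have zi: "val_indep M (set zs)" "set zs \<subseteq> N" using zs unfolding transversal_def by auto
  let ?P = "prods Us zs"
  have Pind: "independent M ?P" using prods_independent[OF M Ui(1) zs(1) zi(1)] .
  have PN: "set ?P \<subseteq> N" using Ui(2) zi(2) subringE(6)[OF subfieldE(1)[OF N(1)]] by auto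
  then have Pc: "set ?P \<subseteq> carrier R" using NR by blast
  have "Span M ?P = N"
    using independent_length_eq_dimension[OF M dim Pind PN] length_prods by simp
  then obtain ks where ks: "set ks \<subseteq> M" "length ks = length ?P" "x = combine ks ?P"
    using Span_mem_iff_length_version[OF M Pc] x(1) by blast
  then have lk: "length ks = length zs * length Us" using length_prods by simp
  obtain kss where kss: "concat kss = ks" "length kss = length zs"
    "\<forall>i<length zs. \<forall>k\<in>set (kss ! i). \<exists>k0\<in>M. le k0 k \<and> le (combine ks ?P) (k0 \<otimes> zs ! i)"
    using prods_combine[OF M Ui(1) zs(1) zi(1) ks(1) lk] by blast
  have xc: "x \<in> carrier R" using x NR by blast
  have "le \<one> k" if kks: "k \<in> set ks" for k
  proof -
    obtain c where "c \<in> set kss" "k \<in> set c" using kss(1) kks by auto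
    then obtain i where i: "i < length zs" "k \<in> set (kss ! i)" using kss(2) by (auto simp: in_set_conv_nth)
    obtain k0 where k0: "k0 \<in> M" "le k0 k" "le x (k0 \<otimes> zs ! i)" using kss(3) i ks(3) by blast
    let ?z = "zs ! i"
    have z: "?z \<in> initial N M" using i zs(3) by auto
    then have zc: "?z \<in> carrier R" "?z \<noteq> \<zero>" using NR unfolding initial_def by auto
    have kc: "k0 \<in> carrier R" "k \<in> carrier R" using k0 ks(1) kks MRc by auto
    have l1: "le \<one> (k0 \<otimes> ?z)" using le_trans[OF x(2) k0(3)] xc kc zc by simp
    have "le \<one> k0"
    \<comment> \<open>If \<open>k0\<close> had negative value, its inverse would be a positive value
      of \<open>M\<close>, hence larger than that of the initial element \<open>?z\<close>, and the
      product of \<open>k0\<close> and \<open>?z\<close> would not be integral.\<close>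
    proof (rule ccontr)
      assume n: "\<not> le \<one> k0"
      then have k1: "lt k0 \<one>" unfolding lt_def .
      have kn: "k0 \<noteq> \<zero>" using lt_nonzero[OF k1] kc by simp
      note i = inv_props[OF kc(1) kn]
      have "lt (k0 \<otimes> inv k0) (\<one> \<otimes> inv k0)" using lt_cancel[OF kc(1) one_closed i(1,4)] k1 by simp
      then have "lt \<one> (inv k0)" using i by simp
      moreover have "inv k0 \<in> M - {\<zero>}" using Minv[OF M, of k0] k0(1) kn by blast
      ultimately have "lt ?z (inv k0)" using z unfolding initial_def by blast
      then have "lt (?z \<otimes> k0) (inv k0 \<otimes> k0)" using lt_cancel zc kc kn i by blast
      then have "lt (k0 \<otimes> ?z) \<one>" using i zc kc by (simp add: m_comm)
      then show False using l1 unfolding lt_def by blast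
    qed
    then show ?thesis using le_trans[OF _ k0(2)] kc by simp
  qed
  then show ?thesis using ks by blast
qed

end

subsection \<open>Valuations and their preorders\<close>

context ordered_abelian_group
begin

lemma leq_cancel:
  assumes "a \<otimes> c \<preceq> b \<otimes> c" "a \<in> carrier G" "b \<in> carrier G" "c \<in> carrier G"
  shows "a \<preceq> b"
  using leq_mult[OF assms(1), of "inv c"] assms by (simp add: m_assoc)

lemma leq_pow: "a \<preceq> b \<Longrightarrow> a \<in> carrier G \<Longrightarrow> b \<in> carrier G \<Longrightarrow> a [^] (n::nat) \<preceq> b [^] n"
proof (induct n)
  case (Suc n)
  have "a [^] n \<otimes> a \<preceq> b [^] n \<otimes> a" using leq_mult Suc by simp
  moreover have "b [^] n \<otimes> a \<preceq> b [^] n \<otimes> b" using leq_mult[of a b "b [^] n"] Suc by (simp add: m_comm)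
  ultimately show ?case using leq_trans[of "a [^] n \<otimes> a" "b [^] n \<otimes> a"] Suc by simp
qed (simp add: leq_refl)

text \<open>An ordered group has no torsion. Uniqueness over the henselization compares only some
  power of each element, and this recovers the value itself.\<close>

lemma pow_inj:
  assumes "a [^] n = b [^] n" "(n::nat) > 0" "a \<in> carrier G" "b \<in> carrier G"
  shows "a = b"
proof -
  have *: "a = b" if "a \<preceq> b" "a [^] n = b [^] n" "a \<in> carrier G" "b \<in> carrier G" for a b
  proof -
    obtain m where m: "n = Suc m" using assms(2) by (cases n) auto
    have "a [^] m \<otimes> a \<preceq> b [^] m \<otimes> a" using leq_mult[OF leq_pow[OF that(1)]] that by simp
    then have "b \<otimes> b [^] m \<preceq> a \<otimes> b [^] m" using that m by (simp add: m_comm)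
    then have "b \<preceq> a" using leq_cancel[of b "b [^] m" a] that by simp
    then show ?thesis using leq_antisym that by blast
  qed
  show ?thesis using leq_total[OF assms(3,4)] *[of a b] *[of b a] assms by auto
qed

end

text \<open>A valuation may take any value at zero, so the place of zero at the top is imposed by
  cases.\<close>

definition vle :: "('a, 'b) ring_scheme \<Rightarrow> ('g, 'h) ordered_group_scheme \<Rightarrow> ('a \<Rightarrow> 'g) \<Rightarrow> 'a \<Rightarrow> 'a \<Rightarrow> bool"
  where "vle F G v x y \<longleftrightarrow> y = \<zero>\<^bsub>F\<^esub> \<or> (x \<noteq> \<zero>\<^bsub>F\<^esub> \<and> v x \<preceq>\<^bsub>G\<^esub> v y)"

lemma valuation_one:
  assumes "valuation F G v"
  shows "v \<one>\<^bsub>F\<^esub> = \<one>\<^bsub>G\<^esub>"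
proof -
  interpret F: field F by (rule valuation.axioms(1)) fact
  interpret O: ordered_abelian_group G by (rule valuation.axioms(2)) fact
  interpret V: valuation F G v by fact
  have 1: "\<one>\<^bsub>F\<^esub> \<in> carrier F - {\<zero>\<^bsub>F\<^esub>}" by simp
  have c: "v \<one>\<^bsub>F\<^esub> \<in> carrier G" using V.val_closed[OF 1] .
  have "v \<one>\<^bsub>F\<^esub> \<otimes>\<^bsub>G\<^esub> v \<one>\<^bsub>F\<^esub> = v \<one>\<^bsub>F\<^esub>" using V.val_mult[OF 1 1] by simp
  then show ?thesis using c by (metis O.one_closed O.r_cancel O.l_one)
qed

lemma valuation_pow:
  assumes "valuation F G v" "x \<in> carrier F" "x \<noteq> \<zero>\<^bsub>F\<^esub>"
  shows "v (x [^]\<^bsub>F\<^esub> (n::nat)) = v x [^]\<^bsub>G\<^esub> n"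
proof -
  interpret F: field F by (rule valuation.axioms(1)) fact
  interpret V: valuation F G v by fact
  have "v (x [^]\<^bsub>F\<^esub> n) = v x [^]\<^bsub>G\<^esub> n \<and> x [^]\<^bsub>F\<^esub> n \<noteq> \<zero>\<^bsub>F\<^esub>"
    using assms valuation_one[OF assms(1)]
    by (induct n) (auto simp: V.val_mult F.integral_iff)
  then show ?thesis by blast
qed

lemma valuation_preval:
  assumes "valuation F G v"
  shows "preval F (vle F G v)"
proof -
  interpret F: field F by (rule valuation.axioms(1)) fact
  interpret O: ordered_abelian_group G by (rule valuation.axioms(2)) fact
  interpret V: valuation F G v by fact
  have vc: "x \<in> carrier F \<Longrightarrow> x \<noteq> \<zero>\<^bsub>F\<^esub> \<Longrightarrow> v x \<in> carrier G" for x using V.val_closed by simp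
  show ?thesis
  proof
    fix x y z assume x: "x \<in> carrier F" and y: "y \<in> carrier F"
    show "vle F G v x y \<or> vle F G v y x" unfolding vle_def using O.leq_total vc x y by blast
    assume z: "z \<in> carrier F"
    show "vle F G v x z" if "vle F G v x y" "vle F G v y z"
      using that O.leq_trans[of "v x" "v y" "v z"] vc x y z unfolding vle_def by blast
    show "vle F G v (x \<otimes>\<^bsub>F\<^esub> z) (y \<otimes>\<^bsub>F\<^esub> z)" if "vle F G v x y"
      using that O.leq_mult[of "v x" "v y" "v z"] vc x y z V.val_mult unfolding vle_def by (auto simp: F.integral_iff)
    show "vle F G v z (x \<oplus>\<^bsub>F\<^esub> y)" if "vle F G v z x" "vle F G v z y"
    proof (cases "x = \<zero>\<^bsub>F\<^esub> \<or> y = \<zero>\<^bsub>F\<^esub> \<or> x \<oplus>\<^bsub>F\<^esub> y = \<zero>\<^bsub>F\<^esub>")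
      case True
      then show ?thesis using that x y unfolding vle_def by auto
    next
      case False
      then have "z \<noteq> \<zero>\<^bsub>F\<^esub>" "v z \<preceq>\<^bsub>G\<^esub> v x" "v z \<preceq>\<^bsub>G\<^esub> v y" using that unfolding vle_def by auto
      moreover have "v x \<preceq>\<^bsub>G\<^esub> v (x \<oplus>\<^bsub>F\<^esub> y) \<or> v y \<preceq>\<^bsub>G\<^esub> v (x \<oplus>\<^bsub>F\<^esub> y)"
        using V.val_add[of x y] x y False by simp
      ultimately have "v z \<preceq>\<^bsub>G\<^esub> v (x \<oplus>\<^bsub>F\<^esub> y)"
        using O.leq_trans[of "v z" _ "v (x \<oplus>\<^bsub>F\<^esub> y)"] vc x y z False by auto
      then show ?thesis unfolding vle_def using \<open>z \<noteq> \<zero>\<^bsub>F\<^esub>\<close> by blast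
    qed
  qed (auto simp: vle_def)
qed

lemma vle_eqv:
  assumes "valuation F G v" "x \<in> carrier F - {\<zero>\<^bsub>F\<^esub>}" "y \<in> carrier F - {\<zero>\<^bsub>F\<^esub>}"
  shows "preval.eqv (vle F G v) x y \<longleftrightarrow> v x = v y"
proof -
  interpret O: ordered_abelian_group G by (rule valuation.axioms(2)) fact
  interpret V: valuation F G v by fact
  interpret P: preval F "vle F G v" by (rule valuation_preval) fact
  show ?thesis unfolding P.eqv_def vle_def
    using assms(2,3) O.leq_antisym[of "v x" "v y"] O.leq_refl[of "v x"] V.val_closed by auto
qed

lemma vle_lt:
  assumes "valuation F G v" "x \<in> carrier F - {\<zero>\<^bsub>F\<^esub>}" "y \<in> carrier F - {\<zero>\<^bsub>F\<^esub>}"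
  shows "preval.lt (vle F G v) x y \<longleftrightarrow> v x \<prec>\<^bsub>G\<^esub> v y"
proof -
  interpret O: ordered_abelian_group G by (rule valuation.axioms(2)) fact
  interpret V: valuation F G v by fact
  interpret P: preval F "vle F G v" by (rule valuation_preval) fact
  show ?thesis unfolding P.lt_def vle_def lt_def
    using assms(2,3) O.leq_antisym[of "v x" "v y"] O.leq_total[of "v x" "v y"] O.leq_refl[of "v x"] V.val_closed by auto
qed

lemma val_ring_vle:
  assumes "valuation F G v"
  shows "val_ring F G v N = {x \<in> N. vle F G v \<one>\<^bsub>F\<^esub> x}"
proof -
  interpret F: field F by (rule valuation.axioms(1)) fact
  interpret V: valuation F G v by fact
  show ?thesis unfolding val_ring_def vle_def valuation_one[OF assms] by auto
qed

lemma val_ideal_vle: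
  assumes "valuation F G v" "N \<subseteq> carrier F"
  shows "val_ideal F G v N = {x \<in> N. preval.lt (vle F G v) \<one>\<^bsub>F\<^esub> x}"
proof -
  interpret F: field F by (rule valuation.axioms(1)) fact
  interpret V: valuation F G v by fact
  interpret P: preval F "vle F G v" by (rule valuation_preval) fact
  have "(x = \<zero>\<^bsub>F\<^esub> \<or> \<one>\<^bsub>G\<^esub> \<prec>\<^bsub>G\<^esub> v x) \<longleftrightarrow> P.lt \<one>\<^bsub>F\<^esub> x" if "x \<in> N" for x
    using vle_lt[OF assms(1), of "\<one>\<^bsub>F\<^esub>" x] P.lt_zero[of "\<one>\<^bsub>F\<^esub>"] that assms(2) valuation_one[OF assms(1)] by auto
  then show ?thesis unfolding val_ideal_def by blast
qed

text \<open>The set \<open>hens\<close> is one of the competing fields by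
  \<open>hens_unique\<close>, and it lies in every other one by \<open>hens_minimal\<close>; so the
  least such field exists and equals \<open>hens\<close>.\<close>

lemma henselization_hens:
  assumes cl: "algebraic_closure F K" and p: "char_p_field F p" and val: "valuation F G v"
  shows "henselization F G v K = valued_closure.hens F K p (vle F G v)"
    and "only_extension F G v (valued_closure.hens F K p (vle F G v))"
    and "subfield E F \<Longrightarrow> K \<subseteq> E \<Longrightarrow> only_extension F G v E \<Longrightarrow> valued_closure.hens F K p (vle F G v) \<subseteq> E"
proof -
  interpret algebraic_closure F K by fact
  interpret char_p_field F p by fact
  interpret O: ordered_abelian_group G by (rule valuation.axioms(2)) fact
  interpret V: valuation F G v by fact
  interpret P: preval F "vle F G v" by (rule valuation_preval) fact
  interpret C: valued_closure F K p "vle F G v" ..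
  show 1: "only_extension F G v C.hens"
      unfolding only_extension_def
    proof (intro allI impI ballI)
      fix w x assume w: "valuation F G w \<and> (\<forall>x\<in>C.hens - {\<zero>\<^bsub>F\<^esub>}. w x = v x)" and x: "x \<in> carrier F - {\<zero>\<^bsub>F\<^esub>}"
      then have wv: "valuation F G w" by blast
      interpret W: valuation F G w by (rule wv)
      interpret Q: preval F "vle F G w" by (rule valuation_preval[OF wv])
      have agree: "vle F G v x y \<longleftrightarrow> vle F G w x y" if "x \<in> C.hens" "y \<in> C.hens" for x y
        using w that unfolding vle_def by (cases "x = \<zero>\<^bsub>F\<^esub>"; cases "y = \<zero>\<^bsub>F\<^esub>") auto
      obtain n e where ne: "n > 0" "e \<in> C.hens" "P.eqv (x [^]\<^bsub>F\<^esub> (n::nat)) e" "Q.eqv (x [^]\<^bsub>F\<^esub> n) e"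
        using C.hens_unique[OF Q.preval_axioms agree, of x] x unfolding Q.eqv_def by auto
      have xn: "x [^]\<^bsub>F\<^esub> n \<in> carrier F - {\<zero>\<^bsub>F\<^esub>}" using x P.pow_nonzero by auto
      have e: "e \<in> carrier F - {\<zero>\<^bsub>F\<^esub>}" using P.eqv_zero[OF ne(3)] xn ne(2) C.hens_carrier by auto
      have "v (x [^]\<^bsub>F\<^esub> n) = v e" "w (x [^]\<^bsub>F\<^esub> n) = w e" "w e = v e"
        using vle_eqv[OF val xn e] vle_eqv[OF wv xn e] ne w e by auto
      then have "w x [^]\<^bsub>G\<^esub> n = v x [^]\<^bsub>G\<^esub> n" using valuation_pow[OF val] valuation_pow[OF wv] x by auto
      then show "w x = v x" using O.pow_inj[OF _ ne(1)] V.val_closed W.val_closed x by blast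
    qed
  have 2: "C.hens \<subseteq> E" if E: "subfield E F \<and> K \<subseteq> E \<and> only_extension F G v E" for E
    proof (rule C.hens_minimal)
      fix \<tau> x assume t: "\<tau> \<in> algebraic_closure.auts F E" and x: "x \<in> carrier F"
      interpret E: algebraic_closure F E using intermediate_algebraic_closure E by blast
      \<comment> \<open>Composing with an automorphism over \<open>E\<close> gives another valuation
        that agrees with \<open>v\<close> on \<open>E\<close>; uniqueness says that the automorphism
        preserves all values.\<close>
      let ?w = "\<lambda>x. v (\<tau> x)"
      have nz: "\<tau> y \<in> carrier F - {\<zero>\<^bsub>F\<^esub>} \<longleftrightarrow> y \<noteq> \<zero>\<^bsub>F\<^esub>" if "y \<in> carrier F" for y
        using E.aut_closed[OF t that] E.aut_eq_zero[OF t that] by blast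
      have "valuation F G ?w"
      proof
        fix x assume "x \<in> carrier F - {\<zero>\<^bsub>F\<^esub>}" then show "v (\<tau> x) \<in> carrier G" using nz V.val_closed by blast
      next
        fix x y assume xy: "x \<in> carrier F - {\<zero>\<^bsub>F\<^esub>}" "y \<in> carrier F - {\<zero>\<^bsub>F\<^esub>}"
        then show "v (\<tau> (x \<otimes>\<^bsub>F\<^esub> y)) = v (\<tau> x) \<otimes>\<^bsub>G\<^esub> v (\<tau> y)"
          using E.aut_mult[OF t, of x y] V.val_mult[of "\<tau> x" "\<tau> y"] nz by auto
        assume "x \<oplus>\<^bsub>F\<^esub> y \<noteq> \<zero>\<^bsub>F\<^esub>"
        then have "\<tau> x \<oplus>\<^bsub>F\<^esub> \<tau> y \<noteq> \<zero>\<^bsub>F\<^esub>" using E.aut_add[OF t, of x y] E.aut_eq_zero[OF t, of "x \<oplus>\<^bsub>F\<^esub> y"] xy by auto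
        then show "v (\<tau> x) \<preceq>\<^bsub>G\<^esub> v (\<tau> (x \<oplus>\<^bsub>F\<^esub> y)) \<or> v (\<tau> y) \<preceq>\<^bsub>G\<^esub> v (\<tau> (x \<oplus>\<^bsub>F\<^esub> y))"
          using E.aut_add[OF t, of x y] V.val_add[of "\<tau> x" "\<tau> y"] nz xy by auto
      qed
      moreover have "\<forall>y\<in>E - {\<zero>\<^bsub>F\<^esub>}. ?w y = v y" using E.aut_fix[OF t] by simp
      ultimately have "\<forall>y\<in>carrier F - {\<zero>\<^bsub>F\<^esub>}. ?w y = v y" using E unfolding only_extension_def by blast
      then show "P.eqv (\<tau> x) x"
        using vle_eqv[OF val, of "\<tau> x" x] nz[OF x] x E.aut_zero[OF t] P.eqv_refl by (cases "x = \<zero>\<^bsub>F\<^esub>") auto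
    qed (use E in auto)
  then show "subfield E F \<Longrightarrow> K \<subseteq> E \<Longrightarrow> only_extension F G v E \<Longrightarrow> C.hens \<subseteq> E" by blast
  show "henselization F G v K = C.hens"
    unfolding henselization_def using 1 2 C.hens_subfield C.K_hens by (intro Least_equality) auto
qed

section \<open>Ramification index, inertia degree and initial index in terms of the preorder\<close>

lemma ramification_index_transversal:
  assumes val: "valuation F G v" and N: "subfield N F" and M: "subfield M F" "M \<subseteq> N"
    and Z: "preval.transversal F (vle F G v) N M Z"
  shows "ramification_index F G v N M = card Z"
proof -
  interpret F: field F by (rule valuation.axioms(1)) fact
  interpret O: ordered_abelian_group G by (rule valuation.axioms(2)) fact
  interpret V: valuation F G v by fact
  interpret P: preval F "vle F G v" by (rule valuation_preval) fact
  let ?H = "value_group F v M" and ?G = "G\<lparr>carrier := value_group F v N\<rparr>"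
  define c where "c z = ?H #>\<^bsub>?G\<^esub> v z" for z
  have NF: "N \<subseteq> carrier F" "M \<subseteq> carrier F" using P.MR N M by blast+
  have Zc: "Z \<subseteq> N - {\<zero>\<^bsub>F\<^esub>}" using Z unfolding P.transversal_def P.val_indep_def by blast
  have cz: "c x = (\<lambda>k. v (k \<otimes>\<^bsub>F\<^esub> x)) ` (M - {\<zero>\<^bsub>F\<^esub>})" if "x \<in> N - {\<zero>\<^bsub>F\<^esub>}" for x
  proof -
    have "c x = (\<lambda>k. v k \<otimes>\<^bsub>G\<^esub> v x) ` (M - {\<zero>\<^bsub>F\<^esub>})" unfolding c_def r_coset_def value_group_def by auto
    also have "\<dots> = (\<lambda>k. v (k \<otimes>\<^bsub>F\<^esub> x)) ` (M - {\<zero>\<^bsub>F\<^esub>})"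
    proof (rule image_cong[OF refl])
      fix k assume "k \<in> M - {\<zero>\<^bsub>F\<^esub>}"
      then have "k \<in> carrier F - {\<zero>\<^bsub>F\<^esub>}" "x \<in> carrier F - {\<zero>\<^bsub>F\<^esub>}" using that NF by auto
      then show "v k \<otimes>\<^bsub>G\<^esub> v x = v (k \<otimes>\<^bsub>F\<^esub> x)" using V.val_mult[of k x] by simp
    qed
    finally show ?thesis .
  qed
  have cc: "c x = c y \<longleftrightarrow> P.cong M x y" if x: "x \<in> N - {\<zero>\<^bsub>F\<^esub>}" and y: "y \<in> N - {\<zero>\<^bsub>F\<^esub>}" for x y
  proof
    have xc: "x \<in> carrier F - {\<zero>\<^bsub>F\<^esub>}" "y \<in> carrier F - {\<zero>\<^bsub>F\<^esub>}" using x y NF by auto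
    have kc: "k \<otimes>\<^bsub>F\<^esub> z \<in> carrier F - {\<zero>\<^bsub>F\<^esub>}" if "k \<in> M - {\<zero>\<^bsub>F\<^esub>}" "z \<in> carrier F - {\<zero>\<^bsub>F\<^esub>}" for k z
      using that NF by (auto simp: F.integral_iff subset_iff)
    {
      assume e: "c x = c y"
      have "v (\<one>\<^bsub>F\<^esub> \<otimes>\<^bsub>F\<^esub> x) \<in> c x" unfolding cz[OF x] using P.M1[OF M(1)] by blast
      then obtain k where k: "k \<in> M - {\<zero>\<^bsub>F\<^esub>}" "v x = v (k \<otimes>\<^bsub>F\<^esub> y)" unfolding e cz[OF y] using xc by auto
      then show "P.cong M x y" unfolding P.cong_def using vle_eqv[OF val xc(1) kc[OF k(1) xc(2)]] by blast
    }
    have sub: "c x \<subseteq> c y" if h: "P.cong M x y" "x \<in> N - {\<zero>\<^bsub>F\<^esub>}" "y \<in> N - {\<zero>\<^bsub>F\<^esub>}" for x y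
    proof
      have xc: "x \<in> carrier F - {\<zero>\<^bsub>F\<^esub>}" "y \<in> carrier F - {\<zero>\<^bsub>F\<^esub>}" using h NF by auto
      obtain k where k: "k \<in> M - {\<zero>\<^bsub>F\<^esub>}" "P.eqv x (k \<otimes>\<^bsub>F\<^esub> y)" using h(1) unfolding P.cong_def by blast
      have vx: "v x = v (k \<otimes>\<^bsub>F\<^esub> y)" using vle_eqv[OF val xc(1) kc[OF k(1) xc(2)]] k(2) by blast
      fix d assume "d \<in> c x"
      then obtain l where l: "l \<in> M - {\<zero>\<^bsub>F\<^esub>}" "d = v (l \<otimes>\<^bsub>F\<^esub> x)" unfolding cz[OF h(2)] by blast
      have lc: "l \<in> carrier F - {\<zero>\<^bsub>F\<^esub>}" "k \<in> carrier F" using l k NF by auto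
      have "d = v (l \<otimes>\<^bsub>F\<^esub> (k \<otimes>\<^bsub>F\<^esub> y))"
        using V.val_mult[OF lc(1) xc(1)] V.val_mult[OF lc(1) kc[OF k(1) xc(2)]] vx l(2) by simp
      also have "l \<otimes>\<^bsub>F\<^esub> (k \<otimes>\<^bsub>F\<^esub> y) = (l \<otimes>\<^bsub>F\<^esub> k) \<otimes>\<^bsub>F\<^esub> y" using lc xc by (simp add: F.m_assoc)
      finally show "d \<in> c y" unfolding cz[OF h(3)] using P.Mmult[OF M(1) l(1) k(1)] by blast
    qed
    show "P.cong M x y \<Longrightarrow> c x = c y"
      using sub[OF _ x y] sub[OF _ y x] P.cong_sym[OF M(1), of x y] xc by blast
  qed
  have "rcosets\<^bsub>?G\<^esub> ?H = c ` (N - {\<zero>\<^bsub>F\<^esub>})" unfolding RCOSETS_def c_def value_group_def by auto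
  also have "\<dots> = c ` Z"
  proof
    show "c ` (N - {\<zero>\<^bsub>F\<^esub>}) \<subseteq> c ` Z"
    proof (rule image_subsetI)
      fix x assume x: "x \<in> N - {\<zero>\<^bsub>F\<^esub>}"
      then obtain z where "z \<in> Z" "P.cong M x z" using Z unfolding P.transversal_cong by blast
      then show "c x \<in> c ` Z" using cc[OF x] Zc by blast
    qed
  qed (use Zc in blast)
  finally have "rcosets\<^bsub>?G\<^esub> ?H = c ` Z" .
  moreover have "inj_on c Z"
  proof (rule inj_onI)
    fix a b assume "a \<in> Z" "b \<in> Z" "c a = c b"
    then show "a = b" using cc[of a b] Zc Z[unfolded P.transversal_cong P.val_indep_cong[OF M(1)]] by blast
  qed
  ultimately show ?thesis unfolding ramification_index_def by (simp add: card_image)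
qed

lemma (in ring) combine_consistent: "ring (R\<lparr>carrier := S\<rparr>) \<Longrightarrow> ring.combine (R\<lparr>carrier := S\<rparr>) ks us = combine ks us"
proof -
  assume r: "ring (R\<lparr>carrier := S\<rparr>)"
  show ?thesis by (induct ks us rule: combine.induct) (simp_all add: ring.combine.simps[OF r])
qed

lemma val_ring_subring:
  assumes val: "valuation F G v" and N: "subfield N F"
  shows "subring (val_ring F G v N) F"
proof -
  interpret F: field F by (rule valuation.axioms(1)) fact
  interpret P: preval F "vle F G v" by (rule valuation_preval) fact
  note s = subringE[OF subfieldE(1)[OF N]] and O = val_ring_vle[OF val]
  show ?thesis
  proof (rule F.subringI)
    show "val_ring F G v N \<subseteq> carrier F" using s(1) unfolding O by blast
    show "\<one>\<^bsub>F\<^esub> \<in> val_ring F G v N" using s(3) P.le_refl unfolding O by simp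
    fix x assume x: "x \<in> val_ring F G v N"
    then show "\<ominus>\<^bsub>F\<^esub> x \<in> val_ring F G v N" using s(1) s(5)[of x] P.le_minus[of "\<one>\<^bsub>F\<^esub>" x] unfolding O by auto
    fix y assume y: "y \<in> val_ring F G v N"
    show "x \<oplus>\<^bsub>F\<^esub> y \<in> val_ring F G v N" using x y s(1) s(7)[of x y] P.le_add[of "\<one>\<^bsub>F\<^esub>" x y] unfolding O by auto
    show "x \<otimes>\<^bsub>F\<^esub> y \<in> val_ring F G v N" using x y s(1) s(6) P.le_mult[of "\<one>\<^bsub>F\<^esub>" x "\<one>\<^bsub>F\<^esub>" y] unfolding O by auto
  qed
qed

text \<open>The reduction map \<open>h\<close> commutes with linear combinations, and coefficients
  in the residue subfield lift to the valuation ring of \<open>M\<close>. The two halves of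
  \<open>res_basis\<close> thus become independence and generation for the images of
  \<open>Us\<close>.\<close>

lemma inertia_degree_res_basis:
  assumes val: "valuation F G v" and N: "subfield N F" and M: "subfield M F" "M \<subseteq> N"
    and U: "preval.res_basis F (vle F G v) N M Us"
  shows "inertia_degree F G v N M = length Us"
proof -
  interpret F: field F by (rule valuation.axioms(1)) fact
  interpret V: valuation F G v by fact
  interpret P: preval F "vle F G v" by (rule valuation_preval) fact
  let ?O = "val_ring F G v" and ?I = "val_ideal F G v N"
  have NF: "N \<subseteq> carrier F" "M \<subseteq> carrier F" using P.MR N M by blast+
  have O: "?O S = {x \<in> S. vle F G v \<one>\<^bsub>F\<^esub> x}" for S using val_ring_vle[OF val] .
  have I: "?I = {x \<in> N. P.lt \<one>\<^bsub>F\<^esub> x}" using val_ideal_vle[OF val NF(1)] .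
  note subO = val_ring_subring[OF val]
  let ?A = "F\<lparr>carrier := ?O N\<rparr>"
  have ringA: "ring ?A" using F.subring_is_ring[OF subO[OF N]] .
  have cringA: "cring ?A" using F.subcring_iff[of "?O N"] F.subcringI'[OF subO[OF N]] subringE(1)[OF subO[OF N]] by blast
  interpret A: cring ?A by (rule cringA)
  have IO: "?I \<subseteq> ?O N" unfolding I O using P.lt_imp_le[of "\<one>\<^bsub>F\<^esub>"] NF by auto
  have Iideal: "ideal ?I ?A"
  proof (rule idealI[OF ringA])
    have neg: "\<ominus>\<^bsub>?A\<^esub> x = \<ominus>\<^bsub>F\<^esub> x" if "x \<in> ?O N" for x
      using that subringE(5)[OF subO[OF N] that] subringE(1)[OF subO[OF N]] A.minus_equality[of "\<ominus>\<^bsub>F\<^esub> x" x] F.l_neg[of x] by auto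
    show "subgroup ?I (add_monoid ?A)"
    proof (rule A.add.subgroupI)
      show "?I \<subseteq> carrier ?A" using IO by simp
      show "?I \<noteq> {}" unfolding I using P.lt_zero[of "\<one>\<^bsub>F\<^esub>"] subringE(2)[OF subfieldE(1)[OF N]] by auto
      fix a assume a: "a \<in> ?I"
      have "\<ominus>\<^bsub>F\<^esub> a \<in> ?I" using a P.lt_minus NF subringE(5)[OF subfieldE(1)[OF N]] unfolding I by auto
      then show "\<ominus>\<^bsub>?A\<^esub> a \<in> ?I" using neg[of a] a IO by auto
      fix b assume b: "b \<in> ?I"
      show "a \<oplus>\<^bsub>?A\<^esub> b \<in> ?I" using a b P.lt_add NF subringE(7)[OF subfieldE(1)[OF N]] unfolding I by auto
    qed
    fix a x assume a: "a \<in> ?I" and x: "x \<in> carrier ?A"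
    have "P.lt (\<one>\<^bsub>F\<^esub> \<otimes>\<^bsub>F\<^esub> \<one>\<^bsub>F\<^esub>) (a \<otimes>\<^bsub>F\<^esub> x)" using a x NF unfolding I O by (intro P.lt_mult) auto
    then have "a \<otimes>\<^bsub>F\<^esub> x \<in> ?I" using a x subringE(6)[OF subfieldE(1)[OF N]] unfolding I O by auto
    moreover have "x \<otimes>\<^bsub>F\<^esub> a = a \<otimes>\<^bsub>F\<^esub> x" using F.m_comm a x NF unfolding I O by auto
    ultimately show "x \<otimes>\<^bsub>?A\<^esub> a \<in> ?I" "a \<otimes>\<^bsub>?A\<^esub> x \<in> ?I" by auto
  qed
  interpret I: ideal ?I ?A by (rule Iideal)
  define Q where "Q = ?A Quot ?I"
  have Qres: "residue_field F G v N = Q" unfolding residue_field_def Q_def ..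
  define h where "h x = ?I +>\<^bsub>?A\<^esub> x" for x
  have hom: "ring_hom_ring ?A Q h" using I.rcos_ring_hom_ring unfolding Q_def h_def .
  have cringQ: "cring Q" unfolding Q_def using I.quotient_is_cring[OF cringA] .
  interpret Q: cring Q by (rule cringQ)
  interpret H: ring_hom_ring ?A Q h by (rule hom)
  have cQ: "carrier Q = h ` ?O N" unfolding Q_def h_def FactRing_def A_RCOSETS_def' by auto
  have zQ: "\<zero>\<^bsub>Q\<^esub> = ?I" unfolding Q_def FactRing_def by simp
  have h0: "h x = \<zero>\<^bsub>Q\<^esub> \<longleftrightarrow> x \<in> ?I" if "x \<in> ?O N" for x
  proof
    show "h x = \<zero>\<^bsub>Q\<^esub> \<Longrightarrow> x \<in> ?I" using I.rcos_const_imp_mem[of x] that unfolding zQ h_def by simp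
    show "x \<in> ?I \<Longrightarrow> h x = \<zero>\<^bsub>Q\<^esub>" using I.a_rcos_const[of x] unfolding zQ h_def by simp
  qed
  have inv: "inv\<^bsub>F\<^esub> x \<in> ?O S \<and> h x \<otimes>\<^bsub>Q\<^esub> h (inv\<^bsub>F\<^esub> x) = \<one>\<^bsub>Q\<^esub>"
    if x: "x \<in> ?O S" "h x \<noteq> \<zero>\<^bsub>Q\<^esub>" and S: "subfield S F" "S \<subseteq> N" for x S
  proof -
    have xN: "x \<in> ?O N" "x \<in> S" using x(1) S(2) unfolding O by auto
    then have "x \<notin> ?I" using h0 x(2) by blast
    then have "\<not> P.lt \<one>\<^bsub>F\<^esub> x" using xN S(2) unfolding I by blast
    then have le: "vle F G v x \<one>\<^bsub>F\<^esub>" unfolding P.lt_def by blast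
    have xc: "x \<in> carrier F" "x \<noteq> \<zero>\<^bsub>F\<^esub>" using xN NF P.zero_le[of "\<one>\<^bsub>F\<^esub>"] le unfolding O by auto
    note i = P.inv_props[OF xc]
    have "vle F G v (x \<otimes>\<^bsub>F\<^esub> inv\<^bsub>F\<^esub> x) (\<one>\<^bsub>F\<^esub> \<otimes>\<^bsub>F\<^esub> inv\<^bsub>F\<^esub> x)" using P.le_mult_right[OF le xc(1) _ i(1)] by simp
    then have "vle F G v \<one>\<^bsub>F\<^esub> (inv\<^bsub>F\<^esub> x)" using i by simp
    moreover have "inv\<^bsub>F\<^esub> x \<in> S" using F.subfield_m_inv(1)[OF S(1), of x] xN xc by blast
    ultimately have iS: "inv\<^bsub>F\<^esub> x \<in> ?O S" unfolding O by blast
    then have "inv\<^bsub>F\<^esub> x \<in> ?O N" using S(2) unfolding O by blast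
    then have "h x \<otimes>\<^bsub>Q\<^esub> h (inv\<^bsub>F\<^esub> x) = h (x \<otimes>\<^bsub>F\<^esub> inv\<^bsub>F\<^esub> x)" using H.hom_mult[of x "inv\<^bsub>F\<^esub> x"] xN by simp
    then show ?thesis using i iS H.hom_one by simp
  qed
  have one: "\<one>\<^bsub>Q\<^esub> \<noteq> \<zero>\<^bsub>Q\<^esub>"
    using h0[of "\<one>\<^bsub>F\<^esub>"] H.hom_one subringE(3)[OF subO[OF N]] P.lt_irrefl[of "\<one>\<^bsub>F\<^esub>"] unfolding I by auto
  have "field Q"
  proof (rule Q.cring_fieldI2)
    show "\<zero>\<^bsub>Q\<^esub> \<noteq> \<one>\<^bsub>Q\<^esub>" using one by simp
    fix a assume a: "a \<in> carrier Q" "a \<noteq> \<zero>\<^bsub>Q\<^esub>"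
    then obtain x where x: "x \<in> ?O N" "a = h x" unfolding cQ by blast
    then show "\<exists>b\<in>carrier Q. a \<otimes>\<^bsub>Q\<^esub> b = \<one>\<^bsub>Q\<^esub>" using inv[OF x(1) _ N] a(2) unfolding cQ by blast
  qed
  then interpret Q: field Q .
  let ?K = "h ` ?O M"
  have Kres: "residue_subfield F G v N M = ?K" unfolding residue_subfield_def h_def ..
  have OM: "?O M \<subseteq> ?O N" using M(2) unfolding O by blast
  have "subring (?O M) ?A"
    using A.ring_incl_imp_subring[of "?O M"] F.subring_is_ring[OF subO[OF M(1)]] OM by simp
  then have sr: "subring ?K Q" by (rule H.img_is_subring)
  have sf: "subfield ?K Q"
  proof (rule Q.subfieldI'[OF sr])
    fix k assume k: "k \<in> ?K - {\<zero>\<^bsub>Q\<^esub>}"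
    then obtain x where x: "x \<in> ?O M" "k = h x" by blast
    then have i: "inv\<^bsub>F\<^esub> x \<in> ?O M" "h x \<otimes>\<^bsub>Q\<^esub> h (inv\<^bsub>F\<^esub> x) = \<one>\<^bsub>Q\<^esub>" using inv[OF x(1) _ M] k by auto
    have "inv\<^bsub>Q\<^esub> k = h (inv\<^bsub>F\<^esub> x)" unfolding x(2) using i x OM cQ by (intro Q.comm_inv_char) auto
    then show "inv\<^bsub>Q\<^esub> k \<in> ?K" using i by blast
  qed
  have Ui: "P.res_indep M Us" "set Us \<subseteq> N" using U unfolding P.res_basis_def by auto
  have UO: "set Us \<subseteq> ?O N" using Ui unfolding P.res_indep_def O by blast
  have comb: "Q.combine (map h ks) (map h Us) = h (F.combine ks Us)" "F.combine ks Us \<in> ?O N" if "set ks \<subseteq> ?O M" for ks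
  proof -
    have ks: "set ks \<subseteq> ?O N" using that OM by blast
    show "Q.combine (map h ks) (map h Us) = h (F.combine ks Us)"
      using H.combine_hom[of ks Us] ks UO F.combine_consistent[OF ringA] by simp
    show "F.combine ks Us \<in> ?O N" using P.combine_subring[OF subO[OF N] ks UO] .
  qed
  have lists: "\<exists>ks. set ks \<subseteq> ?O M \<and> Ks = map h ks" if "set Ks \<subseteq> ?K" for Ks
  proof -
    have "Ks \<in> lists ?K" using that by auto
    then show ?thesis unfolding lists_image by auto
  qed
  have Uc: "set (map h Us) \<subseteq> carrier Q" using UO cQ by auto
  have ind: "Q.independent ?K (map h Us)"
  proof (rule ccontr)
    assume d: "Q.dependent ?K (map h Us)"
    obtain Ks where Ks: "length Ks = length (map h Us)" "Q.combine Ks (map h Us) = \<zero>\<^bsub>Q\<^esub>" "set Ks \<subseteq> ?K" "set Ks \<noteq> {\<zero>\<^bsub>Q\<^esub>}"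
      using Q.dependent_imp_non_trivial_combine[OF sf Uc d] .
    obtain ks where ks: "set ks \<subseteq> ?O M" "Ks = map h ks" using lists[OF Ks(3)] by blast
    have "F.combine ks Us \<in> ?I" using Ks(2) comb[OF ks(1)] h0 ks(2) by simp
    then have l: "P.lt \<one>\<^bsub>F\<^esub> (F.combine ks Us)" unfolding I by blast
    have "k \<in> ?I" if "k \<in> set ks" for k
      using P.res_indepD[OF Ui(1) _ _ _ l that] ks Ks(1) that M(2) unfolding O I by auto
    then have "h k = \<zero>\<^bsub>Q\<^esub>" if "k \<in> set ks" for k using h0 that IO by blast
    then have "set Ks \<subseteq> {\<zero>\<^bsub>Q\<^esub>}" using ks(2) by auto
    moreover have "Ks \<noteq> []" using d Ks(1) by auto
    ultimately show False using Ks(4) by (metis set_empty subset_singletonD)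
  qed
  have "Q.Span ?K (map h Us) = carrier Q"
  proof
    show "Q.Span ?K (map h Us) \<subseteq> carrier Q" using Q.Span_in_carrier[OF subringE(1)[OF sr] Uc] .
    show "carrier Q \<subseteq> Q.Span ?K (map h Us)"
    proof
      fix a assume "a \<in> carrier Q"
      then obtain x where x: "x \<in> ?O N" "a = h x" unfolding cQ by blast
      then obtain ks where ks: "set ks \<subseteq> M" "length ks = length Us" "\<forall>k\<in>set ks. vle F G v \<one>\<^bsub>F\<^esub> k"
        "P.lt \<one>\<^bsub>F\<^esub> (x \<ominus>\<^bsub>F\<^esub> F.combine ks Us)" using U unfolding P.res_basis_def O by blast
      have kO: "set ks \<subseteq> ?O M" using ks unfolding O by blast
      let ?c = "F.combine ks Us"
      have c: "?c \<in> ?O N" using comb(2)[OF kO] .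
      have d: "x \<ominus>\<^bsub>F\<^esub> ?c \<in> ?O N" using x c subringE(5,7)[OF subO[OF N]] unfolding a_minus_def by blast
      then have "x \<ominus>\<^bsub>F\<^esub> ?c \<in> ?I" using ks(4) unfolding I O by blast
      then have "h (x \<ominus>\<^bsub>F\<^esub> ?c) = \<zero>\<^bsub>Q\<^esub>" using h0[OF d] by blast
      moreover have "x = (x \<ominus>\<^bsub>F\<^esub> ?c) \<oplus>\<^bsub>F\<^esub> ?c"
        using x c NF unfolding O by (simp add: a_minus_def F.a_assoc F.l_neg subset_iff)
      ultimately have "h x = \<zero>\<^bsub>Q\<^esub> \<oplus>\<^bsub>Q\<^esub> h ?c" using H.hom_add[of "x \<ominus>\<^bsub>F\<^esub> ?c" ?c] d c by simp
      then have "a = Q.combine (map h ks) (map h Us)" using x(2) comb(1)[OF kO] c H.hom_closed[of ?c] by simp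
      then show "a \<in> Q.Span ?K (map h Us)"
        unfolding Q.Span_eq_combine_set[OF sf Uc] using image_mono[OF kO, of h]
        by (intro CollectI exI[of _ "map h ks"]) simp
    qed
  qed
  then have "Q.dimension (length (map h Us)) ?K (carrier Q)" using Q.dimensionI[OF sf ind] by simp
  then have "(Q.dim over ?K) (carrier Q) = length Us" using Q.dimI[OF sf] by simp
  then show ?thesis unfolding inertia_degree_def Qres Kres over_def .
qed

lemma initial_index_card:
  assumes val: "valuation F G v" and N: "N \<subseteq> carrier F" "M \<subseteq> carrier F"
  shows "initial_index F G v N M = card (v ` preval.initial F (vle F G v) N M)"
proof -
  interpret F: field F by (rule valuation.axioms(1)) fact
  interpret V: valuation F G v by fact
  interpret P: preval F "vle F G v" by (rule valuation_preval) fact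
  have "{c \<in> value_group F v N. \<one>\<^bsub>G\<^esub> \<preceq>\<^bsub>G\<^esub> c \<and> (\<forall>d\<in>value_group F v M. \<one>\<^bsub>G\<^esub> \<prec>\<^bsub>G\<^esub> d \<longrightarrow> c \<prec>\<^bsub>G\<^esub> d)}
    = v ` P.initial N M" (is "?L = ?R")
  proof -
    have 1: "\<one>\<^bsub>F\<^esub> \<in> carrier F - {\<zero>\<^bsub>F\<^esub>}" by simp
    have "(\<one>\<^bsub>G\<^esub> \<preceq>\<^bsub>G\<^esub> v x \<and> (\<forall>d\<in>value_group F v M. \<one>\<^bsub>G\<^esub> \<prec>\<^bsub>G\<^esub> d \<longrightarrow> v x \<prec>\<^bsub>G\<^esub> d)) \<longleftrightarrow> x \<in> P.initial N M"
      if x: "x \<in> N - {\<zero>\<^bsub>F\<^esub>}" for x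
    proof -
      have xc: "x \<in> carrier F - {\<zero>\<^bsub>F\<^esub>}" using x N by blast
      have "\<one>\<^bsub>G\<^esub> \<preceq>\<^bsub>G\<^esub> v x \<longleftrightarrow> vle F G v \<one>\<^bsub>F\<^esub> x" unfolding vle_def valuation_one[OF val] using x by auto
      moreover have "\<one>\<^bsub>G\<^esub> \<prec>\<^bsub>G\<^esub> v m \<longleftrightarrow> P.lt \<one>\<^bsub>F\<^esub> m" "v x \<prec>\<^bsub>G\<^esub> v m \<longleftrightarrow> P.lt x m" if "m \<in> M - {\<zero>\<^bsub>F\<^esub>}" for m
        using vle_lt[OF val 1, of m] vle_lt[OF val xc, of m] that N valuation_one[OF val] by auto
      ultimately show ?thesis unfolding P.initial_def value_group_def using x by auto
    qed
    then show ?thesis unfolding value_group_def[of F v N] P.initial_def by blast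
  qed
  then show ?thesis unfolding initial_index_def initial_index_group_def by simp
qed

subsection \<open>Reduction to the separable closure\<close>

text \<open>Take the least positive multiple that kills \<open>\<one>\<close>. In a domain a
  factorization of it would kill \<open>\<one>\<close> by one of the factors already.\<close>

lemma (in domain) minimal_char_prime:
  assumes "(n::nat) > 0" "add_pow R n \<one> = \<zero>"
  shows "\<exists>p. normalization_semidom_class.prime p \<and> add_pow R (p::nat) \<one> = \<zero>"
proof -
  define p where "p = (LEAST n. n > 0 \<and> add_pow R (n::nat) \<one> = \<zero>)"
  have p: "p > 0" "add_pow R p \<one> = \<zero>"
    using LeastI[of "\<lambda>n. n > 0 \<and> add_pow R (n::nat) \<one> = \<zero>" n] assms unfolding p_def by auto
  have min: "p \<le> m" if "m > 0" "add_pow R m \<one> = \<zero>" for m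
    unfolding p_def using that by (intro Least_le) blast
  have "p \<noteq> 1" using p(2) by (auto simp: add_pow_def)
  moreover have "m = 1 \<or> m = p" if md: "m dvd p" for m
  proof -
    obtain k where k: "p = m * k" using md by (auto simp: dvd_def)
    have "add_pow R m \<one> \<otimes> add_pow R k \<one> = add_pow R p \<one>"
      unfolding k by (simp add: add_pow_ldistr add_pow_rdistr add.nat_pow_pow mult.commute)
    then have "add_pow R m \<one> = \<zero> \<or> add_pow R k \<one> = \<zero>" using p(2) by (simp add: integral_iff)
    moreover have "m > 0" "k > 0" using k p(1) by (auto intro: Nat.gr0I)
    ultimately have "p \<le> m \<or> p \<le> k" using min by blast
    then show ?thesis using k \<open>m > 0\<close> \<open>k > 0\<close> p(1) by (auto simp: le_antisym dest: dvd_imp_le)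
  qed
  ultimately have "normalization_semidom_class.prime p" using p(1) by (simp add: prime_nat_iff)
  then show ?thesis using p(2) by blast
qed

section \<open>Changing the base field in a tower\<close>

lemma (in ring) Span_mono_field:
  assumes "subfield M R" "subfield M' R" "M \<subseteq> M'" "set Us \<subseteq> carrier R"
  shows "Span M Us \<subseteq> Span M' Us"
  using Span_eq_combine_set[OF assms(1,4)] Span_eq_combine_set[OF assms(2,4)] assms(3) by blast

lemma (in ring) independent_mono_field:
  assumes "subfield M R" "subfield M' R" "M \<subseteq> M'" "independent M' Us"
  shows "independent M Us"
  using assms(4)
proof (induct Us rule: list.induct)
  case (Cons u Us)
  note i = independent_backwards[OF Cons(2)]
  show ?case
    using i Cons(1) Span_mono_field[OF assms(1-3) independent_in_carrier[OF i(2)]] by (intro li_Cons) auto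
qed simp

lemma (in ring) finite_dimension_upper:
  assumes M: "subfield M R" "subfield E R" "M \<subseteq> E" and N: "subfield N R" "E \<subseteq> N" "finite_dimension M N"
  shows "finite_dimension E N"
proof -
  obtain Us where Us: "set Us \<subseteq> carrier R" "Span M Us = N"
    using exists_base[OF M(1) finite_dimensionE[OF M(1) N(3)]] by blast
  have UN: "set Us \<subseteq> N" using Span_base_incl[OF M(1) Us(1)] Us(2) by blast
  have "subalgebra E N R"
    using subringE(1,2,5-7)[OF subfieldE(1)[OF N(1)]] N(2) by (intro subalgebraI[OF M(2)]) auto
  then have "Span E Us \<subseteq> N" using subalgebra_Span_incl[OF M(2) _ UN] by blast
  then have "Span E Us = N" using Span_mono_field[OF M Us(1)] Us(2) by blast
  then show ?thesis using Span_finite_dimension[OF M(2) Us(1)] by simp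
qed

lemma (in ring) finite_dimension_lower:
  assumes M: "subfield M R" and E: "subfield E R" "M \<subseteq> E" "E \<subseteq> N" and N: "finite_dimension M N"
  shows "finite_dimension M E"
proof (rule subalbegra_incl_imp_finite_dimension[OF M N _ E(3)])
  show "subalgebra M E R"
    using subringE(1,2,5-7)[OF subfieldE(1)[OF E(1)]] E(2) by (intro subalgebraI[OF M]) auto
qed

text \<open>The closure is given over the upper field, while conjugates over the lower one are
  needed. An element generates a finite extension of \<open>K\<close>, which is finite over
  \<open>M\<close> as well, so the element is algebraic over \<open>M\<close>.\<close>

lemma (in algebraic_closure) lower_algebraic_closure:
  assumes M: "subfield M L" "M \<subseteq> K" "finite_dimension M K"
  shows "algebraic_closure L M"
proof -
  note KL' = subfield_axioms
  interpret M: subfield M L by (rule M(1))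
  show ?thesis
  proof
    fix x assume x: "x \<in> carrier L"
    have sub: "subring (simple_extension K x) L" using simple_extension_is_subring[OF Ksub x] .
    have "finite_dimension K (simple_extension K x)"
      using finite_dimension_simple_extension[OF KL' x] alg[OF x] by blast
    then have "finite_dimension M (simple_extension K x)"
      using telescopic_base_dim(1)[OF M(1) KL' M(3)] by blast
    then show "(algebraic over M) x"
      using finite_dimension_imp_algebraic[OF M(1) sub] simple_extension_mem[OF Ksub x] by blast
  next
    fix P assume "P \<in> carrier (M[X])"
    then show "splitted P"
      using roots_over_carrier carrier_polynomial_shell[OF subfieldE(1)[OF M(1)]] by blast
  qed
qed

text \<open>Linear disjointness of purely inseparable and separable elements. The automorphisms over
  \<open>K\<close> fix \<open>Us\<close>, so they fix the unique separable coefficients of a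
  relation; these then lie in \<open>K\<close>, which contradicts independence over
  \<open>K\<close>.\<close>

lemma (in char_p_closure) pure_independent:
  assumes "independent K Us" "\<And>u. u \<in> set Us \<Longrightarrow> \<exists>n. u [^] (p ^ n) \<in> K"
  shows "independent {x. sep K x} Us"
  using assms
proof (induct Us rule: list.induct)
  case (Cons u Us)
  let ?S = "{x. sep K x}"
  note i = independent_backwards[OF Cons(2)]
  have c: "set Us \<subseteq> carrier L" using independent_in_carrier[OF i(2)] .
  have ind: "independent ?S Us" using Cons i by auto
  have "u \<notin> Span ?S Us"
  proof
    assume u: "u \<in> Span ?S Us"
    from unique_decomposition[OF sep_subfield ind this]
    obtain ks where ks: "set ks \<subseteq> ?S" "length ks = length Us" "u = combine ks Us"
      and uniq: "\<And>ls. set ls \<subseteq> ?S \<Longrightarrow> length ls = length Us \<Longrightarrow> u = combine ls Us \<Longrightarrow> ls = ks" by blast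
    have kc: "set ks \<subseteq> carrier L" using ks(1) sep_carrier by blast
    have "k \<in> K" if k: "k \<in> set ks" for k
    proof (rule sep_fixed)
      show "sep K k" using k ks(1) by blast
      fix \<tau> assume t: "\<tau> \<in> auts"
      interpret H: ring_hom_ring L L \<tau> using aut_hom[OF t] .
      have fx: "\<tau> w = w" if "w \<in> set (u # Us)" for w
        using pure_fixed[OF _ _ t] Cons(3)[OF that] that c i(3) by auto
      have "map \<tau> Us = Us" using fx by (intro map_idI) auto
      then have u1: "u = combine (map \<tau> ks) Us" using H.combine_hom[OF kc c] ks(3) fx[of u] by simp
      have u2: "set (map \<tau> ks) \<subseteq> ?S" using ks(1) sep_aut[OF t] by auto
      have "map \<tau> ks = ks" using uniq[OF u2 _ u1] ks(2) by simp
      then show "\<tau> k = k" using k by (metis in_set_conv_nth nth_map)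
    qed
    then have "set ks \<subseteq> K" by blast
    then have "u \<in> Span K Us" using Span_eq_combine_set[OF subfield_axioms c] ks(3) by blast
    then show False using i(1) by blast
  qed
  then show ?case using ind i(3) by (intro li_Cons)
qed simp

lemma only_extension_mono:
  "only_extension F G v E \<Longrightarrow> E \<subseteq> E' \<Longrightarrow> only_extension F G v E'"
  unfolding only_extension_def by blast

lemma valuation_subfield:
  assumes val: "valuation F G v" and E: "subfield E F"
  shows "valuation (F\<lparr>carrier := E\<rparr>) G v"
proof -
  interpret F: field F by (rule valuation.axioms(1)) fact
  interpret O: ordered_abelian_group G by (rule valuation.axioms(2)) fact
  interpret V: valuation F G v by fact
  interpret E: field "F\<lparr>carrier := E\<rparr>" using F.subfield_iff(2)[OF E] .
  have EF: "E \<subseteq> carrier F" using subfieldE(3)[OF E] .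
  show ?thesis
    by unfold_locales (use EF V.val_closed V.val_mult V.val_add in \<open>auto simp: subset_iff\<close>)
qed

lemma (in field) inv_in_subring:
  assumes S: "subring S R" and s: "s \<in> Units (R\<lparr>carrier := S\<rparr>)"
  shows "s \<in> S" "inv s \<in> S" "s \<otimes> inv s = \<one>" "inv\<^bsub>R\<lparr>carrier := S\<rparr>\<^esub> s = inv s" "s \<in> carrier R" "inv s \<in> carrier R"
proof -
  have SR: "S \<subseteq> carrier R" using subringE(1)[OF S] .
  interpret B: ring "R\<lparr>carrier := S\<rparr>" using subring_is_ring[OF S] .
  obtain t where t: "s \<in> S" "t \<in> S" "s \<otimes> t = \<one>" "t \<otimes> s = \<one>" using s unfolding Units_def by auto
  have st: "s \<in> carrier R" "t \<in> carrier R" using t SR by auto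
  have inv: "inv s = t" using st t by (intro comm_inv_char) auto
  have "inv\<^bsub>R\<lparr>carrier := S\<rparr>\<^esub> s = t" using B.inv_char[of s t] t by simp
  then show "s \<in> S" "inv s \<in> S" "s \<otimes> inv s = \<one>" "inv\<^bsub>R\<lparr>carrier := S\<rparr>\<^esub> s = inv s" "s \<in> carrier R" "inv s \<in> carrier R"
    using t inv st by auto
qed

text \<open>The denominators are kept and the module generators are added to the ring generators.
  Elements of \<open>S\<close> remain units in the larger ring.\<close>

lemma essentially_finitely_generated_finite:
  assumes F: "field F" and B: "subring B F" and B': "subring B' F" "B \<subseteq> B'" and A: "A \<subseteq> B"
    and efg: "essentially_finitely_generated (F\<lparr>carrier := B\<rparr>) A"
    and P: "set P \<subseteq> B'" "\<And>x. x \<in> B' \<Longrightarrow> \<exists>ks. set ks \<subseteq> B \<and> x = ring.combine F ks P"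
  shows "essentially_finitely_generated (F\<lparr>carrier := B'\<rparr>) A"
proof -
  interpret field F by fact
  have BF: "B \<subseteq> carrier F" "B' \<subseteq> carrier F" using subringE(1) B B' by blast+
  obtain T S where T: "finite T" "T \<subseteq> B" and S: "submonoid S (F\<lparr>carrier := B\<rparr>)"
    "S \<subseteq> generate_ring (F\<lparr>carrier := B\<rparr>) (A \<union> T)" "S \<subseteq> Units (F\<lparr>carrier := B\<rparr>)"
    and eq: "B = {a \<otimes>\<^bsub>F\<^esub> inv\<^bsub>F\<lparr>carrier := B\<rparr>\<^esub> s | a s. a \<in> generate_ring (F\<lparr>carrier := B\<rparr>) (A \<union> T) \<and> s \<in> S}"
    using efg unfolding essentially_finitely_generated_def by auto
  note sB = inv_in_subring[OF B subsetD[OF S(3)]]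
  have AT: "A \<union> T \<subseteq> B" using A T by blast
  have gB: "generate_ring (F\<lparr>carrier := B\<rparr>) (A \<union> T) = generate_ring F (A \<union> T)"
    using subring_gen_equality[OF B AT] by simp
  let ?T = "T \<union> set P"
  let ?R = "generate_ring F (A \<union> ?T)"
  have AT': "A \<union> ?T \<subseteq> B'" "A \<union> ?T \<subseteq> carrier F" using AT B' P(1) BF by blast+
  have gB': "generate_ring (F\<lparr>carrier := B'\<rparr>) (A \<union> ?T) = ?R"
    using subring_gen_equality[OF B'(1) AT'(1)] by simp
  have R: "subring ?R F" using generate_ring_is_subring[OF AT'(2)] .
  have RF: "?R \<subseteq> carrier F" using subringE(1)[OF R] .
  have RB': "?R \<subseteq> B'" using generate_ring_min_subring1[OF AT'(2) B'(1) AT'(1)] .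
  have gR: "generate_ring F (A \<union> T) \<subseteq> ?R" using AT'(2) by (intro mono_generate_ring) auto
  have SR: "S \<subseteq> ?R" using S(2) gB gR by blast
  have S1: "\<one>\<^bsub>F\<^esub> \<in> S" "\<And>s t. s \<in> S \<Longrightarrow> t \<in> S \<Longrightarrow> s \<otimes>\<^bsub>F\<^esub> t \<in> S"
    using submonoid.one_closed[OF S(1)] submonoid.m_closed[OF S(1)] by auto
  have U': "s \<in> Units (F\<lparr>carrier := B'\<rparr>)" if "s \<in> S" for s
    using sB[OF that] B'(2) m_comm[of s "inv\<^bsub>F\<^esub> s"] unfolding Units_def by auto
  have inv': "inv\<^bsub>F\<lparr>carrier := B'\<rparr>\<^esub> s = inv\<^bsub>F\<^esub> s" if "s \<in> S" for s
    using inv_in_subring(4)[OF B'(1) U'[OF that]] .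
  \<comment> \<open>\<open>Q\<close> is the localization to be compared with \<open>B'\<close>. It
    is closed under sums and products and contains \<open>B\<close> and the generators, hence every
    combination of them.\<close>
  define Q where "Q = {a \<otimes>\<^bsub>F\<^esub> inv\<^bsub>F\<^esub> s | a s. a \<in> ?R \<and> s \<in> S}"
  have QI: "a \<otimes>\<^bsub>F\<^esub> inv\<^bsub>F\<^esub> s \<in> Q" if "a \<in> ?R" "s \<in> S" for a s using that unfolding Q_def by blast
  have invm: "inv\<^bsub>F\<^esub> (s \<otimes>\<^bsub>F\<^esub> t) = inv\<^bsub>F\<^esub> s \<otimes>\<^bsub>F\<^esub> inv\<^bsub>F\<^esub> t" if "s \<in> S" "t \<in> S" for s t
  proof (rule comm_inv_char)
    note s = sB[OF that(1)] and t = sB[OF that(2)]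
    have "(s \<otimes>\<^bsub>F\<^esub> t) \<otimes>\<^bsub>F\<^esub> (inv\<^bsub>F\<^esub> s \<otimes>\<^bsub>F\<^esub> inv\<^bsub>F\<^esub> t) = (s \<otimes>\<^bsub>F\<^esub> inv\<^bsub>F\<^esub> s) \<otimes>\<^bsub>F\<^esub> (t \<otimes>\<^bsub>F\<^esub> inv\<^bsub>F\<^esub> t)"
      using s(5,6) t(5,6) by (simp add: m_ac)
    then show "(s \<otimes>\<^bsub>F\<^esub> t) \<otimes>\<^bsub>F\<^esub> (inv\<^bsub>F\<^esub> s \<otimes>\<^bsub>F\<^esub> inv\<^bsub>F\<^esub> t) = \<one>\<^bsub>F\<^esub>" using s(3) t(3) by simp
  qed (use sB[OF that(1)] sB[OF that(2)] in auto)
  have Qadd: "x \<oplus>\<^bsub>F\<^esub> y \<in> Q" and Qmult: "x \<otimes>\<^bsub>F\<^esub> y \<in> Q" if xy: "x \<in> Q" "y \<in> Q" for x y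
  proof -
    obtain a s b t where x: "x = a \<otimes>\<^bsub>F\<^esub> inv\<^bsub>F\<^esub> s" "a \<in> ?R" "s \<in> S" and y: "y = b \<otimes>\<^bsub>F\<^esub> inv\<^bsub>F\<^esub> t" "b \<in> ?R" "t \<in> S"
      using xy unfolding Q_def by blast
    note s = sB[OF x(3)] and t = sB[OF y(3)]
    have ab: "a \<in> carrier F" "b \<in> carrier F" using x y RF by auto
    have a1: "a \<otimes>\<^bsub>F\<^esub> inv\<^bsub>F\<^esub> s = (a \<otimes>\<^bsub>F\<^esub> t) \<otimes>\<^bsub>F\<^esub> (inv\<^bsub>F\<^esub> s \<otimes>\<^bsub>F\<^esub> inv\<^bsub>F\<^esub> t)"
    proof -
      have "(a \<otimes>\<^bsub>F\<^esub> t) \<otimes>\<^bsub>F\<^esub> (inv\<^bsub>F\<^esub> s \<otimes>\<^bsub>F\<^esub> inv\<^bsub>F\<^esub> t) = (a \<otimes>\<^bsub>F\<^esub> inv\<^bsub>F\<^esub> s) \<otimes>\<^bsub>F\<^esub> (t \<otimes>\<^bsub>F\<^esub> inv\<^bsub>F\<^esub> t)"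
        using ab s(5,6) t(5,6) by (simp add: m_ac)
      then show ?thesis using t(3) ab s(6) by simp
    qed
    have b1: "b \<otimes>\<^bsub>F\<^esub> inv\<^bsub>F\<^esub> t = (b \<otimes>\<^bsub>F\<^esub> s) \<otimes>\<^bsub>F\<^esub> (inv\<^bsub>F\<^esub> s \<otimes>\<^bsub>F\<^esub> inv\<^bsub>F\<^esub> t)"
    proof -
      have "(b \<otimes>\<^bsub>F\<^esub> s) \<otimes>\<^bsub>F\<^esub> (inv\<^bsub>F\<^esub> s \<otimes>\<^bsub>F\<^esub> inv\<^bsub>F\<^esub> t) = (b \<otimes>\<^bsub>F\<^esub> inv\<^bsub>F\<^esub> t) \<otimes>\<^bsub>F\<^esub> (s \<otimes>\<^bsub>F\<^esub> inv\<^bsub>F\<^esub> s)"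
        using ab s(5,6) t(5,6) by (simp add: m_ac)
      then show ?thesis using s(3) ab t(6) by simp
    qed
    have "x \<oplus>\<^bsub>F\<^esub> y = (a \<otimes>\<^bsub>F\<^esub> t \<oplus>\<^bsub>F\<^esub> b \<otimes>\<^bsub>F\<^esub> s) \<otimes>\<^bsub>F\<^esub> (inv\<^bsub>F\<^esub> s \<otimes>\<^bsub>F\<^esub> inv\<^bsub>F\<^esub> t)"
      unfolding x(1) y(1) using a1 b1 ab s(5,6) t(5,6) by (simp add: l_distr)
    moreover have "a \<otimes>\<^bsub>F\<^esub> t \<oplus>\<^bsub>F\<^esub> b \<otimes>\<^bsub>F\<^esub> s \<in> ?R" using subringE(7)[OF R subringE(6)[OF R x(2) subsetD[OF SR y(3)]] subringE(6)[OF R y(2) subsetD[OF SR x(3)]]] .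
    ultimately show "x \<oplus>\<^bsub>F\<^esub> y \<in> Q" using QI[OF _ S1(2)[OF x(3) y(3)]] invm[OF x(3) y(3)] by metis
    have "x \<otimes>\<^bsub>F\<^esub> y = (a \<otimes>\<^bsub>F\<^esub> b) \<otimes>\<^bsub>F\<^esub> (inv\<^bsub>F\<^esub> s \<otimes>\<^bsub>F\<^esub> inv\<^bsub>F\<^esub> t)"
      unfolding x(1) y(1) using ab s(6) t(6) by (simp add: m_ac)
    moreover have "a \<otimes>\<^bsub>F\<^esub> b \<in> ?R" using x y subringE(6)[OF R] by blast
    ultimately show "x \<otimes>\<^bsub>F\<^esub> y \<in> Q" using QI[OF _ S1(2)[OF x(3) y(3)]] invm[OF x(3) y(3)] by metis
  qed
  have RQ: "?R \<subseteq> Q"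
  proof
    fix a assume a: "a \<in> ?R"
    then have "a \<otimes>\<^bsub>F\<^esub> inv\<^bsub>F\<^esub> \<one>\<^bsub>F\<^esub> = a" using RF by auto
    then show "a \<in> Q" using QI[OF a S1(1)] by simp
  qed
  have BQ: "B \<subseteq> Q"
  proof
    fix b assume "b \<in> B"
    then obtain a s where "b = a \<otimes>\<^bsub>F\<^esub> inv\<^bsub>F\<lparr>carrier := B\<rparr>\<^esub> s" "a \<in> generate_ring F (A \<union> T)" "s \<in> S"
      using eq gB by blast
    then show "b \<in> Q" using sB(4) gR QI by auto
  qed
  have PR: "set P \<subseteq> ?R" using generate_ring.incl[of _ "A \<union> ?T" F] by blast
  have zR: "\<zero>\<^bsub>F\<^esub> \<in> Q" using RQ subringE(2)[OF R] by blast
  have comb: "combine ks us \<in> Q" if "set ks \<subseteq> Q" "set us \<subseteq> Q" for ks us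
    using that by (induct ks us rule: combine.induct) (auto simp: zR intro: Qadd Qmult)
  have B'Q: "B' \<subseteq> Q"
  proof
    fix x assume "x \<in> B'"
    then obtain ks where "set ks \<subseteq> B" "x = combine ks P" using P(2) by blast
    then show "x \<in> Q" using comb[of ks P] BQ RQ PR by blast
  qed
  have QB': "Q \<subseteq> B'"
  proof
    fix x assume "x \<in> Q"
    then obtain a s where x: "x = a \<otimes>\<^bsub>F\<^esub> inv\<^bsub>F\<^esub> s" "a \<in> ?R" "s \<in> S" unfolding Q_def by blast
    then show "x \<in> B'" using RB' sB(2)[OF x(3)] B'(2) subringE(6)[OF B'(1)] by blast
  qed
  have "B' = {a \<otimes>\<^bsub>F\<^esub> inv\<^bsub>F\<lparr>carrier := B'\<rparr>\<^esub> s | a s. a \<in> ?R \<and> s \<in> S}"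
  proof -
    have "(\<exists>a s. x = a \<otimes>\<^bsub>F\<^esub> inv\<^bsub>F\<lparr>carrier := B'\<rparr>\<^esub> s \<and> a \<in> ?R \<and> s \<in> S) \<longleftrightarrow> x \<in> Q" for x
      unfolding Q_def mem_Collect_eq using inv' by metis
    then show ?thesis using B'Q QB' by blast
  qed
  moreover have "submonoid S (F\<lparr>carrier := B'\<rparr>)"
    using S1 sB(1) B'(2) by (intro submonoid.intro) auto
  moreover have "S \<subseteq> Units (F\<lparr>carrier := B'\<rparr>)" using U' by blast
  ultimately show ?thesis
    unfolding essentially_finitely_generated_def
    using T B'(2) P(1) SR gB' by (intro exI[of _ ?T] exI[of _ S]) auto
qed

text \<open>A factor from \<open>M'\<close> can be replaced by a nearby one from \<open>M\<close>
  without changing its value, so no new cosets coincide.\<close>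

lemma (in preval) val_indep_immediate:
  assumes M: "subfield M R" "subfield M' R" and imm: "\<And>x. x \<in> M' \<Longrightarrow> x \<noteq> \<zero> \<Longrightarrow> \<exists>c\<in>M. near x c"
    and Z: "val_indep M Z"
  shows "val_indep M' Z"
  unfolding val_indep_def
proof (intro conjI ballI impI)
  show Zc: "Z \<subseteq> carrier R - {\<zero>}" using Z unfolding val_indep_def by blast
  fix z z' k assume z: "z \<in> Z" "z' \<in> Z" and k: "k \<in> M' - {\<zero>}" and e: "eqv (k \<otimes> z) z'"
  obtain c where c: "c \<in> M" "near k c" using imm k by blast
  have cc: "k \<in> carrier R" "c \<in> carrier R" "z \<in> carrier R" "z' \<in> carrier R" using k c z Zc MR[OF M(1)] MR[OF M(2)] by auto
  have kc: "eqv k c" using near_eqv c cc by blast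
  then have "c \<in> M - {\<zero>}" using c eqv_zero cc k by blast
  moreover have "eqv (c \<otimes> z) z'"
    using eqv_trans[OF eqv_mult[OF eqv_sym[OF kc] eqv_refl[OF cc(3)]] e] cc by simp
  ultimately show "z = z'" using Z z unfolding val_indep_def by blast
qed

text \<open>Each integral coefficient in \<open>M'\<close> differs from one in \<open>M\<close> by
  positive value, the coefficient \<open>\<zero>\<close> being replaced by itself. The combination
  then changes only by positive value, and independence over \<open>M\<close> applies.\<close>

lemma (in preval) res_indep_immediate:
  assumes M: "subfield M R" "subfield M' R" and imm: "\<And>x. x \<in> M' \<Longrightarrow> x \<noteq> \<zero> \<Longrightarrow> \<exists>c\<in>M. near x c"
    and U: "res_indep M Us"
  shows "res_indep M' Us"
proof -
  have Uc: "set Us \<subseteq> carrier R" "\<And>u. u \<in> set Us \<Longrightarrow> le \<one> u" using U unfolding res_indep_def by auto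
  have ex: "\<exists>c. c \<in> M \<and> le \<one> c \<and> lt \<one> (k \<ominus> c)" if k: "k \<in> M'" "le \<one> k" for k
  proof (cases "k = \<zero>")
    case True
    then show ?thesis using subringE(2)[OF subfieldE(1)[OF M(1)]] le_zero[of \<one>] lt_zero[of \<one>]
      by (intro exI[of _ \<zero>]) (simp add: a_minus_def)
  next
    case False
    then obtain c where c: "c \<in> M" "near k c" using imm k by blast
    have cc: "k \<in> carrier R" "c \<in> carrier R" using k c MR[OF M(1)] MR[OF M(2)] by auto
    have "le \<one> c" using near_eqv[OF c(2) cc] le_eqv_trans[OF k(2)] cc by simp
    moreover have "lt \<one> (k \<ominus> c)" using c(2) le_lt_trans[OF k(2)] cc unfolding near_def by simp
    ultimately show ?thesis using c by blast
  qed
  define c where "c k = (SOME c. c \<in> M \<and> le \<one> c \<and> lt \<one> (k \<ominus> c))" for k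
  have c: "c k \<in> M" "le \<one> (c k)" "lt \<one> (k \<ominus> c k)" if "k \<in> M'" "le \<one> k" for k
    using someI_ex[OF ex[OF that]] unfolding c_def by auto
  show ?thesis unfolding res_indep_def
  proof (intro conjI allI impI ballI)
    fix ks k assume ks: "set ks \<subseteq> M'" "length ks = length Us" "\<forall>k\<in>set ks. le \<one> k" "lt \<one> (combine ks Us)" and k: "k \<in> set ks"
    let ?cs = "map c ks"
    have kc: "set ks \<subseteq> carrier R" and csM: "set ?cs \<subseteq> M" using ks c MR[OF M(2)] by auto
    have cc: "set ?cs \<subseteq> carrier R" using csM MR[OF M(1)] by blast
    let ?k = "combine ks Us" and ?c = "combine ?cs Us"
    have C: "?k \<in> carrier R" "?c \<in> carrier R" using combine_in_carrier kc cc Uc by blast+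
    have d: "lt \<one> (?k \<ominus> ?c)"
    proof (rule combine_diff_lt[OF ks(2) _ kc cc Uc(1)])
      fix i assume "i < length Us"
      then show "lt \<one> (ks ! i \<ominus> ?cs ! i)" using c(3)[of "ks ! i"] ks by (auto simp: subset_iff)
    qed (use ks Uc in auto)
    have "?c = ?k \<oplus> \<ominus> (?k \<ominus> ?c)"
      using C by (simp add: a_minus_def minus_add r_neg a_assoc[symmetric])
    moreover have "lt \<one> (\<ominus> (?k \<ominus> ?c))" using d lt_minus C by simp
    ultimately have "lt \<one> ?c" using lt_add[OF ks(4), of "\<ominus> (?k \<ominus> ?c)"] C by simp
    then have "lt \<one> (c k)" using res_indepD[OF U csM _ _ _ , of "c k"] ks c k by auto
    moreover have kk: "k \<in> carrier R" "c k \<in> carrier R" using k kc cc by auto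
    moreover have "lt \<one> (k \<ominus> c k)" using c(3) ks k by blast
    moreover have "k = c k \<oplus> (k \<ominus> c k)" using kk by (simp add: a_minus_def a_lcomm r_neg)
    ultimately show "lt \<one> k" using lt_add[of \<one> "c k" "k \<ominus> c k"] by simp
  qed (use Uc in auto)
qed

text \<open>Uniqueness of the extension passes to larger fields. Adjoining a basis of
  \<open>L|K\<close> to the henselization of \<open>K\<close> therefore gives a field that contains
  the henselization of \<open>L\<close>.\<close>

lemma hens_finite:
  assumes K: "algebraic_closure F K" and p: "char_p_field F p" and val: "valuation F G v"
    and L: "subfield L F" "K \<subseteq> L" "ring.finite_dimension F K L"
  shows "ring.finite_dimension F (valued_closure.hens F K p (vle F G v)) (valued_closure.hens F L p (vle F G v))"
    and "valued_closure.hens F K p (vle F G v) \<subseteq> valued_closure.hens F L p (vle F G v)"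
proof -
  interpret F: field F by (rule valuation.axioms(1)) fact
  interpret K: algebraic_closure F K by fact
  interpret char_p_field F p by fact
  interpret O: ordered_abelian_group G by (rule valuation.axioms(2)) fact
  interpret V: valuation F G v by fact
  interpret P: preval F "vle F G v" by (rule valuation_preval) fact
  interpret CK: valued_closure F K p "vle F G v" ..
  have clL: "algebraic_closure F L" using K.intermediate_algebraic_closure[OF L(1,2)] .
  interpret L: algebraic_closure F L by fact
  interpret CL: valued_closure F L p "vle F G v" ..
  note HK = henselization_hens[OF K p val] and HL = henselization_hens[OF clL p val]
  have HKs: "subfield CK.hens F" by (rule CK.hens_subfield)
  have HLs: "subfield CL.hens F" by (rule CL.hens_subfield)
  show sub: "CK.hens \<subseteq> CL.hens"
    using HK(3)[OF HLs _ HL(2)] L(2) CL.K_hens by blast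
  have Kf: "subfield K F" by (rule K.subfield_axioms)
  obtain Us where Us: "set Us \<subseteq> carrier F" "F.Span K Us = L"
    using F.exists_base[OF Kf F.finite_dimensionE[OF Kf L(3)]] by blast
  have clH: "algebraic_closure F CK.hens" using K.intermediate_algebraic_closure[OF HKs CK.K_hens] .
  have algs: "(F.algebraic over CK.hens) x" if "x \<in> set Us" for x
    using algebraic_closure.alg[OF clH] Us that by blast
  let ?E = "F.finite_extension CK.hens Us"
  have E: "subfield ?E F" using F.finite_extension_is_subfield[OF HKs Us(1) algs] .
  have HE: "CK.hens \<subseteq> ?E" using F.finite_extension_incl[OF P.MR[OF HKs] Us(1)] .
  have UE: "set Us \<subseteq> ?E" using F.finite_extension_mem[OF subfieldE(1)[OF HKs] Us(1)] .
  have "subalgebra K ?E F"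
    using subringE(1,2,5-7)[OF subfieldE(1)[OF E]] HE CK.K_hens by (intro F.subalgebraI[OF Kf]) auto
  then have "L \<subseteq> ?E" using F.subalgebra_Span_incl[OF Kf _ UE] Us(2) by blast
  then have "CL.hens \<subseteq> ?E" using HL(3)[OF E] only_extension_mono[OF HK(2) HE] by blast
  then show "F.finite_dimension CK.hens CL.hens"
    using F.finite_dimension_lower[OF HKs HLs sub] F.finite_extension_finite_dimension(1)[OF HKs Us(1) algs] by blast
qed

lemma (in preval) transversal_res_basis_exist:
  assumes M: "subfield M R" and N: "subfield N R" "M \<subseteq> N" "finite_dimension M N"
  obtains zs Us where "distinct zs" "transversal N M (set zs)" "res_basis N M Us"
proof -
  have NR: "N \<subseteq> carrier R" using MR[OF N(1)] .
  note sub = subfieldE(1)[OF N(1)] and dim = finite_dimensionE[OF M N(3)]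
  have "\<exists>Z\<subseteq>N - {\<zero>}. transversal N M Z"
    using NR cong_refl[OF M] by (intro exists_transversal[OF M]) auto
  then obtain Z where Z: "transversal N M Z" by blast
  then have "finite Z" using val_indep_card(1)[OF M sub dim] unfolding transversal_def by blast
  then obtain zs where "set zs = Z" "distinct zs" using finite_distinct_list by blast
  moreover obtain Us where "res_basis N M Us" using res_basis_exists[OF M sub dim N(2)] by blast
  ultimately show ?thesis using that Z by blast
qed

text \<open>Fundamental inequality with the degree read over an immediate extension
  \<open>M'\<close> of \<open>M\<close>, while indices and residues are those of \<open>N|M\<close>.
  It serves both for henselizations and, with nothing enlarged, for \<open>L|E\<close>.\<close>

lemma (in preval) length_le_immediate_degree:
  assumes M: "subfield M R" "subfield M' R" and imm: "\<And>x. x \<in> M' \<Longrightarrow> x \<noteq> \<zero> \<Longrightarrow> \<exists>c\<in>M. near x c"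
    and N: "subfield N' R" "N \<subseteq> N'" "finite_dimension M' N'"
    and zs: "distinct zs" "transversal N M (set zs)" and U: "res_basis N M Us"
  shows "length zs * length Us \<le> (dim over M') N'"
proof -
  have z: "val_indep M (set zs)" "set zs \<subseteq> N" and u: "res_indep M Us" "set Us \<subseteq> N"
    using zs(2) U unfolding transversal_def res_basis_def by auto
  have "independent M' (prods Us zs)"
    using prods_independent[OF M(2) res_indep_immediate[OF M imm u(1)] zs(1) val_indep_immediate[OF M imm z(1)]] .
  moreover have "set (prods Us zs) \<subseteq> N'"
    using z(2) u(2) N(2) subringE(6)[OF subfieldE(1)[OF N(1)]] by (auto simp: subset_iff)
  ultimately have "length (prods Us zs) \<le> (dim over M') N'"
    using independent_length_le_dimension[OF M(2) finite_dimensionE[OF M(2) N(3)]] by blast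
  then show ?thesis by (simp only: length_prods)
qed

text \<open>Division by zero yields zero, so a defect of one includes positivity of the
  denominator.\<close>

lemma defect_eq_one_iff:
  assumes val: "valuation F G v" and N: "subfield N F" and M: "subfield M F" "M \<subseteq> N"
    and Z: "distinct zs" "preval.transversal F (vle F G v) N M (set zs)"
    and U: "preval.res_basis F (vle F G v) N M Us"
  shows "defect F G v N M = 1 \<longleftrightarrow>
    ring.dim F (henselization F G v M) (henselization F G v N) = length zs * length Us \<and> length zs * length Us > 0"
  unfolding defect_def ramification_index_transversal[OF val N M Z(2)] inertia_degree_res_basis[OF val N M U]
    distinct_card[OF Z(1)] by (auto simp: divide_eq_1_iff simp flip: of_nat_mult)

text \<open>Here \<open>a\<close> and \<open>b\<close> are the products of index and residue degree
  for \<open>E|K\<close> and \<open>L|E\<close>, \<open>c\<close> and \<open>d\<close> are the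
  degrees of the henselizations, and \<open>n\<close> is the degree of \<open>L|E\<close>.
  Positivity permits cancellation.\<close>

lemma degree_sandwich:
  assumes "(a::nat) \<le> c" "b \<le> n" "n \<le> d" "c * d = a * b" "a * b > 0"
  shows "c = a" "n = b"
proof -
  have "a * b \<le> a * n" "a * n \<le> a * d" "a * d \<le> c * d" using assms(1-3) by simp_all
  then have "a * n = a * b" "c * d = a * d" using assms(4) by linarith+
  moreover have "a > 0" "d > 0" using assms(4,5) by (auto intro: Nat.gr0I)
  ultimately show "c = a" "n = b" by simp_all
qed

lemma reduction_to_separable:
  fixes E :: "'a set"
  assumes K: "algebraic_closure F K" and p: "char_p_field F p" and val: "valuation F G v"
    and L: "subfield L F" "K \<subseteq> L" "ring.finite_dimension F K L"
    and def1: "defect F G v L K = 1" and ini: "initial_index F G v L K = ramification_index F G v L K"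
    and E: "E = L \<inter> {x. char_p_field.sep F p K x}"
  shows "subfield E F" "K \<subseteq> E" "ring.finite_dimension F K E" "defect F G v E K = 1"
    and "initial_index F G v E K = ramification_index F G v E K"
    and "\<exists>P. set P \<subseteq> val_ring F G v L \<and>
      (\<forall>x\<in>val_ring F G v L. \<exists>ks. set ks \<subseteq> val_ring F G v E \<and> x = ring.combine F ks P)"
proof -
  interpret F: field F by (rule valuation.axioms(1)) fact
  interpret K: algebraic_closure F K by fact
  interpret C: char_p_field F p by fact
  interpret O: ordered_abelian_group G by (rule valuation.axioms(2)) fact
  interpret V: valuation F G v by fact
  interpret P: preval F "vle F G v" by (rule valuation_preval) fact
  interpret CK: valued_closure F K p "vle F G v" ..
  have Kf: "subfield K F" by (rule K.subfield_axioms)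
  show KE: "K \<subseteq> E" using L(2) CK.sep_base unfolding E by blast
  have "subring E F"
    unfolding E using F.subring_inter[OF subfieldE(1)[OF L(1)] subfieldE(1)[OF CK.sep_subfield]] .
  then show Ef: "subfield E F" using K.intermediate_subfield KE by blast
  have EL: "E \<subseteq> L" unfolding E by blast
  have clE: "algebraic_closure F E" using K.intermediate_algebraic_closure[OF Ef KE] .
  interpret E: algebraic_closure F E by fact
  interpret CE: valued_closure F E p "vle F G v" ..
  have clL: "algebraic_closure F L" using K.intermediate_algebraic_closure[OF L(1,2)] .
  interpret L: algebraic_closure F L by fact
  interpret CL: valued_closure F L p "vle F G v" ..
  have LF: "L \<subseteq> carrier F" using P.MR[OF L(1)] .
  show fKE: "F.finite_dimension K E" using F.finite_dimension_lower[OF Kf Ef KE EL L(3)] .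
  have fEL: "F.finite_dimension E L" using F.finite_dimension_upper[OF Kf Ef KE L(1) EL L(3)] .
  obtain zs1 Us1 where 1: "distinct zs1" "P.transversal E K (set zs1)" "P.res_basis E K Us1"
    using P.transversal_res_basis_exist[OF Kf Ef KE fKE] .
  obtain zs2 Us2 where 2: "distinct zs2" "P.transversal L E (set zs2)" "P.res_basis L E Us2"
    using P.transversal_res_basis_exist[OF Ef L(1) EL fEL] .
  let ?zs = "map (\<lambda>(z, w). z \<otimes>\<^bsub>F\<^esub> w) (List.product zs1 zs2)" and ?Us = "P.prods Us1 Us2"
  note tm = P.transversal_mult[OF Kf Ef KE L(1) EL 1(2) 2(2)]
  have zs: "P.transversal L K (set ?zs)" "distinct ?zs"
    using tm 1(1) 2(1) by (auto simp: distinct_map distinct_product)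
  have Us: "P.res_basis L K ?Us" using P.res_basis_prods[OF Kf Ef KE L(1) EL 1(3) 2(3)] .
  have lens: "length ?zs * length ?Us = (length zs1 * length Us1) * (length zs2 * length Us2)"
    by (simp add: P.length_prods)
  note hK = henselization_hens[OF K p val] and hE = henselization_hens[OF clE p val] and hL = henselization_hens[OF clL p val]
  note sK = CK.hens_subfield and sE = CE.hens_subfield and sL = CL.hens_subfield
  have fin: "F.finite_dimension CK.hens CL.hens" using hens_finite(1)[OF K p val L] .
  have KEh: "CK.hens \<subseteq> CE.hens" using hens_finite(2)[OF K p val Ef KE fKE] .
  have ELh: "CE.hens \<subseteq> CL.hens" using hens_finite(2)[OF clE p val L(1) EL fEL] .
  have fin1: "F.finite_dimension CK.hens CE.hens" using F.finite_dimension_lower[OF sK sE KEh ELh fin] .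
  have fin2: "F.finite_dimension CE.hens CL.hens" using F.finite_dimension_upper[OF sK sE KEh sL ELh fin] .
  have D: "F.dim CK.hens CL.hens = F.dim CK.hens CE.hens * F.dim CE.hens CL.hens"
    using F.telescopic_base_dim(2)[OF sK sE fin1 fin2] unfolding over_def .
  have D': "F.dim CK.hens CL.hens = length ?zs * length ?Us" "length ?zs * length ?Us > 0"
    using def1 defect_eq_one_iff[OF val L(1) Kf L(2) zs(2,1) Us] unfolding hK(1) hL(1) by auto
  have d1: "length zs1 * length Us1 \<le> F.dim CK.hens CE.hens"
    using P.length_le_immediate_degree[OF Kf sK CK.hens_immediate sE CE.K_hens fin1 1] unfolding over_def .
  \<comment> \<open>The trivial immediate extension: every nonzero element is near itself.\<close>
  have "\<exists>c\<in>E. P.near x c" if "x \<in> E" "x \<noteq> \<zero>\<^bsub>F\<^esub>" for x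
    using that P.MR[OF Ef] P.lt_zero by (intro bexI[of _ x]) (auto simp: P.near_def a_minus_def F.r_neg)
  then have d2: "length zs2 * length Us2 \<le> F.dim E L"
    using P.length_le_immediate_degree[OF Ef Ef _ L(1) _ fEL 2] unfolding over_def by blast
  have d3: "F.dim E L \<le> F.dim CE.hens CL.hens"
  proof -
    obtain Bs where Bs: "set Bs \<subseteq> carrier F" "F.independent E Bs" "length Bs = F.dim E L" "F.Span E Bs = L"
      using F.exists_base[OF Ef F.finite_dimensionE[OF Ef fEL]] unfolding over_def by blast
    have BL: "set Bs \<subseteq> L" using F.Span_base_incl[OF Ef Bs(1)] Bs(4) by blast
    have "F.independent {x. C.sep E x} Bs"
    proof (rule CE.pure_independent[OF Bs(2)])
      fix u assume "u \<in> set Bs"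
      then have u: "u \<in> L" "u \<in> carrier F" using BL LF by auto
      \<comment> \<open>The separable power still lies in \<open>L\<close>, hence in
        \<open>E\<close>; so \<open>L|E\<close> is purely inseparable.\<close>
      obtain n where "C.sep K (u [^]\<^bsub>F\<^esub> (p ^ n))" using CK.exists_sep_power[OF u(2)] by blast
      then show "\<exists>n. u [^]\<^bsub>F\<^esub> (p ^ n) \<in> E"
        using F.subring_nat_pow[OF subfieldE(1)[OF L(1)] u(1)] unfolding E by blast
    qed
    \<comment> \<open>The henselization of \<open>E\<close> consists of separable elements, so
      independence over the separable closure of \<open>E\<close> descends to it.\<close>
    moreover have "CE.hens \<subseteq> {x. C.sep E x}" using CE.hens_sep by blast
    ultimately have "F.independent CE.hens Bs"
      using F.independent_mono_field[OF sE CE.sep_subfield] by blast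
    moreover have "set Bs \<subseteq> CL.hens" using BL CL.K_hens by blast
    ultimately show ?thesis
      using F.independent_length_le_dimension[OF sE F.finite_dimensionE[OF sE fin2]] Bs(3) unfolding over_def by metis
  qed
  note sw = degree_sandwich[OF d1 d2 d3 D[unfolded D'(1) lens, symmetric] D'(2)[unfolded lens]]
  have pos: "length zs1 * length Us1 > 0" using D'(2) unfolding lens by simp
  have sw1: "F.dim CK.hens CE.hens = length zs1 * length Us1" and sw2: "F.dim E L = length zs2 * length Us2"
    using sw by blast+
  show "defect F G v E K = 1"
    using defect_eq_one_iff[OF val Ef Kf KE 1] sw1 pos unfolding hK(1) hE(1) by simp
  have vf: "v x = v y \<longleftrightarrow> P.eqv x y" if "x \<in> L - {\<zero>\<^bsub>F\<^esub>}" "y \<in> L - {\<zero>\<^bsub>F\<^esub>}" for x y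
    using vle_eqv[OF val, of x y] that LF by blast
  have full: "P.init_full L K"
    using P.init_full_card[OF Kf LF zs(1) _ vf] ini
    unfolding initial_index_card[OF val LF P.MR[OF Kf]] ramification_index_transversal[OF val L(1) Kf L(2) zs(1)] by simp
  have "P.init_full E K" using P.init_full_lower[OF Kf Ef KE EL LF full] .
  then show "initial_index F G v E K = ramification_index F G v E K"
    using P.init_full_card[OF Kf P.MR[OF Ef] 1(2) _ vf] EL
    unfolding initial_index_card[OF val P.MR[OF Ef] P.MR[OF Kf]] ramification_index_transversal[OF val Ef Kf KE 1(2)] by blast
  have fullE: "P.init_full L E" using P.init_full_upper[OF Kf Ef KE L(1) EL full zs(1)] by simp
  have "P.initial L E \<subseteq> L - {\<zero>\<^bsub>F\<^esub>}" unfolding P.initial_def by blast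
  then obtain Z where Z: "Z \<subseteq> P.initial L E" "P.transversal L E Z"
    using P.exists_transversal[OF Ef _ LF] fullE unfolding P.init_full_def by blast
  have "finite Z"
    using P.val_indep_card(1)[OF Ef subfieldE(1)[OF L(1)] F.finite_dimensionE[OF Ef fEL]] Z(2) unfolding P.transversal_def by blast
  then obtain zs' where zs': "set zs' = Z" "distinct zs'" using finite_distinct_list by blast
  \<comment> \<open>Both lists represent the cosets of \<open>L|E\<close> once each, so the degree
    formula obtained with \<open>zs2\<close> also holds for representatives taken from the initial
    segment.\<close>
  have "length zs' = length zs2"
    using ramification_index_transversal[OF val L(1) Ef EL Z(2)] ramification_index_transversal[OF val L(1) Ef EL 2(2)]
      distinct_card[OF zs'(2)] distinct_card[OF 2(1)] zs'(1) by simp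
  then have dim: "F.dimension (length zs' * length Us2) E L"
    using F.finite_dimensionE[OF Ef fEL] sw2 unfolding over_def by simp
  note O = val_ring_vle[OF val]
  have subr: "subring (val_ring F G v L) F" using val_ring_subring[OF val L(1)] .
  have "set Us2 \<subseteq> val_ring F G v L" using 2(3) unfolding P.res_basis_def P.res_indep_def O by blast
  moreover have "set zs' \<subseteq> val_ring F G v L" using Z(1) zs'(1) unfolding P.initial_def O by blast
  ultimately have "set (P.prods Us2 zs') \<subseteq> val_ring F G v L"
    using subringE(6)[OF subr] by (auto simp: subset_iff)
  moreover have "\<exists>ks. set ks \<subseteq> val_ring F G v E \<and> x = F.combine ks (P.prods Us2 zs')" if "x \<in> val_ring F G v L" for x
  proof -
    have "x \<in> L" "vle F G v \<one>\<^bsub>F\<^esub> x" using that unfolding O by auto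
    from P.integral_generators[OF Ef L(1) EL 2(3) zs'(2) _ _ dim this] Z zs'(1)
    obtain ks where "set ks \<subseteq> E" "\<forall>k\<in>set ks. vle F G v \<one>\<^bsub>F\<^esub> k" "x = F.combine ks (P.prods Us2 zs')" by auto
    then show ?thesis unfolding O by blast
  qed
  ultimately show "\<exists>P. set P \<subseteq> val_ring F G v L \<and>
      (\<forall>x\<in>val_ring F G v L. \<exists>ks. set ks \<subseteq> val_ring F G v E \<and> x = F.combine ks P)" by blast
qed

text \<open>The assertions speak of \<open>\<omega>\<close> on \<open>L\<close>, the defect of its
  extension \<open>v\<close>. Rings and value groups inside \<open>L\<close> do not see the
  difference, so the argument can use \<open>v\<close> throughout.\<close>

lemma finite_valued_extension_agree:
  assumes "finite_valued_extension F L K G \<omega> v" "E \<subseteq> L"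
  shows "val_ring F G \<omega> E = val_ring F G v E" "value_group F \<omega> E = value_group F v E"
proof -
  have e: "\<omega> x = v x" if "x \<in> E - {\<zero>\<^bsub>F\<^esub>}" for x
    using finite_valued_extension.extends[OF assms(1)] assms(2) that by force
  show "val_ring F G \<omega> E = val_ring F G v E" unfolding val_ring_def by (rule Collect_cong) (use e in force)
  show "value_group F \<omega> E = value_group F v E" unfolding value_group_def using e by (rule image_cong[OF refl])
qed

theorem corollary5p3:
  assumes A: "\<forall>(F :: 'a ring) L K (G :: 'g ordered_group) \<omega> v.
      finite_valued_extension F L K G \<omega> v \<and> separable_extension F L K \<and>
      defect F G v L K = 1 \<and> initial_index F G \<omega> L K = ramification_index F G \<omega> L K \<longrightarrow>
      essentially_finitely_generated (F\<lparr>carrier := val_ring F G \<omega> L\<rparr>) (val_ring F G \<omega> K)"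
  shows "\<forall>(F :: 'a ring) L K (G :: 'g ordered_group) \<omega> v.
      finite_valued_extension F L K G \<omega> v \<and>
      defect F G v L K = 1 \<and> initial_index F G \<omega> L K = ramification_index F G \<omega> L K \<longrightarrow>
      essentially_finitely_generated (F\<lparr>carrier := val_ring F G \<omega> L\<rparr>) (val_ring F G \<omega> K)"
proof (intro allI impI, elim conjE)
  fix F :: "'a ring" and L K and G :: "'g ordered_group" and \<omega> v
  assume fve: "finite_valued_extension F L K G \<omega> v" and def1: "defect F G v L K = 1"
    and ini: "initial_index F G \<omega> L K = ramification_index F G \<omega> L K"
  have clL: "algebraic_closure F L" and Kf: "subfield K F" and KL: "K \<subseteq> L"
    and fin: "ring.finite_dimension F K L" and val: "valuation F G v"
    using fve unfolding finite_valued_extension_def by auto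
  have Lf: "subfield L F" using algebraic_closure.axioms(2)[OF clL] .
  have cl: "algebraic_closure F K" using algebraic_closure.lower_algebraic_closure[OF clL Kf KL fin] .
  interpret K: algebraic_closure F K by fact
  show "essentially_finitely_generated (F\<lparr>carrier := val_ring F G \<omega> L\<rparr>) (val_ring F G \<omega> K)"
  proof (cases "\<exists>n>0. add_pow F (n::nat) \<one>\<^bsub>F\<^esub> = \<zero>\<^bsub>F\<^esub>")
    case False
    then have simple: "K.alg_mult (K.Irr K x) a \<le> 1" if "x \<in> carrier F" "a \<in> carrier F" for x a
      using K.char_0_simple_roots that by blast
    have "separable_extension F L K"
      unfolding separable_extension_def
      using simple K.algebraic_extension subfieldE(3)[OF Lf] unfolding over_def by blast
    then show ?thesis using A fve def1 ini by blast
  next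
    case True
    then obtain p where "normalization_semidom_class.prime p" "add_pow F (p::nat) \<one>\<^bsub>F\<^esub> = \<zero>\<^bsub>F\<^esub>"
      using K.minimal_char_prime by blast
    then have p: "char_p_field F p"
      by (intro char_p_field.intro K.field_axioms char_p_field_axioms.intro)
    interpret char_p_field F p by (rule p)
    interpret C: char_p_closure F K p ..
    define E where "E = L \<inter> {x. sep K x}"
    have EL: "E \<subseteq> L" unfolding E_def by blast
    have ini': "initial_index F G v L K = ramification_index F G v L K"
      using ini finite_valued_extension_agree[OF fve] KL
      unfolding initial_index_def ramification_index_def by simp
    note red = reduction_to_separable[OF cl p val Lf KL fin def1 ini' E_def]
    \<comment> \<open>The ambient field and the valuation are kept, with \<open>v\<close> also in
      the role of \<open>\<omega>\<close>; so assertion (A) is applied at the same types.\<close>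
    have fveE: "finite_valued_extension F E K G v v"
      using K.intermediate_algebraic_closure[OF red(1,2)] Kf red(2,3) valuation_subfield[OF val red(1)] val
      by (intro finite_valued_extension.intro) auto
    have "separable_extension F E K"
      unfolding separable_extension_def
      using C.sep_simple_roots K.algebraic_extension subfieldE(3)[OF red(1)]
      unfolding E_def over_def by blast
    then have efg: "essentially_finitely_generated (F\<lparr>carrier := val_ring F G v E\<rparr>) (val_ring F G v K)"
      using A fveE red(4,5) by blast
    obtain P where P: "set P \<subseteq> val_ring F G v L"
      "\<And>x. x \<in> val_ring F G v L \<Longrightarrow> \<exists>ks. set ks \<subseteq> val_ring F G v E \<and> x = ring.combine F ks P"
      using red(6) by blast
    have "val_ring F G v E \<subseteq> val_ring F G v L" "val_ring F G v K \<subseteq> val_ring F G v E"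
      using EL red(2) unfolding val_ring_def by auto
    then have "essentially_finitely_generated (F\<lparr>carrier := val_ring F G v L\<rparr>) (val_ring F G v K)"
      using essentially_finitely_generated_finite[OF K.field_axioms val_ring_subring[OF val red(1)]
          val_ring_subring[OF val Lf] _ _ efg P] by blast
    then show ?thesis using finite_valued_extension_agree(1)[OF fve] KL by simp
  qed
qed

end
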